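(* Let $f\in\mathscr F^n$, $g\in C^0(\overline I\times\mathbb R^n\times\mathbb R;\mathbb R)$ and $u_o\in L^\infty(\mathbb R^n;\mathbb R)$. Let $u\in L^\infty(I\times\mathbb R^n;\mathbb R)$ be a distributional solution to the Cauchy problem $\partial_tu+\operatorname{div}_xf(t,x,u)=g(t,x,u)$, $u(0,x)=u_o(x)$. Let $\widehat\mu(\xi)=\int_{\mathbb R}\mu_k\,e^{-i\xi k}\,dk$ for $\xi\in\mathbb C$. Then: (FT.1) $\widehat\mu$ is an entire function defined on $\mathbb C$ with values in $\mathcal D'(I\times\mathbb R^n;\mathbb C)$. (FT.2) Setting, for $\xi\in\mathbb C$ and $k\in\mathbb R$, $$\mathcal E_\xi(k)=-2\,\frac{e^{-i\xi k}-1+i\xi k}{\xi^2}$$ (extended by continuity at $\xi=0$, i.e. $\mathcal E_0(k)=k^2$), one has $\widehat\mu(\xi)=\mathcal M_u(\mathcal E_\xi)$ for all $\xi\in\mathbb C$.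
   Context: Let $n\ge1$ be an integer and let $I=[0,+\infty)$ or $I=[0,T)$ for some $T>0$, with closure $\overline I$. $\nabla_x$ and $\operatorname{div}_x$ applied to functions of $(t,x,u)$ denote derivatives with respect to $x$ only, with $t$ and $u$ fixed. $\mathcal D(I\times\mathbb R^n;\mathbb C)=C_c^\infty(I\times\mathbb R^n;\mathbb C)$, where compact support means that the support is a compact subset of $I\times\mathbb R^n$ (so $\varphi(0,\cdot)$ need not vanish), and $\mathcal D'(I\times\mathbb R^n;\mathbb C)$ is the corresponding space of distributions. $\mathscr F$ is the set of $\zeta\in C^1(\overline I\times\mathbb R^n\times\mathbb R;\mathbb R)$, with variables $(t,x,u)$, such that $\partial^2_{tu}\zeta$ and $\nabla_x\partial_u\zeta$ are continuous on $\overline I\times\mathbb R^n\times\mathbb R$; $\mathscr F^n$ is the analogous space of $\mathbb R^n$-valued functions. Distributional solution: for all $\varphi\in C^1_c(I\times\mathbb R^n;\mathbb R)$, $$\int_I\int_{\mathbb R^n}\big(u\,\partial_t\varphi+f(t,x,u)\cdot\nabla_x\varphi\big)dx\,dt+\int_I\int_{\mathbb R^n}g(t,x,u)\,\varphi\,dx\,dt+\int_{\mathbb R^n}u_o(x)\varphi(0,x)\,dx=0 .$$ Entropy production: for $E\in C^1(\mathbb R;\mathbb C)$ let $F\in\mathscr F^n+i\mathscr F^n$ be any function with $\partial_uF(t,x,u)=E'(u)\,\partial_uf(t,x,u)$ (the choice is irrelevant; e.g. $F=\int_0^uE'(w)\partial_uf(t,x,w)dw$); for $\varphi\in\mathcal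 D(I\times\mathbb R^n;\mathbb C)$ (complex valued entropies and test functions are used, everything being linear) $$(\mathcal M_u(E))(\varphi)=\int_I\int_{\mathbb R^n}\big(E(u)\,\partial_t\varphi+F(t,x,u)\cdot\nabla_x\varphi\big)dx\,dt-\int_I\int_{\mathbb R^n}E'(u)\,(\operatorname{div}_xf)(t,x,u)\,\varphi\,dx\,dt$$ $$+\int_I\int_{\mathbb R^n}(\operatorname{div}_xF)(t,x,u)\,\varphi\,dx\,dt+\int_I\int_{\mathbb R^n}E'(u)\,g(t,x,u)\,\varphi\,dx\,dt+\int_{\mathbb R^n}E(u_o(x))\,\varphi(0,x)\,dx .$$ Kruzhkov entropy production: with $\operatorname{sgn}z=1,0,-1$ for $z>0$, $z=0$, $z<0$ and $\Phi(t,x,u,k)=\operatorname{sgn}(u-k)\,(f(t,x,u)-f(t,x,k))$, for $k\in\mathbb R$ $$\mu_k(\varphi)=\int_I\int_{\mathbb R^n}\big(|u-k|\,\partial_t\varphi+\Phi(t,x,u,k)\cdot\nabla_x\varphi\big)dx\,dt-\int_I\int_{\mathbb R^n}\operatorname{sgn}(u-k)\,\operatorname{div}_xf(t,x,k)\,\varphi\,dx\,dt$$ $$+\int_I\int_{\mathbb R^n}\operatorname{sgn}(u-k)\,g(t,x,u)\,\varphi\,dx\,dt+\int_{\mathbb R^n}|u_o(x)-k|\,\varphi(0,x)\,dx .$$ In all formulas $u=u(t,x)$ and $\varphi=\varphi(t,x)$. For a distributional solution $u$, $\mu_k=0$ if $k\le\operatorname{ess\,inf}u$ or $k\ge\operatorname{ess\,sup}u$,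 so the integral defining $\widehat\mu$ is over a bounded set; it is the distribution $\varphi\mapsto\int_{\mathbb R}\mu_k(\varphi)e^{-i\xi k}dk$. A $\mathcal D'$-valued map is entire in the sense that $\xi\mapsto(\widehat\mu(\xi))(\varphi)$ is entire for every $\varphi\in\mathcal D(I\times\mathbb R^n;\mathbb C)$. *)

theory Defs
  imports "HOL-Complex_Analysis.Complex_Analysis"
begin

section \<open>Partial derivatives, test functions and distributions\<close>

text \<open>
  Functions on a set \<open>S\<close> are total functions whose values outside \<open>S\<close> are irrelevant.
  Derivatives are taken within \<open>S\<close>; for the sets used below, products of a nondegenerate
  interval with full Euclidean spaces, this means one-sided time derivatives at the ends of
  the interval and ordinary derivatives elsewhere.
\<close>

definition has_pd_on ::
  "'a::real_normed_vector set \<Rightarrow> 'a \<Rightarrow> ('a \<Rightarrow> 'b::real_normed_vector) \<Rightarrow> bool" where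
  "has_pd_on S v h \<longleftrightarrow>
     (\<forall>p\<in>S. (\<lambda>s::real. h (p + s *\<^sub>R v)) differentiable (at 0 within {s. p + s *\<^sub>R v \<in> S}))"

definition pd ::
  "'a::real_normed_vector set \<Rightarrow> 'a \<Rightarrow> ('a \<Rightarrow> 'b::real_normed_vector) \<Rightarrow> 'a \<Rightarrow> 'b" where
  "pd S v h p = vector_derivative (\<lambda>s. h (p + s *\<^sub>R v)) (at 0 within {s. p + s *\<^sub>R v \<in> S})"

primrec Ck_on ::
  "nat \<Rightarrow> 'a::euclidean_space set \<Rightarrow> ('a \<Rightarrow> 'b::real_normed_vector) \<Rightarrow> bool" where
  "Ck_on 0 S h \<longleftrightarrow> continuous_on S h"
| "Ck_on (Suc k) S h \<longleftrightarrow>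
     continuous_on S h \<and> (\<forall>b\<in>Basis. has_pd_on S b h \<and> Ck_on k S (pd S b h))"

definition compactly_supported_on ::
  "'a::euclidean_space set \<Rightarrow> ('a \<Rightarrow> 'b::real_normed_vector) \<Rightarrow> bool" where
  "compactly_supported_on S h \<longleftrightarrow>
     compact (closure (support_on S h)) \<and> closure (support_on S h) \<subseteq> S"

definition Ckc ::
  "nat \<Rightarrow> 'a::euclidean_space set \<Rightarrow> ('a \<Rightarrow> 'b::real_normed_vector) set" where
  "Ckc k S = {h. Ck_on k S h \<and> compactly_supported_on S h}"

definition test_functions :: "'a::euclidean_space set \<Rightarrow> ('a \<Rightarrow> complex) set" where
  "test_functions S = {h. (\<forall>k. Ck_on k S h) \<and> compactly_supported_on S h}"

text \<open>
  Continuity is expressed by the usual seminorm estimates on compact sets. Multi-indices of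
  order at most \<open>N\<close> are replaced by lists of at most \<open>N\<close> basis directions, so that mixed
  derivatives are counted repeatedly, which only affects the constant.
  The estimate also makes the functional independent of the values of \<open>\<phi>\<close> outside \<open>S\<close>.
\<close>

definition distribution_on ::
  "'a::euclidean_space set \<Rightarrow> (('a \<Rightarrow> complex) \<Rightarrow> complex) \<Rightarrow> bool" where
  "distribution_on S L \<longleftrightarrow>
     (\<forall>\<phi>\<in>test_functions S. \<forall>\<psi>\<in>test_functions S. L (\<lambda>p. \<phi> p + \<psi> p) = L \<phi> + L \<psi>) \<and>
     (\<forall>c. \<forall>\<phi>\<in>test_functions S. L (\<lambda>p. c * \<phi> p) = c * L \<phi>) \<and>
     (\<forall>K. compact K \<and> K \<subseteq> S \<longrightarrow>
        (\<exists>C N. \<forall>\<phi>\<in>test_functions S. support_on S \<phi> \<subseteq> K \<longrightarrow>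
           cmod (L \<phi>) \<le>
             C * (\<Sum>vs | set vs \<subseteq> Basis \<and> length vs \<le> N.
                    SUP p\<in>S. cmod (foldr (pd S) vs \<phi> p))))"

definition Linfty :: "'a measure \<Rightarrow> ('a \<Rightarrow> real) \<Rightarrow> bool" where
  "Linfty M h \<longleftrightarrow> h \<in> borel_measurable M \<and> (\<exists>C. AE p in M. \<bar>h p\<bar> \<le> C)"


section \<open>The balance law\<close>

type_synonym 'n point = "real \<times> (real^'n)"
type_synonym 'n state = "real \<times> (real^'n) \<times> real"

abbreviation Om :: "real set \<Rightarrow> ('n::finite) point set" where
  "Om I \<equiv> I \<times> UNIV"

abbreviation flux_dom :: "real set \<Rightarrow> ('n::finite) state set" where
  "flux_dom I \<equiv> closure I \<times> UNIV \<times> UNIV"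

abbreviation dt ::
  "real set \<Rightarrow> (('n::finite) point \<Rightarrow> 'b::real_normed_vector) \<Rightarrow> 'n point \<Rightarrow> 'b" where
  "dt I \<phi> \<equiv> pd (Om I) (1, 0) \<phi>"

abbreviation dx ::
  "real set \<Rightarrow> 'n \<Rightarrow> (('n::finite) point \<Rightarrow> 'b::real_normed_vector) \<Rightarrow> 'n point \<Rightarrow> 'b" where
  "dx I i \<phi> \<equiv> pd (Om I) (0, axis i 1) \<phi>"

abbreviation du ::
  "real set \<Rightarrow> (('n::finite) state \<Rightarrow> 'b::real_normed_vector) \<Rightarrow> 'n state \<Rightarrow> 'b" where
  "du I h \<equiv> pd (flux_dom I) (0, 0, 1) h"

definition div_x ::
  "real set \<Rightarrow> (('n::finite) state \<Rightarrow> ('b::real_normed_vector)^'n) \<Rightarrow> 'n state \<Rightarrow> 'b" where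
  "div_x I h p = (\<Sum>i\<in>UNIV. pd (flux_dom I) (0, axis i 1, 0) (\<lambda>q. h q $ i) p)"

text \<open>
  The class \<open>\<F>\<close>, for an arbitrary value space: \<open>real^'n\<close> gives \<open>\<F>\<^sup>n\<close> and
  \<open>complex^'n\<close> gives \<open>\<F>\<^sup>n + \<i>\<F>\<^sup>n\<close>. No second derivative in \<open>u\<close> is assumed.
\<close>

definition flux_class ::
  "real set \<Rightarrow> (('n::finite) state \<Rightarrow> 'b::real_normed_vector) \<Rightarrow> bool" where
  "flux_class I h \<longleftrightarrow>
     Ck_on 1 (flux_dom I) h \<and>
     has_pd_on (flux_dom I) (1, 0, 0) (du I h) \<and>
     continuous_on (flux_dom I) (pd (flux_dom I) (1, 0, 0) (du I h)) \<and>
     (\<forall>i. has_pd_on (flux_dom I) (0, axis i 1, 0) (du I h) \<and>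
          continuous_on (flux_dom I) (pd (flux_dom I) (0, axis i 1, 0) (du I h)))"

definition distributional_solution ::
  "real set \<Rightarrow> (('n::finite) state \<Rightarrow> real^'n) \<Rightarrow> ('n state \<Rightarrow> real) \<Rightarrow>
   (real^'n \<Rightarrow> real) \<Rightarrow> ('n point \<Rightarrow> real) \<Rightarrow> bool" where
  "distributional_solution I f g uo u \<longleftrightarrow>
     (\<forall>\<phi> :: 'n point \<Rightarrow> real. \<phi> \<in> Ckc 1 (Om I) \<longrightarrow>
        (LINT (t, x):Om I|lebesgue.
            u (t, x) * dt I \<phi> (t, x)
            + (\<Sum>i\<in>UNIV. f (t, x, u (t, x)) $ i * dx I i \<phi> (t, x)))
        + (LINT (t, x):Om I|lebesgue. g (t, x, u (t, x)) * \<phi> (t, x))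
        + (LINT x|lebesgue. uo x * \<phi> (0, x)) = 0)"


section \<open>Entropy productions\<close>

definition entropy_pair ::
  "real set \<Rightarrow> (('n::finite) state \<Rightarrow> real^'n) \<Rightarrow>
   (real \<Rightarrow> complex) \<Rightarrow> ('n state \<Rightarrow> complex^'n) \<Rightarrow> bool" where
  "entropy_pair I f E F \<longleftrightarrow>
     Ck_on 1 UNIV E \<and> flux_class I F \<and>
     (\<forall>t\<in>closure I. \<forall>x w. \<forall>i.
        du I F (t, x, w) $ i
        = vector_derivative E (at w) * complex_of_real (du I f (t, x, w) $ i))"

text \<open>
  The entropy production \<open>\<M>\<^sub>u(E)\<close>, computed with the entropy flux \<open>F\<close>. The dot product
  with \<open>\<nabla>\<^sub>x\<phi>\<close> is complex bilinear, hence written out.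
\<close>

definition entropy_production ::
  "real set \<Rightarrow> (('n::finite) state \<Rightarrow> real^'n) \<Rightarrow> ('n state \<Rightarrow> real) \<Rightarrow>
   (real^'n \<Rightarrow> real) \<Rightarrow> ('n point \<Rightarrow> real) \<Rightarrow>
   (real \<Rightarrow> complex) \<Rightarrow> ('n state \<Rightarrow> complex^'n) \<Rightarrow> ('n point \<Rightarrow> complex) \<Rightarrow> complex" where
  "entropy_production I f g uo u E F \<phi> =
     (LINT (t, x):Om I|lebesgue.
         E (u (t, x)) * dt I \<phi> (t, x)
         + (\<Sum>i\<in>UNIV. F (t, x, u (t, x)) $ i * dx I i \<phi> (t, x)))
     - (LINT (t, x):Om I|lebesgue.
         vector_derivative E (at (u (t, x)))
         * complex_of_real (div_x I f (t, x, u (t, x))) * \<phi> (t, x))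
     + (LINT (t, x):Om I|lebesgue. div_x I F (t, x, u (t, x)) * \<phi> (t, x))
     + (LINT (t, x):Om I|lebesgue.
         vector_derivative E (at (u (t, x)))
         * complex_of_real (g (t, x, u (t, x))) * \<phi> (t, x))
     + (LINT x|lebesgue. E (uo x) * \<phi> (0, x))"

definition Kruzhkov_flux ::
  "(('n::finite) state \<Rightarrow> real^'n) \<Rightarrow> real \<Rightarrow> real^'n \<Rightarrow> real \<Rightarrow> real \<Rightarrow> real^'n" where
  "Kruzhkov_flux f t x w k = sgn (w - k) *\<^sub>R (f (t, x, w) - f (t, x, k))"

definition Kruzhkov_production ::
  "real set \<Rightarrow> (('n::finite) state \<Rightarrow> real^'n) \<Rightarrow> ('n state \<Rightarrow> real) \<Rightarrow>
   (real^'n \<Rightarrow> real) \<Rightarrow> ('n point \<Rightarrow> real) \<Rightarrow> real \<Rightarrow> ('n point \<Rightarrow> complex) \<Rightarrow> complex" where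
  "Kruzhkov_production I f g uo u k \<phi> =
     (LINT (t, x):Om I|lebesgue.
         complex_of_real \<bar>u (t, x) - k\<bar> * dt I \<phi> (t, x)
         + (\<Sum>i\<in>UNIV. complex_of_real (Kruzhkov_flux f t x (u (t, x)) k $ i) * dx I i \<phi> (t, x)))
     - (LINT (t, x):Om I|lebesgue.
         complex_of_real (sgn (u (t, x) - k) * div_x I f (t, x, k)) * \<phi> (t, x))
     + (LINT (t, x):Om I|lebesgue.
         complex_of_real (sgn (u (t, x) - k) * g (t, x, u (t, x))) * \<phi> (t, x))
     + (LINT x|lebesgue. complex_of_real \<bar>uo x - k\<bar> * \<phi> (0, x))"

definition mu_hat ::
  "real set \<Rightarrow> (('n::finite) state \<Rightarrow> real^'n) \<Rightarrow> ('n state \<Rightarrow> real) \<Rightarrow>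
   (real^'n \<Rightarrow> real) \<Rightarrow> ('n point \<Rightarrow> real) \<Rightarrow> complex \<Rightarrow> ('n point \<Rightarrow> complex) \<Rightarrow> complex" where
  "mu_hat I f g uo u \<xi> \<phi> =
     (LINT k|lebesgue.
        Kruzhkov_production I f g uo u k \<phi> * exp (- \<i> * \<xi> * complex_of_real k))"

definition exp_entropy :: "complex \<Rightarrow> real \<Rightarrow> complex" where
  "exp_entropy \<xi> k =
     (if \<xi> = 0 then complex_of_real (k\<^sup>2)
      else - 2 * ((exp (- \<i> * \<xi> * complex_of_real k) - 1 + \<i> * \<xi> * complex_of_real k) / \<xi>\<^sup>2))"

end

theory Submission
  imports Defs
begin

text \<open>
  Both sides of the claimed identity pair \<open>u\<close> and \<open>u\<^sub>o\<close> with a test function in the same way,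
  namely as \<open>\<integral>\<integral> (c\<^sub>0 \<partial>\<^sub>t\<phi> + c\<^sub>1 \<cdot> \<nabla>\<^sub>x\<phi> + c\<^sub>2 \<phi>) + \<integral> c\<^sub>3 \<phi>(0, \<cdot>)\<close> with locally bounded measurable
  coefficients (\<open>first_order\<close>). By Fubini the integral over \<open>k\<close> may therefore be taken inside the
  coefficients, where it is an elementary computation at each point. Let \<open>e(k) = exp(-i \<xi> k)\<close> and
  let \<open>R\<close> bound \<open>\<bar>u\<bar>\<close> and \<open>\<bar>u\<^sub>o\<bar>\<close>. For \<open>\<bar>v\<bar> \<le> R\<close> one has
  \<open>\<integral>\<^bsub>[-R,R]\<^esub> sgn(v - k) h(k) dk = 2 \<integral>\<^bsub>[0,v]\<^esub> h - c\<close> with \<open>c\<close> independent of \<open>v\<close>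
  (\<open>set_integral_sgn_kernel\<close>), and \<open>\<E>\<^sub>\<xi>'' = 2 e\<close>, \<open>\<E>\<^sub>\<xi>(0) = \<E>\<^sub>\<xi>'(0) = 0\<close>. Hence the integral of
  \<open>\<bar>u - k\<bar> e(k)\<close> is \<open>\<E>\<^sub>\<xi>(u) + A + B u\<close>, that of the Kruzhkov flux is \<open>F(u) + B f(u)\<close> plus a vector field
  independent of \<open>u\<close>, where \<open>F\<close> is an entropy flux of \<open>\<E>\<^sub>\<xi>\<close>, and the zeroth-order terms match
  in the same way (\<open>Fourier_Kruzhkov\<close>).

  The surplus terms pair to zero with every test function: the constant \<open>A\<close> by integration by
  parts in time (\<open>first_order_time\<close>), the multiple of \<open>B\<close> because \<open>u\<close> solves the equation
  (\<open>first_order_solution\<close>), and a field independent of \<open>u\<close> by integration by parts in space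
  (\<open>first_order_divergence\<close>). The same three facts show that the Kruzhkov production vanishes for
  \<open>\<bar>k\<bar> > R\<close> (\<open>Kruzhkov_production_eq_0\<close>), so that the transform is an integral over a bounded set and
  therefore entire, and that replacing \<open>F\<close> by another entropy flux, which differs from it by a field
  independent of \<open>u\<close>, changes nothing (\<open>entropy_production_eq_std\<close>). Finally, a first-order
  functional is visibly a distribution (\<open>distribution_on_first_order\<close>).

  Two points need care. The flux \<open>F(u) = \<integral>\<^bsub>[0,u]\<^esub> \<E>\<^sub>\<xi>'(w) \<partial>\<^sub>u f(w) dw\<close> is used in the form
  \<open>\<E>\<^sub>\<xi>'(u) f(u) - 2 \<integral>\<^bsub>[0,u]\<^esub> e(w) f(w) dw\<close>, whose derivatives in \<open>(t, x)\<close> exist because \<open>f\<close> is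
  continuously differentiable. And Fubini needs measurability in \<open>(k, t, x)\<close> for the product
  \<open>\<sigma>\<close>-algebra, which a Lebesgue measurable \<open>u\<close> does not provide; so \<open>u\<close> and \<open>u\<^sub>o\<close> are first replaced by
  bounded Borel functions equal to them almost everywhere.
\<close>

section \<open>Directional derivatives within a set\<close>

text \<open>
  The derivative along \<open>v\<close> within \<open>S\<close> as a relation, which can be composed by the usual rules;
  \<open>thick\<close> below supplies the uniqueness that turns it into an equation for the function \<open>pd\<close>.
\<close>

definition has_pd ::
  "'a::real_normed_vector set \<Rightarrow> 'a \<Rightarrow> ('a \<Rightarrow> 'b::real_normed_vector) \<Rightarrow> ('a \<Rightarrow> 'b) \<Rightarrow> bool"
where
  "has_pd S v h d \<longleftrightarrow>
     (\<forall>p\<in>S. ((\<lambda>s::real. h (p + s *\<^sub>R v)) has_vector_derivative d p)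
        (at 0 within {s. p + s *\<^sub>R v \<in> S}))"

text \<open>
  The segments of \<open>S\<close> in direction \<open>v\<close> do not degenerate to points, which makes derivatives along \<open>v\<close>
  within \<open>S\<close> unique.
\<close>

definition thick :: "'a::real_normed_vector set \<Rightarrow> 'a \<Rightarrow> bool" where
  "thick S v \<longleftrightarrow> (\<forall>p\<in>S. at 0 within {s. p + s *\<^sub>R v \<in> S} \<noteq> bot)"

lemma convex_line_section:
  assumes "convex S"
  shows "convex {s. p + s *\<^sub>R v \<in> S}"
proof (rule convexI)
  fix r s a b :: real
  assume "r \<in> {s. p + s *\<^sub>R v \<in> S}" "s \<in> {s. p + s *\<^sub>R v \<in> S}" and ab: "0 \<le> a" "0 \<le> b" "a + b = 1"
  then have "a *\<^sub>R (p + r *\<^sub>R v) + b *\<^sub>R (p + s *\<^sub>R v) \<in> S"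
    using convexD[OF assms] by simp
  also have "a *\<^sub>R (p + r *\<^sub>R v) + b *\<^sub>R (p + s *\<^sub>R v) = (a + b) *\<^sub>R p + (a * r + b * s) *\<^sub>R v"
    by (simp add: algebra_simps)
  finally show "a *\<^sub>R r + b *\<^sub>R s \<in> {s. p + s *\<^sub>R v \<in> S}"
    using ab by simp
qed

lemma thick_convex:
  assumes "convex S" "\<And>p. p \<in> S \<Longrightarrow> \<exists>s. s \<noteq> 0 \<and> p + s *\<^sub>R v \<in> S"
  shows "thick S v"
  unfolding thick_def
proof
  fix p assume p: "p \<in> S"
  let ?L = "{s. p + s *\<^sub>R v \<in> S}"
  have "convex ?L" using assms(1) by (rule convex_line_section)
  then have c: "connected ?L" by (rule convex_connected)
  obtain s where s: "s \<noteq> 0" "s \<in> ?L" using assms(2)[OF p] by blast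
  then have "0 islimpt ?L"
  proof (intro connected_imp_perfect)
    show "?L \<noteq> {x}" for x
    proof
      assume "?L = {x}"
      moreover have "0 \<in> ?L" using p by simp
      ultimately show False using s by auto
    qed
  qed (use c p in auto)
  then show "at 0 within ?L \<noteq> bot" by (simp add: trivial_limit_within)
qed

lemma has_pd_pd: "has_pd_on S v h \<Longrightarrow> has_pd S v h (pd S v h)"
  unfolding has_pd_on_def has_pd_def pd_def by (simp flip: vector_derivative_works)

lemma has_pd_imp_has_pd_on: "has_pd S v h d \<Longrightarrow> has_pd_on S v h"
  unfolding has_pd_on_def has_pd_def by (blast intro: differentiableI_vector)

lemma has_pd_imp_pd_eq: "has_pd S v h d \<Longrightarrow> thick S v \<Longrightarrow> p \<in> S \<Longrightarrow> pd S v h p = d p"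
  unfolding has_pd_def thick_def pd_def by (simp add: vector_derivative_within)

lemma has_pd_cong:
  assumes "has_pd S v h d" "\<And>p. p \<in> S \<Longrightarrow> h' p = h p" "\<And>p. p \<in> S \<Longrightarrow> d' p = d p"
  shows "has_pd S v h' d'"
  unfolding has_pd_def
proof
  fix p assume p: "p \<in> S"
  with assms have "((\<lambda>s. h (p + s *\<^sub>R v)) has_vector_derivative d' p) (at 0 within {s. p + s *\<^sub>R v \<in> S})"
    by (simp add: has_pd_def)
  then show "((\<lambda>s. h' (p + s *\<^sub>R v)) has_vector_derivative d' p) (at 0 within {s. p + s *\<^sub>R v \<in> S})"
    unfolding has_vector_derivative_def
    by (rule has_derivative_transform[rotated 2]) (use p assms(2) in auto)
qed

lemma has_pd_add:
  "has_pd S v h d \<Longrightarrow> has_pd S v h' d' \<Longrightarrow> has_pd S v (\<lambda>p. h p + h' p) (\<lambda>p. d p + d' p)"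
  unfolding has_pd_def by (auto intro!: has_vector_derivative_add)

lemma has_pd_diff:
  "has_pd S v h d \<Longrightarrow> has_pd S v h' d' \<Longrightarrow> has_pd S v (\<lambda>p. h p - h' p) (\<lambda>p. d p - d' p)"
  unfolding has_pd_def by (auto intro!: has_vector_derivative_diff)

lemma has_pd_mult:
  fixes h h' :: "'a::real_normed_vector \<Rightarrow> 'b::real_normed_algebra"
  assumes "has_pd S v h d" "has_pd S v h' d'"
  shows "has_pd S v (\<lambda>p. h p * h' p) (\<lambda>p. h p * d' p + d p * h' p)"
  unfolding has_pd_def
proof
  fix p assume p: "p \<in> S"
  show "((\<lambda>s. h (p + s *\<^sub>R v) * h' (p + s *\<^sub>R v)) has_vector_derivative h p * d' p + d p * h' p)
     (at 0 within {s. p + s *\<^sub>R v \<in> S})"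
    using has_vector_derivative_mult[OF assms[unfolded has_pd_def, rule_format, OF p]] by simp
qed

lemma has_pd_bounded_linear:
  assumes "bounded_linear L" "has_pd S v h d"
  shows "has_pd S v (\<lambda>p. L (h p)) (\<lambda>p. L (d p))"
  using assms(2) bounded_linear.has_vector_derivative[OF assms(1)] unfolding has_pd_def by blast

text \<open>
  The derivative at parameter \<open>s\<close> on the line through \<open>p\<close> is the one at parameter \<open>0\<close> on the same line
  based at \<open>p + s v\<close>. This is what lets the fundamental theorem of calculus be applied along lines.
\<close>

lemma has_pd_at:
  assumes "has_pd S v h d" "p + s *\<^sub>R v \<in> S"
  shows "((\<lambda>r. h (p + r *\<^sub>R v)) has_vector_derivative d (p + s *\<^sub>R v))
           (at s within {r. p + r *\<^sub>R v \<in> S})"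
proof -
  let ?q = "p + s *\<^sub>R v"
  have im: "(\<lambda>r. r - s) ` {r. p + r *\<^sub>R v \<in> S} = {r. ?q + r *\<^sub>R v \<in> S}"
  proof (intro equalityI subsetI)
    fix r assume "r \<in> {r. ?q + r *\<^sub>R v \<in> S}"
    then show "r \<in> (\<lambda>r. r - s) ` {r. p + r *\<^sub>R v \<in> S}"
      by (intro image_eqI[where x = "r + s"]) (auto simp: algebra_simps)
  qed (auto simp: algebra_simps)
  have "((\<lambda>r. h (?q + r *\<^sub>R v)) has_vector_derivative d ?q) (at (s - s) within (\<lambda>r. r - s) ` {r. p + r *\<^sub>R v \<in> S})"
    unfolding im using assms by (simp add: has_pd_def)
  moreover have "((\<lambda>r. r - s) has_vector_derivative 1) (at s within {r. p + r *\<^sub>R v \<in> S})"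
    by (auto intro!: derivative_eq_intros)
  ultimately have "((\<lambda>r. h (?q + r *\<^sub>R v)) \<circ> (\<lambda>r. r - s) has_vector_derivative 1 *\<^sub>R d ?q)
      (at s within {r. p + r *\<^sub>R v \<in> S})"
    by (intro vector_diff_chain_within)
  then show ?thesis by (simp add: o_def algebra_simps)
qed

lemma Ck_on_Suc_0_iff:
  "Ck_on (Suc 0) S h \<longleftrightarrow>
     continuous_on S h \<and> (\<forall>b\<in>Basis. has_pd_on S b h \<and> continuous_on S (pd S b h))"
  by simp

lemma pd_eq_0_off_support:
  assumes "thick S v" "p \<in> S" "p \<notin> closure (support_on S h)"
  shows "((\<lambda>s. h (p + s *\<^sub>R v)) has_vector_derivative 0) (at 0 within {s. p + s *\<^sub>R v \<in> S})"
    and "pd S v h p = 0"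
proof -
  let ?L = "{s. p + s *\<^sub>R v \<in> S}"
  have "open ((\<lambda>s. p + s *\<^sub>R v) -` (- closure (support_on S h)))"
    by (intro open_vimage) (auto intro!: continuous_intros)
  then have ev: "\<forall>\<^sub>F s in at 0 within ?L. p + s *\<^sub>R v \<notin> closure (support_on S h)"
    using assms(3) by (auto simp: eventually_at_topological)
  have "\<forall>\<^sub>F s in at 0 within ?L. s \<in> ?L"
    by (simp add: eventually_at_filter)
  with ev have ev0: "\<forall>\<^sub>F s in at 0 within ?L. h (p + s *\<^sub>R v) = 0"
  proof eventually_elim
    case (elim s)
    then show ?case using closure_subset[of "support_on S h"] by (auto simp: support_on_def)
  qed
  have hp: "h p = 0"
    using assms closure_subset[of "support_on S h"] by (auto simp: support_on_def)
  have ev': "\<forall>\<^sub>F s in at 0 within ?L. 0 = h (p + s *\<^sub>R v)"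
    using ev0 by eventually_elim simp
  have d0: "((\<lambda>s. 0) has_derivative (\<lambda>x. x *\<^sub>R 0)) (at 0 within ?L)"
    by simp
  have L: "0 = h (p + 0 *\<^sub>R v)" "0 \<in> ?L"
    using hp assms(2) by simp_all
  show *: "((\<lambda>s. h (p + s *\<^sub>R v)) has_vector_derivative 0) (at 0 within ?L)"
    unfolding has_vector_derivative_def by (rule has_derivative_transform_eventually[OF d0 ev' L])
  show "pd S v h p = 0"
    unfolding pd_def by (rule vector_derivative_within[OF _ *]) (use assms in \<open>simp add: thick_def\<close>)
qed

text \<open>
  A vector is the sum of its components placed on the axes, and each such placement is linear.
\<close>

lemma has_pd_vec:
  fixes h d :: "'a::real_normed_vector \<Rightarrow> complex^'n::finite"
  assumes "\<And>i. has_pd S v (\<lambda>p. h p $ i) (\<lambda>p. d p $ i)"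
  shows "has_pd S v h d"
  unfolding has_pd_def
proof
  fix p assume p: "p \<in> S"
  let ?A = "at 0 within {s. p + s *\<^sub>R v \<in> S}"
  have "((\<lambda>s. \<Sum>i\<in>UNIV. axis i (h (p + s *\<^sub>R v) $ i)) has_vector_derivative (\<Sum>i\<in>UNIV. axis i (d p $ i))) ?A"
  proof (rule has_vector_derivative_sum)
    fix i :: 'n
    have "bounded_linear (axis i :: complex \<Rightarrow> complex^'n)"
      by (simp add: axis_def vec_eq_iff linearI flip: linear_conv_bounded_linear)
    from bounded_linear.has_vector_derivative[OF this, of "\<lambda>s. h (p + s *\<^sub>R v) $ i" "d p $ i"]
    show "((\<lambda>s. axis i (h (p + s *\<^sub>R v) $ i)) has_vector_derivative axis i (d p $ i)) ?A"
      using assms[of i] p by (simp add: has_pd_def)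
  qed
  moreover have "(\<Sum>i\<in>UNIV. axis i (x $ i)) = x" for x :: "complex^'n"
    by (simp add: vec_eq_iff axis_def if_distrib cong: if_cong)
  ultimately show "((\<lambda>s. h (p + s *\<^sub>R v)) has_vector_derivative d p) ?A" by simp
qed

text \<open>
  A nonzero time component of \<open>v\<close> is used to move towards another point of \<open>J\<close>; a purely spatial
  direction never leaves the strip.
\<close>

lemma thick_strip:
  fixes J :: "real set"
  assumes "convex J" "a \<in> J" "b \<in> J" "a \<noteq> b"
  shows "thick (J \<times> (UNIV :: 'a::real_normed_vector set)) v"
proof (rule thick_convex)
  show "convex (J \<times> (UNIV :: 'a set))" using assms(1) by (intro convex_Times) auto
  fix p assume p: "p \<in> J \<times> (UNIV :: 'a set)"
  obtain t x where [simp]: "p = (t, x)" by (cases p)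
  obtain \<tau> y where [simp]: "v = (\<tau>, y)" by (cases v)
  show "\<exists>s. s \<noteq> 0 \<and> p + s *\<^sub>R v \<in> J \<times> UNIV"
  proof (cases "\<tau> = 0")
    case True
    then show ?thesis using p by (intro exI[of _ 1]) simp
  next
    case False
    obtain t' where "t' \<in> J" "t' \<noteq> t" using assms by metis
    then show ?thesis using False by (intro exI[of _ "(t' - t) / \<tau>"]) simp
  qed
qed

lemma has_pd_eq_0_off:
  assumes "thick S v" "has_pd S v h d" "closed K" "\<And>p. p \<in> S - K \<Longrightarrow> h p = 0" "p \<in> S - K"
  shows "d p = 0"
proof -
  have "support_on S h \<subseteq> K" using assms(4) by (auto simp: support_on_def)
  then have "closure (support_on S h) \<subseteq> K" using assms(3) by (rule closure_minimal)
  then show ?thesis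
    using pd_eq_0_off_support(2)[OF assms(1), of p h] has_pd_imp_pd_eq[OF assms(2,1), of p] assms(5)
    by auto
qed

lemma Ckc_1_continuous: "h \<in> Ckc 1 S \<Longrightarrow> continuous_on S h"
  by (simp add: Ckc_def)

lemma Ckc_1_has_pd: "h \<in> Ckc 1 S \<Longrightarrow> b \<in> Basis \<Longrightarrow> has_pd S b h (pd S b h)"
  by (simp add: Ckc_def has_pd_pd)

lemma Ckc_1_continuous_pd: "h \<in> Ckc 1 S \<Longrightarrow> b \<in> Basis \<Longrightarrow> continuous_on S (pd S b h)"
  by (simp add: Ckc_def)

lemma Ckc_1_support:
  assumes "h \<in> Ckc 1 S"
  shows "\<exists>K. compact K \<and> K \<subseteq> S \<and> (\<forall>p\<in>S - K. h p = 0)"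
proof (intro exI conjI ballI)
  let ?K = "closure (support_on S h)"
  show "compact ?K" "?K \<subseteq> S"
    using assms by (auto simp: Ckc_def compactly_supported_on_def)
  show "h p = 0" if "p \<in> S - ?K" for p
    using that closure_subset[of "support_on S h"] by (auto simp: support_on_def)
qed

lemma Ckc_1I:
  assumes "\<And>b. b \<in> Basis \<Longrightarrow> thick S b" "continuous_on S h"
    and "\<And>b. b \<in> Basis \<Longrightarrow> has_pd S b h (d b)" "\<And>b. b \<in> Basis \<Longrightarrow> continuous_on S (d b)"
    and K: "compact K" "K \<subseteq> S" "\<And>p. p \<in> S - K \<Longrightarrow> h p = 0"
  shows "h \<in> Ckc 1 S"
proof -
  have "support_on S h \<subseteq> K" using K(3) by (auto simp: support_on_def)
  then have sub: "closure (support_on S h) \<subseteq> K"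
    using K(1) by (intro closure_minimal compact_imp_closed)
  have "compact (closure (support_on S h))"
    using compact_Int_closed[OF K(1) closed_closure[of "support_on S h"]] sub
    by (simp add: Int_absorb1)
  moreover have "continuous_on S (pd S b h)" if "b \<in> Basis" for b
    using assms(4)[OF that] has_pd_imp_pd_eq[OF assms(3)[OF that] assms(1)[OF that]]
    by (simp cong: continuous_on_cong)
  moreover have "has_pd_on S b h" if "b \<in> Basis" for b
    using has_pd_imp_has_pd_on[OF assms(3)[OF that]] .
  moreover have "closure (support_on S h) \<subseteq> S"
    using sub K(2) by (rule order_trans)
  ultimately show ?thesis
    using assms(2) by (simp add: Ckc_def compactly_supported_on_def)
qed

lemma Ckc_1_add:
  fixes h h' :: "'a::euclidean_space \<Rightarrow> 'b::real_normed_vector"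
  assumes S: "\<And>b. b \<in> Basis \<Longrightarrow> thick S b" and h: "h \<in> Ckc 1 S" and h': "h' \<in> Ckc 1 S"
  shows "(\<lambda>p. h p + h' p) \<in> Ckc 1 S"
proof -
  obtain K where K: "compact K" "K \<subseteq> S" "\<And>p. p \<in> S - K \<Longrightarrow> h p = 0"
    using Ckc_1_support[OF h] by blast
  note * = Ckc_1_continuous[OF h] Ckc_1_has_pd[OF h] Ckc_1_continuous_pd[OF h]
  obtain K' where K': "compact K'" "K' \<subseteq> S" "\<And>p. p \<in> S - K' \<Longrightarrow> h' p = 0"
    using Ckc_1_support[OF h'] by blast
  note ** = Ckc_1_continuous[OF h'] Ckc_1_has_pd[OF h'] Ckc_1_continuous_pd[OF h']
  show ?thesis
  proof (rule Ckc_1I[OF S])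
    show "compact (K \<union> K')" "K \<union> K' \<subseteq> S" using K K' by auto
    show "h p + h' p = 0" if "p \<in> S - (K \<union> K')" for p using that K K' by simp
    show "continuous_on S (\<lambda>p. h p + h' p)" by (intro continuous_on_add * **)
    fix b :: 'a assume b: "b \<in> Basis"
    show "has_pd S b (\<lambda>p. h p + h' p) (\<lambda>p. pd S b h p + pd S b h' p)"
      "continuous_on S (\<lambda>p. pd S b h p + pd S b h' p)"
      using b by (intro has_pd_add continuous_on_add * **; assumption)+
  qed
qed

lemma Ckc_1_bounded_linear:
  fixes h :: "'a::euclidean_space \<Rightarrow> 'b::real_normed_vector"
  assumes S: "\<And>b. b \<in> Basis \<Longrightarrow> thick S b" and L: "bounded_linear L" and h: "h \<in> Ckc 1 S"
  shows "(\<lambda>p. L (h p)) \<in> Ckc 1 S"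
proof -
  obtain K where K: "compact K" "K \<subseteq> S" "\<And>p. p \<in> S - K \<Longrightarrow> h p = 0"
    using Ckc_1_support[OF h] by blast
  note * = Ckc_1_continuous[OF h] Ckc_1_has_pd[OF h] Ckc_1_continuous_pd[OF h]
  have "continuous_on S (\<lambda>p. L (q p))" if "continuous_on S q" for q
    using bounded_linear.continuous_on[OF L that] .
  note cont = this
  show ?thesis
  proof (rule Ckc_1I[OF S])
    show "compact K" "K \<subseteq> S" using K by auto
    show "L (h p) = 0" if "p \<in> S - K" for p
      using that K linear_0[OF bounded_linear.linear[OF L]] by simp
    show "continuous_on S (\<lambda>p. L (h p))" by (intro cont *)
    fix b :: 'a assume b: "b \<in> Basis"
    show "has_pd S b (\<lambda>p. L (h p)) (\<lambda>p. L (pd S b h p))" "continuous_on S (\<lambda>p. L (pd S b h p))"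
      using b by (intro has_pd_bounded_linear[OF L] cont *; assumption)+
  qed
qed

lemma test_functions_imp_Ckc: "\<phi> \<in> test_functions S \<Longrightarrow> \<phi> \<in> Ckc k S"
  by (simp add: test_functions_def Ckc_def)

section \<open>Locally bounded coefficients\<close>

text \<open>
  The coefficients allowed in front of test functions. Boundedness on compact sets, rather than
  local integrability, makes the class stable under products. Measurability is that of the extension
  by zero, since values outside \<open>S\<close> are arbitrary.
\<close>

definition loc_bounded :: "'a::euclidean_space set \<Rightarrow> ('a \<Rightarrow> complex) \<Rightarrow> bool" where
  "loc_bounded S q \<longleftrightarrow> (\<lambda>p. indicator S p *\<^sub>R q p) \<in> borel_measurable borel \<and>
     (\<forall>K. compact K \<and> K \<subseteq> S \<longrightarrow> bounded (q ` K))"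

lemma loc_bounded_continuous:
  assumes "S \<in> sets borel" "continuous_on S q"
  shows "loc_bounded S q"
  unfolding loc_bounded_def
proof safe
  show "(\<lambda>p. indicator S p *\<^sub>R q p) \<in> borel_measurable borel"
    by (rule borel_measurable_continuous_on_indicator[OF assms])
  show "bounded (q ` K)" if "compact K" "K \<subseteq> S" for K
    using that by (intro compact_imp_bounded compact_continuous_image continuous_on_subset[OF assms(2)])
qed

lemma loc_bounded_cong:
  assumes "\<And>p. p \<in> S \<Longrightarrow> q p = q' p"
  shows "loc_bounded S q \<longleftrightarrow> loc_bounded S q'"
proof -
  have "(\<lambda>p. indicator S p *\<^sub>R q p) = (\<lambda>p. indicator S p *\<^sub>R q' p)"
    using assms by (auto simp: fun_eq_iff indicator_def)
  moreover have "K \<subseteq> S \<Longrightarrow> q ` K = q' ` K" for K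
    using assms by (intro image_cong) auto
  ultimately show ?thesis by (auto simp: loc_bounded_def)
qed

lemma loc_bounded_add:
  assumes "loc_bounded S q" "loc_bounded S q'"
  shows "loc_bounded S (\<lambda>p. q p + q' p)"
  unfolding loc_bounded_def
proof safe
  have "(\<lambda>p. indicator S p *\<^sub>R q p + indicator S p *\<^sub>R q' p) \<in> borel_measurable borel"
    using assms unfolding loc_bounded_def by (intro borel_measurable_add) auto
  then show "(\<lambda>p. indicator S p *\<^sub>R (q p + q' p)) \<in> borel_measurable borel"
    by (simp add: scaleR_add_right)
  show "bounded ((\<lambda>p. q p + q' p) ` K)" if "compact K" "K \<subseteq> S" for K
    using that assms by (auto simp: loc_bounded_def intro!: bounded_plus_comp)
qed

lemma loc_bounded_mult:
  assumes "loc_bounded S q" "loc_bounded S q'"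
  shows "loc_bounded S (\<lambda>p. q p * q' p)"
  unfolding loc_bounded_def
proof safe
  have "(\<lambda>p. (indicator S p *\<^sub>R q p) * (indicator S p *\<^sub>R q' p)) \<in> borel_measurable borel"
    using assms unfolding loc_bounded_def by (intro borel_measurable_times) auto
  also have "(\<lambda>p. (indicator S p *\<^sub>R q p) * (indicator S p *\<^sub>R q' p)) = (\<lambda>p. indicator S p *\<^sub>R (q p * q' p))"
    by (auto simp: indicator_def)
  finally show "(\<lambda>p. indicator S p *\<^sub>R (q p * q' p)) \<in> borel_measurable borel" .
next
  fix K assume "compact K" "K \<subseteq> S"
  then have "bounded (q ` K)" "bounded (q' ` K)" using assms by (auto simp: loc_bounded_def)
  then obtain C C' where "\<And>p. p \<in> K \<Longrightarrow> norm (q p) \<le> C" "\<And>p. p \<in> K \<Longrightarrow> norm (q' p) \<le> C'"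
    by (auto simp: bounded_iff)
  then have "norm (q p * q' p) \<le> C * C'" if "p \<in> K" for p
    using that by (auto simp: norm_mult intro!: mult_mono order_trans[OF norm_ge_zero])
  then show "bounded ((\<lambda>p. q p * q' p) ` K)"
    by (auto simp: bounded_iff)
qed

lemma loc_bounded_const: "S \<in> sets borel \<Longrightarrow> loc_bounded S (\<lambda>_. c)"
  by (intro loc_bounded_continuous) auto

lemma loc_bounded_uminus: "S \<in> sets borel \<Longrightarrow> loc_bounded S q \<Longrightarrow> loc_bounded S (\<lambda>p. - q p)"
  using loc_bounded_mult[OF loc_bounded_const[of S "-1"], of q] by simp

lemma loc_bounded_diff:
  "S \<in> sets borel \<Longrightarrow> loc_bounded S q \<Longrightarrow> loc_bounded S q' \<Longrightarrow> loc_bounded S (\<lambda>p. q p - q' p)"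
  using loc_bounded_add[of S q, OF _ loc_bounded_uminus, of q'] by simp

lemma loc_bounded_sum:
  assumes "S \<in> sets borel" "\<And>i. i \<in> A \<Longrightarrow> loc_bounded S (q i)"
  shows "loc_bounded S (\<lambda>p. \<Sum>i\<in>A. q i p)"
  using assms(2)
  by (induction A rule: infinite_finite_induct)
    (auto intro: loc_bounded_add loc_bounded_const assms(1))

lemma loc_bounded_bounded:
  assumes "S \<in> sets borel" "q \<in> borel_measurable borel" "\<And>p. norm (q p) \<le> C"
  shows "loc_bounded S q"
  unfolding loc_bounded_def
proof safe
  show "(\<lambda>p. indicator S p *\<^sub>R q p) \<in> borel_measurable borel"
    using assms(1,2) by (intro borel_measurable_scaleR borel_measurable_indicator) auto
  show "bounded (q ` K)" for K
    using assms(3) by (auto simp: bounded_iff)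
qed

text \<open>
  Bounded superpositions \<open>W(p, v(p))\<close>, which is how the solution enters the coefficients: on a compact
  set of points only a compact set of arguments of \<open>W\<close> is met.
\<close>

lemma loc_bounded_subst:
  fixes W :: "'a::euclidean_space \<Rightarrow> real \<Rightarrow> complex"
  assumes S: "S \<in> sets borel" and W: "continuous_on (S \<times> UNIV) (\<lambda>(p, w). W p w)"
    and v[measurable]: "v \<in> borel_measurable borel" and R: "\<And>p. \<bar>v p\<bar> \<le> R"
  shows "loc_bounded S (\<lambda>p. W p (v p))"
  unfolding loc_bounded_def
proof safe
  have "S \<times> (UNIV :: real set) \<in> sets borel"
    using S by (intro borel_Times) auto
  from borel_measurable_continuous_on_indicator[OF this W]
  have "(\<lambda>z. indicator (S \<times> UNIV) z *\<^sub>R (case z of (p, w) \<Rightarrow> W p w)) \<in> borel_measurable borel" .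
  moreover have "(\<lambda>p. (p, v p)) \<in> borel_measurable borel" by measurable
  ultimately have "(\<lambda>z. indicator (S \<times> UNIV) z *\<^sub>R (case z of (p, w) \<Rightarrow> W p w)) \<circ> (\<lambda>p. (p, v p))
      \<in> borel_measurable borel"
    by (intro measurable_comp)
  then show "(\<lambda>p. indicator S p *\<^sub>R W p (v p)) \<in> borel_measurable borel"
    by (simp add: o_def indicator_def)
next
  fix K assume K: "compact K" "K \<subseteq> S"
  have "bounded ((\<lambda>(p, w). W p w) ` (K \<times> {-R..R}))"
    using K by (intro compact_imp_bounded compact_continuous_image compact_Times
        continuous_on_subset[OF W]) auto
  then show "bounded ((\<lambda>p. W p (v p)) ` K)"
    by (rule bounded_subset) (use R in \<open>force simp: abs_le_iff image_iff\<close>)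
qed

lemma set_integrable_loc_bounded:
  fixes q :: "'a::euclidean_space \<Rightarrow> complex"
  assumes q: "loc_bounded S q" and K: "compact K" "K \<subseteq> S" and 0: "\<And>p. p \<in> S - K \<Longrightarrow> q p = 0"
  shows "set_integrable lborel S q"
proof -
  have "bounded (q ` K)" using q K by (auto simp: loc_bounded_def)
  then obtain C where C: "\<And>p. p \<in> K \<Longrightarrow> norm (q p) \<le> C" by (auto simp: bounded_iff)
  have i: "integrable lborel (\<lambda>p. indicator K p *\<^sub>R C)"
    using K(1) emeasure_compact_finite[OF K(1)]
    by (intro integrable_scaleR_left integrable_real_indicator)
      (auto simp: less_top compact_imp_closed)
  have m: "(\<lambda>p. indicator S p *\<^sub>R q p) \<in> borel_measurable lborel"
    using q by (simp add: loc_bounded_def)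
  have "norm (indicator S p *\<^sub>R q p) \<le> norm (indicator K p *\<^sub>R C)" for p
    using C[of p] 0[of p] K(2) by (auto simp: indicator_def)
  then show ?thesis
    unfolding set_integrable_def by (intro Bochner_Integration.integrable_bound[OF i m] AE_I2)
qed

text \<open>
  The support condition is uniform in \<open>k\<close>, so that the integrand vanishes off the compact set
  \<open>J \<times> K\<close> and is jointly integrable as a bounded function.
\<close>

lemma set_integral_Fubini:
  fixes Q :: "'b::euclidean_space \<Rightarrow> 'a::euclidean_space \<Rightarrow> complex"
  assumes Q: "loc_bounded (J \<times> S) (\<lambda>(k, p). Q k p)"
    and J: "compact J" and K: "compact K" "K \<subseteq> S" and 0: "\<And>k p. p \<in> S - K \<Longrightarrow> Q k p = 0"
  shows "set_integrable lborel J (\<lambda>k. LINT p:S|lborel. Q k p)"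
    and "(LINT k:J|lborel. LINT p:S|lborel. Q k p) = (LINT p:S|lborel. LINT k:J|lborel. Q k p)"
    and "(LINT z:J \<times> S|lborel. case z of (k, p) \<Rightarrow> Q k p) = (LINT k:J|lborel. LINT p:S|lborel. Q k p)"
proof -
  have "set_integrable lborel (J \<times> S) (\<lambda>(k, p). Q k p)"
    by (rule set_integrable_loc_bounded[OF Q, of "J \<times> K"]) (use J K 0 in \<open>auto intro: compact_Times\<close>)
  then have i: "integrable (lborel \<Otimes>\<^sub>M lborel) (\<lambda>(k, p). indicator J k *\<^sub>R indicator S p *\<^sub>R Q k p)"
    unfolding set_integrable_def lborel_prod by (simp add: indicator_times case_prod_beta')
  show "set_integrable lborel J (\<lambda>k. LINT p:S|lborel. Q k p)"
    using lborel_pair.integrable_fst'[OF i]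
    by (simp only: set_integrable_def set_lebesgue_integral_def integral_scaleR_right prod.case)
  have "(LINT k:J|lborel. LINT p:S|lborel. Q k p)
      = (\<integral>k. \<integral>p. indicator J k *\<^sub>R indicator S p *\<^sub>R Q k p \<partial>lborel \<partial>lborel)"
    by (simp only: set_lebesgue_integral_def integral_scaleR_right)
  also have "\<dots> = (\<integral>p. \<integral>k. indicator J k *\<^sub>R indicator S p *\<^sub>R Q k p \<partial>lborel \<partial>lborel)"
    using lborel_pair.Fubini_integral[OF i] by simp
  also have "\<dots> = (\<integral>p. indicator S p *\<^sub>R (\<integral>k. indicator J k *\<^sub>R Q k p \<partial>lborel) \<partial>lborel)"
    by (simp only: scaleR_left_commute[of "indicator J k" for k] integral_scaleR_right)
  finally show "(LINT k:J|lborel. LINT p:S|lborel. Q k p) = (LINT p:S|lborel. LINT k:J|lborel. Q k p)"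
    by (simp add: set_lebesgue_integral_def)
  have "(LINT z:J \<times> S|lborel. case z of (k, p) \<Rightarrow> Q k p)
      = integral\<^sup>L (lborel \<Otimes>\<^sub>M lborel) (\<lambda>(k, p). indicator J k *\<^sub>R indicator S p *\<^sub>R Q k p)"
    unfolding set_lebesgue_integral_def lborel_prod by (simp add: indicator_times case_prod_beta')
  also have "\<dots> = (\<integral>k. \<integral>p. indicator J k *\<^sub>R indicator S p *\<^sub>R Q k p \<partial>lborel \<partial>lborel)"
    using lborel_pair.integral_fst'[OF i] by (simp only: prod.case)
  finally show "(LINT z:J \<times> S|lborel. case z of (k, p) \<Rightarrow> Q k p) = (LINT k:J|lborel. LINT p:S|lborel. Q k p)"
    by (simp only: set_lebesgue_integral_def integral_scaleR_right)
qed

lemma set_integral_lebesgue_eq_lborel: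
  fixes q :: "'a::euclidean_space \<Rightarrow> complex"
  assumes "loc_bounded S q"
  shows "(LINT p:S|lebesgue. q p) = (LINT p:S|lborel. q p)"
  using assms unfolding set_lebesgue_integral_def loc_bounded_def
  by (intro integral_completion) simp

lemma loc_bounded_subset:
  assumes "loc_bounded S q" "S' \<subseteq> S" "S' \<in> sets borel"
  shows "loc_bounded S' q"
  unfolding loc_bounded_def
proof safe
  have "(\<lambda>p. indicat_real S' p *\<^sub>R (indicator S p *\<^sub>R q p)) \<in> borel_measurable borel"
    by (rule borel_measurable_scaleR) (use assms in \<open>simp_all add: loc_bounded_def\<close>)
  also have "(\<lambda>p. indicat_real S' p *\<^sub>R (indicator S p *\<^sub>R q p)) = (\<lambda>p. indicator S' p *\<^sub>R q p)"
    using assms(2) by (auto simp: fun_eq_iff indicator_def)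
  finally show "(\<lambda>p. indicator S' p *\<^sub>R q p) \<in> borel_measurable borel" .
  show "bounded (q ` K)" if "compact K" "K \<subseteq> S'" for K
    using assms that by (auto simp: loc_bounded_def)
qed

lemma loc_bounded_sections:
  assumes Q: "loc_bounded (J \<times> S) (\<lambda>(k, p). Q k p)"
  shows "k \<in> J \<Longrightarrow> loc_bounded S (Q k)" and "p \<in> S \<Longrightarrow> loc_bounded J (\<lambda>k. Q k p)"
proof -
  let ?q = "\<lambda>z. indicat_real (J \<times> S) z *\<^sub>R (case z of (k, p) \<Rightarrow> Q k p)"
  have m: "?q \<in> borel_measurable borel" using Q by (simp add: loc_bounded_def)
  show "loc_bounded S (Q k)" if k: "k \<in> J"
    unfolding loc_bounded_def
  proof safe
    have "?q \<circ> (\<lambda>p. (k, p)) \<in> borel_measurable borel"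
      by (rule measurable_comp[OF _ m]) (rule borel_measurable_continuous_onI, intro continuous_intros)
    then show "(\<lambda>p. indicat_real S p *\<^sub>R Q k p) \<in> borel_measurable borel"
      using k by (simp add: o_def indicator_times)
    fix K assume K: "compact K" "K \<subseteq> S"
    then have "bounded ((\<lambda>(k, p). Q k p) ` ({k} \<times> K))"
      using Q k compact_Times[OF compact_sing[of k] K(1)] unfolding loc_bounded_def by blast
    moreover have "(\<lambda>(k, p). Q k p) ` ({k} \<times> K) = Q k ` K" by force
    ultimately show "bounded (Q k ` K)" by simp
  qed
  show "loc_bounded J (\<lambda>k. Q k p)" if p: "p \<in> S"
    unfolding loc_bounded_def
  proof safe
    have "?q \<circ> (\<lambda>k. (k, p)) \<in> borel_measurable borel"
      by (rule measurable_comp[OF _ m]) (rule borel_measurable_continuous_onI, intro continuous_intros)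
    then show "(\<lambda>k. indicat_real J k *\<^sub>R Q k p) \<in> borel_measurable borel"
      using p by (simp add: o_def indicator_times)
    fix K assume K: "compact K" "K \<subseteq> J"
    then have "bounded ((\<lambda>(k, p). Q k p) ` (K \<times> {p}))"
      using Q p compact_Times[OF K(1) compact_sing[of p]] unfolding loc_bounded_def by blast
    moreover have "(\<lambda>(k, p). Q k p) ` (K \<times> {p}) = (\<lambda>k. Q k p) ` K" by force
    ultimately show "bounded ((\<lambda>k. Q k p) ` K)" by simp
  qed
qed

lemma loc_bounded_snd:
  fixes J :: "'b::euclidean_space set" and q :: "'a::euclidean_space \<Rightarrow> complex"
  assumes "J \<in> sets borel" "loc_bounded S q"
  shows "loc_bounded (J \<times> S) (\<lambda>(k, p). q p)"
  unfolding loc_bounded_def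
proof safe
  let ?q = "\<lambda>p. indicat_real S p *\<^sub>R q p"
  have "?q \<in> borel_measurable borel" using assms(2) by (simp add: loc_bounded_def)
  moreover have "snd \<in> borel_measurable (borel :: ('b \<times> 'a) measure)"
    by (intro borel_measurable_continuous_onI continuous_intros)
  ultimately have qs: "?q \<circ> snd \<in> borel_measurable (borel :: ('b \<times> 'a) measure)"
    by (intro measurable_comp)
  have "J \<times> (UNIV :: 'a set) \<in> sets borel" using assms(1) by (intro borel_Times) auto
  then have "(\<lambda>z. indicat_real (J \<times> UNIV) z *\<^sub>R (?q \<circ> snd) z) \<in> borel_measurable borel"
    by (intro borel_measurable_scaleR[OF _ qs] borel_measurable_indicator)
  also have "(\<lambda>z. indicat_real (J \<times> UNIV) z *\<^sub>R (?q \<circ> snd) z)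
     = (\<lambda>z. indicat_real (J \<times> S) z *\<^sub>R (case z of (k, p) \<Rightarrow> q p))"
    by (rule ext) (simp add: indicator_times case_prod_beta')
  finally show "(\<lambda>z. indicat_real (J \<times> S) z *\<^sub>R (case z of (k, p) \<Rightarrow> q p)) \<in> borel_measurable borel" .
next
  fix K assume K: "compact K" "K \<subseteq> J \<times> S"
  have "compact (snd ` K)" using K(1) by (intro compact_continuous_image continuous_intros)
  moreover have "snd ` K \<subseteq> S" using K(2) by auto
  ultimately have "bounded (q ` snd ` K)" using assms(2) by (auto simp: loc_bounded_def)
  moreover have "(\<lambda>(k, p). q p) ` K = q ` snd ` K"
    by (simp add: image_image case_prod_beta')
  ultimately show "bounded ((\<lambda>(k, p). q p) ` K)" by simp
qed

lemma set_integral_sum: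
  fixes X :: "'i \<Rightarrow> 'a \<Rightarrow> 'b::{banach, second_countable_topology}"
  assumes "\<And>i. i \<in> A \<Longrightarrow> set_integrable M S (X i)"
  shows "set_integrable M S (\<lambda>p. \<Sum>i\<in>A. X i p)"
    and "(LINT p:S|M. \<Sum>i\<in>A. X i p) = (\<Sum>i\<in>A. LINT p:S|M. X i p)"
  using assms unfolding set_integrable_def set_lebesgue_integral_def scaleR_sum_right
  by (auto intro: Bochner_Integration.integrable_sum Bochner_Integration.integral_sum)

lemma norm_set_integral_le:
  fixes X :: "'a::euclidean_space \<Rightarrow> complex"
  assumes X: "set_integrable lborel S X" and K: "compact K" "K \<subseteq> S"
    and 0: "\<And>p. p \<in> S - K \<Longrightarrow> X p = 0" and B: "\<And>p. p \<in> K \<Longrightarrow> norm (X p) \<le> B"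
  shows "norm (LINT p:S|lborel. X p) \<le> B * measure lborel K"
proof -
  have fin: "emeasure lborel K < \<infinity>" using K(1) by (rule emeasure_compact_finite)
  have Ks: "K \<in> sets lborel" using K(1) by (simp add: compact_imp_closed)
  have iK: "integrable lborel (\<lambda>p. B * indicat_real K p)"
    using Ks fin by (intro integrable_mult_right integrable_real_indicator)
  have "norm (LINT p:S|lborel. X p) \<le> (\<integral>p. norm (indicator S p *\<^sub>R X p) \<partial>lborel)"
    unfolding set_lebesgue_integral_def by (rule integral_norm_bound)
  also have "\<dots> \<le> (\<integral>p. B * indicat_real K p \<partial>lborel)"
  proof (rule integral_mono[OF _ iK])
    show "integrable lborel (\<lambda>p. norm (indicator S p *\<^sub>R X p))"
      using X unfolding set_integrable_def by (rule integrable_norm)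
    show "norm (indicator S p *\<^sub>R X p) \<le> B * indicat_real K p" for p
      using 0[of p] B[of p] K(2) by (auto simp: indicator_def)
  qed
  also have "\<dots> = B * measure lborel K"
    using Ks fin by simp
  finally show ?thesis .
qed

text \<open>
  The shape of all coefficients of the Kruzhkov productions as functions of \<open>(k, p)\<close>. The sign is
  discontinuous at \<open>k = v p\<close>, but it is a bounded Borel function of \<open>(k, p)\<close> because \<open>v\<close> is Borel.
\<close>

lemma loc_bounded_sgn_kernel:
  fixes W :: "real \<Rightarrow> 'a::euclidean_space \<Rightarrow> real \<Rightarrow> complex"
  assumes S: "S \<in> sets borel" and W: "continuous_on (UNIV \<times> S \<times> UNIV) (\<lambda>(k, p, w). W k p w)"
    and v: "v \<in> borel_measurable borel" and R: "\<And>p. \<bar>v p\<bar> \<le> R"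
  shows "loc_bounded (UNIV \<times> S) (\<lambda>(k, p). of_real (sgn (v p - k)) * W k p (v p))"
proof -
  have US: "(UNIV :: real set) \<times> S \<in> sets borel" using S by (intro borel_Times) auto
  have [measurable]: "fst \<in> borel_measurable (borel :: (real \<times> 'a) measure)"
    "snd \<in> borel_measurable (borel :: (real \<times> 'a) measure)"
    by (intro borel_measurable_continuous_onI continuous_intros)+
  have vs: "(\<lambda>z. v (snd z)) \<in> borel_measurable (borel :: (real \<times> 'a) measure)"
    using v by measurable
  have "loc_bounded (UNIV \<times> S) (\<lambda>z. W (fst z) (snd z) (v (snd z)))"
  proof (rule loc_bounded_subst[OF US _ vs R])
    show "continuous_on ((UNIV \<times> S) \<times> UNIV) (\<lambda>(z, w). W (fst z) (snd z) w)"
      unfolding case_prod_beta'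
      by (rule continuous_on_compose2[OF W[unfolded case_prod_beta'],
            of _ "\<lambda>y. (fst (fst y), snd (fst y), snd y)", simplified])
        (auto intro!: continuous_intros)
  qed
  moreover have "loc_bounded (UNIV \<times> S) (\<lambda>z. of_real (sgn (v (snd z) - fst z)))"
  proof (rule loc_bounded_bounded[OF US])
    show "(\<lambda>z. complex_of_real (sgn (v (snd z) - fst z))) \<in> borel_measurable borel"
      using vs unfolding sgn_real_def by measurable
    show "norm (complex_of_real (sgn (v (snd z) - fst z))) \<le> 1" for z :: "real \<times> 'a"
      by (simp add: sgn_real_def)
  qed
  ultimately show ?thesis
    unfolding case_prod_beta' by (intro loc_bounded_mult)
qed

lemma set_integral_lebesgue_bounded_linear:
  fixes X :: "'a::euclidean_space \<Rightarrow> complex" and L :: "complex \<Rightarrow> real"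
  assumes "bounded_linear L" and X: "set_integrable lborel S X"
  shows "(LINT p:S|lebesgue. L (X p)) = L (LINT p:S|lebesgue. X p)"
proof -
  have "(\<lambda>p. indicator S p *\<^sub>R X p) \<in> borel_measurable lborel"
    using X unfolding set_integrable_def by (rule borel_measurable_integrable)
  then have "integrable lebesgue (\<lambda>p. indicator S p *\<^sub>R X p)"
    using X by (simp add: set_integrable_def integrable_completion)
  from integral_bounded_linear[OF assms(1) this] show ?thesis
    by (simp add: set_lebesgue_integral_def linear_scale[OF bounded_linear.linear[OF assms(1)]])
qed

section \<open>Integration by parts\<close>

text \<open>
  The functions \<open>p \<mapsto> h(p + v)\<close> and \<open>h\<close> have the same integral over \<open>S\<close>. Their difference at \<open>p\<close> is the integral of
  \<open>d(p + s v)\<close> over \<open>0 \<le> s \<le> 1\<close>, and for each \<open>s\<close> the integral over \<open>p\<close> is again that of \<open>d\<close>; Fubini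
  thus identifies the difference with the integral of \<open>d\<close>. Translation replaces a choice of
  coordinates along \<open>v\<close>.
\<close>

lemma integral_pd_translation_invariant:
  fixes h d :: "'a::euclidean_space \<Rightarrow> complex"
  assumes S: "S \<in> sets borel" and inv: "\<And>p s. p \<in> S \<Longrightarrow> p + s *\<^sub>R v \<in> S"
    and hd: "has_pd S v h d" and h: "continuous_on S h" and d: "continuous_on S d"
    and K: "compact K" "K \<subseteq> S" and 0: "\<And>p. p \<in> S - K \<Longrightarrow> h p = 0"
  shows "(LINT p:S|lborel. d p) = 0"
proof -
  have line: "p + s *\<^sub>R v \<in> S \<longleftrightarrow> p \<in> S" for p s
    using inv[of p s] inv[of "p + s *\<^sub>R v" "-s"] by (auto simp: algebra_simps)
  have "thick S v"
    unfolding thick_def by (simp add: line)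
  then have d0: "d p = 0" if "p \<in> S - K" for p
    using has_pd_eq_0_off[OF _ hd compact_imp_closed[OF K(1)] 0 that] by blast
  have transl: "(LINT p:S|lborel. q (p + s *\<^sub>R v)) = (LINT p:S|lborel. q p)"
    if q: "loc_bounded S q" for q s
  proof -
    let ?g = "\<lambda>p. indicator S p *\<^sub>R q p"
    have "(LINT p:S|lborel. q (p + s *\<^sub>R v)) = (\<integral>p. ?g (s *\<^sub>R v + p) \<partial>lborel)"
      unfolding set_lebesgue_integral_def
      by (intro Bochner_Integration.integral_cong refl) (simp add: indicator_def line add.commute)
    also have "\<dots> = integral\<^sup>L (distr lborel borel ((+) (s *\<^sub>R v))) ?g"
      using q by (intro integral_distr[symmetric]) (auto simp: loc_bounded_def)
    finally show ?thesis
      by (simp only: lborel_distr_plus set_lebesgue_integral_def)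
  qed
  let ?J = "{0..1::real}"
  \<comment> \<open>All points from which a translate by \<open>s v\<close> with \<open>0 \<le> s \<le> 1\<close> can meet the support.\<close>
  let ?K' = "(\<lambda>(p, s). p - s *\<^sub>R v) ` (K \<times> ?J)"
  have lb: "loc_bounded S h" "loc_bounded S d"
    using S h d by (auto intro: loc_bounded_continuous)
  have "compact ?K'"
    using K(1) by (intro compact_continuous_image compact_Times)
      (auto simp: case_prod_beta' intro!: continuous_intros)
  moreover have "?K' \<subseteq> S"
    using K(2) inv[of _ "- s" for s] by force
  moreover have "p + s *\<^sub>R v \<notin> K" if "p \<in> S - ?K'" "s \<in> ?J" for p s
    using that by (force simp: image_iff)
  ultimately have K': "compact ?K'" "?K' \<subseteq> S"
    and off: "\<And>p s. p \<in> S - ?K' \<Longrightarrow> s \<in> ?J \<Longrightarrow> p + s *\<^sub>R v \<in> S - K"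
    using line by blast+
  \<comment> \<open>Cut off in \<open>s\<close> so that the support condition of Fubini holds for every \<open>s\<close>.\<close>
  define Q where "Q s p = (if s \<in> ?J then d (p + s *\<^sub>R v) else 0)" for s p
  have "continuous_on (?J \<times> S) (\<lambda>(s, p). d (p + s *\<^sub>R v))"
    unfolding case_prod_beta'
    by (intro continuous_on_compose2[OF d]) (auto intro!: continuous_intros simp: line)
  then have "loc_bounded (?J \<times> S) (\<lambda>(s, p). d (p + s *\<^sub>R v))"
    using S by (intro loc_bounded_continuous borel_Times) auto
  then have Q: "loc_bounded (?J \<times> S) (\<lambda>(s, p). Q s p)"
    by (rule iffD1[OF loc_bounded_cong, rotated]) (auto simp: Q_def)
  have Q0: "Q s p = 0" if "p \<in> S - ?K'" for s p
    using d0[OF off[OF that, of s]] by (auto simp: Q_def)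
  have "0 = (LINT p:S|lborel. h (p + 1 *\<^sub>R v)) - (LINT p:S|lborel. h p)"
    by (subst transl) (simp_all add: lb)
  also have "\<dots> = (LINT p:S|lborel. h (p + 1 *\<^sub>R v) - h p)"
  proof (rule set_integral_diff(2)[symmetric])
    have "continuous_on S (\<lambda>p. h (p + 1 *\<^sub>R v))"
      by (intro continuous_on_compose2[OF h] continuous_intros) (auto simp: line simp del: scaleR_one)
    then show "set_integrable lborel S (\<lambda>p. h (p + 1 *\<^sub>R v))"
      using K' 0[OF off[of _ 1]] by (intro set_integrable_loc_bounded[where K = ?K'] loc_bounded_continuous S) auto
    show "set_integrable lborel S h"
      using K 0 lb by (intro set_integrable_loc_bounded[where K = K])
  qed
  also have "\<dots> = (LINT p:S|lborel. LINT s:?J|lborel. Q s p)"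
  proof (rule set_lebesgue_integral_cong)
    show "\<forall>p. p \<in> S \<longrightarrow> h (p + 1 *\<^sub>R v) - h p = (LINT s:?J|lborel. Q s p)"
    proof safe
      fix p assume p: "p \<in> S"
      have vd: "((\<lambda>r. h (p + r *\<^sub>R v)) has_vector_derivative d (p + s *\<^sub>R v)) (at s within ?J)" for s
        using has_pd_at[OF hd, of p s] p by (auto simp: line intro: has_vector_derivative_at_within)
      have "continuous_on ?J (\<lambda>s. d (p + s *\<^sub>R v))"
        using p by (intro continuous_on_compose2[OF d] continuous_intros) (auto simp: line)
      from integral_FTC_atLeastAtMost[OF _ vd this]
      have "(LINT s:?J|lborel. d (p + s *\<^sub>R v)) = h (p + 1 *\<^sub>R v) - h p"
        by (simp add: set_lebesgue_integral_def)
      moreover have "(LINT s:?J|lborel. Q s p) = (LINT s:?J|lborel. d (p + s *\<^sub>R v))"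
        by (rule set_lebesgue_integral_cong) (auto simp: Q_def)
      ultimately show "h (p + 1 *\<^sub>R v) - h p = (LINT s:?J|lborel. Q s p)"
        by simp
    qed
  qed (use S in auto)
  also have "\<dots> = (LINT s:?J|lborel. LINT p:S|lborel. Q s p)"
    by (rule set_integral_Fubini(2)[OF Q _ K' Q0, symmetric]) auto
  also have "\<dots> = (LINT s:?J|lborel. LINT p:S|lborel. d p)"
    by (rule set_lebesgue_integral_cong) (auto simp: Q_def transl[OF lb(2)])
  also have "\<dots> = (LINT p:S|lborel. d p)"
    by (subst set_integral_const) simp_all
  finally show ?thesis by simp
qed

lemma integral_by_parts_translation_invariant:
  fixes h d :: "'a::euclidean_space \<Rightarrow> complex"
  assumes "S \<in> sets borel" and "\<And>p s. p \<in> S \<Longrightarrow> p + s *\<^sub>R v \<in> S"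
    and hd: "has_pd S v h d" "continuous_on S h" "continuous_on S d"
    and cd: "has_pd S v c c'" "continuous_on S c" "continuous_on S c'"
    and K: "compact K" "K \<subseteq> S" and 0: "\<And>p. p \<in> S - K \<Longrightarrow> c p = 0"
  shows "(LINT p:S|lborel. h p * c' p + d p * c p) = 0"
  by (rule integral_pd_translation_invariant[OF assms(1,2) has_pd_mult[OF hd(1) cd(1)] _ _ K])
    (use 0 in \<open>auto intro!: continuous_intros hd cd\<close>)

text \<open>
  For fixed \<open>x\<close> this is the fundamental theorem of calculus on \<open>[0, b]\<close>, where \<open>b\<close> lies in \<open>I\<close> beyond the
  support of \<open>h\<close>. Such a \<open>b\<close> exists because \<open>I\<close> contains no right end point.
\<close>

lemma integral_pd_time:
  fixes h d :: "real \<times> 'a::euclidean_space \<Rightarrow> complex"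
  assumes I: "I = {0..} \<or> (\<exists>T>0. I = {0..<T})"
    and hd: "has_pd (I \<times> UNIV) (1, 0) h d"
    and h: "continuous_on (I \<times> UNIV) h" and d: "continuous_on (I \<times> UNIV) d"
    and K: "compact K" "K \<subseteq> I \<times> UNIV" and 0: "\<And>p. p \<in> I \<times> UNIV - K \<Longrightarrow> h p = 0"
    and d0: "\<And>p. p \<in> I \<times> UNIV - K \<Longrightarrow> d p = 0"
  shows "(LINT p:I \<times> UNIV|lborel. d p) + (LINT x|lborel. h (0, x)) = 0"
proof -
  have "\<exists>b\<in>I. 0 < b \<and> (\<forall>p\<in>K. fst p < b)"
  proof (cases "K = {}")
    case True
    have "\<exists>b\<in>I. 0 < b"
      using I
    proof (elim disjE exE conjE)
      assume "I = {0..}"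
      then show ?thesis by (intro bexI[of _ 1]) auto
    next
      fix T :: real assume "I = {0..<T}" "0 < T"
      then show ?thesis by (intro bexI[of _ "T / 2"]) auto
    qed
    with True show ?thesis by auto
  next
    case False
    then obtain m where m: "m \<in> K" "\<And>p. p \<in> K \<Longrightarrow> fst p \<le> fst m"
      using continuous_attains_sup[OF K(1) False continuous_on_fst[OF continuous_on_id]] by blast
    then have "fst m \<in> I" using K(2) by auto
    with I have "\<exists>b\<in>I. 0 < b \<and> fst m < b"
    proof (elim disjE exE conjE)
      assume "fst m \<in> I" "I = {0..}"
      then show ?thesis by (intro bexI[of _ "fst m + 1"]) auto
    next
      fix T assume "fst m \<in> I" "I = {0..<T}" "0 < T"
      then show ?thesis by (intro bexI[of _ "(fst m + T) / 2"]) auto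
    qed
    then show ?thesis using m by force
  qed
  then obtain b where b: "b \<in> I" "0 < b" "\<And>p. p \<in> K \<Longrightarrow> fst p < b" by blast
  have sub: "{0..b} \<subseteq> I" using I b(1) by auto
  have Kpos: "0 \<le> fst p" if "p \<in> K" for p using that K(2) I by auto
  have dQ: "loc_bounded ({0..b} \<times> UNIV) (\<lambda>(t, x). d (t, x))"
    using sub by (intro loc_bounded_continuous borel_Times)
      (auto intro: continuous_on_subset[OF d])
  define Q where "Q t x = (if t \<in> {0..b} then d (t, x) else 0)" for t x
  have Q: "loc_bounded ({0..b} \<times> UNIV) (\<lambda>(t, x). Q t x)"
    using dQ by (rule iffD1[OF loc_bounded_cong, rotated]) (auto simp: Q_def)
  have Q0: "Q t x = 0" if "x \<in> UNIV - snd ` K" for t x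
    using that d0[of "(t, x)"] sub by (force simp: Q_def)
  have "compact (snd ` K)"
    using K(1) by (intro compact_continuous_image continuous_intros)
  note F = set_integral_Fubini(2,3)[OF Q _ this subset_UNIV Q0]
  have "(LINT p:I \<times> UNIV|lborel. d p) = (LINT p:{0..b} \<times> UNIV|lborel. case p of (t, x) \<Rightarrow> Q t x)"
    unfolding set_lebesgue_integral_def
  proof (intro Bochner_Integration.integral_cong refl)
    fix p :: "real \<times> 'a"
    show "indicator (I \<times> UNIV) p *\<^sub>R d p = indicator ({0..b} \<times> UNIV) p *\<^sub>R (case p of (t, x) \<Rightarrow> Q t x)"
    proof (cases "p \<in> K")
      case True
      then show ?thesis using b(3)[OF True] Kpos[OF True] K(2) sub
        by (cases p) (auto simp: indicator_def Q_def)
    next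
      case False
      then show ?thesis using d0[of p] sub
        by (cases p) (auto simp: indicator_def Q_def)
    qed
  qed
  also have "\<dots> = (LINT x|lborel. (LINT t:{0..b}|lborel. Q t x))"
    using F by (simp add: set_lebesgue_integral_def)
  also have "\<dots> = (LINT x|lborel. - h (0, x))"
  proof (intro Bochner_Integration.integral_cong refl)
    fix x
    have vd: "((\<lambda>r. h (r, x)) has_vector_derivative d (t, x)) (at t within {0..b})" if "0 \<le> t" "t \<le> b" for t
    proof -
      have "t \<in> I" using sub that by auto
      then have "((\<lambda>r. h ((0, x) + r *\<^sub>R (1, 0))) has_vector_derivative d ((0, x) + t *\<^sub>R (1, 0)))
           (at t within {r. (0, x) + r *\<^sub>R (1, 0) \<in> I \<times> UNIV})"
        by (intro has_pd_at[OF hd]) simp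
      then show ?thesis
        using sub by (auto intro: has_vector_derivative_within_subset)
    qed
    have "continuous_on {0..b} (\<lambda>t. d (t, x))"
      using sub by (intro continuous_on_compose2[OF d] continuous_intros) auto
    from integral_FTC_atLeastAtMost[OF _ vd this] b(2)
    have "(LINT t:{0..b}|lborel. d (t, x)) = h (b, x) - h (0, x)"
      by (simp add: set_lebesgue_integral_def)
    moreover have "h (b, x) = 0"
      using b(1) b(3)[of "(b, x)"] by (intro 0) auto
    moreover have "(LINT t:{0..b}|lborel. Q t x) = (LINT t:{0..b}|lborel. d (t, x))"
      by (rule set_lebesgue_integral_cong) (auto simp: Q_def)
    ultimately show "(LINT t:{0..b}|lborel. Q t x) = - h (0, x)"
      by simp
  qed
  finally show ?thesis by simp
qed

section \<open>Primitives in the state variable\<close>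

text \<open>
  The primitive of \<open>h\<close> that vanishes at \<open>0\<close>, rescaled to the fixed interval \<open>[0, 1]\<close>: there is no case
  distinction on the sign of \<open>w\<close>, and continuity and differentiability in parameters follow from the
  rules for integrals over a fixed domain.
\<close>

definition prim :: "(real \<Rightarrow> complex) \<Rightarrow> real \<Rightarrow> complex" where
  "prim h w = of_real w * integral {0..1} (\<lambda>s. h (s * w))"

lemma prim_FTC:
  assumes J: "convex J" "0 \<in> J" "w \<in> J"
    and H: "\<And>x. x \<in> J \<Longrightarrow> (H has_vector_derivative h x) (at x within J)"
  shows "prim h w = H w - H 0"
proof -
  have sub: "(\<lambda>s. s * w) ` {0..1} \<subseteq> J"
  proof safe
    fix s :: real assume "s \<in> {0..1}"
    then show "s * w \<in> J"
      using convexD[OF J(1,2,3), of "1 - s" s] by simp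
  qed
  have vd: "((H \<circ> (\<lambda>s. s * w)) has_vector_derivative w *\<^sub>R h (s * w)) (at s within {0..1})"
    if "s \<in> {0..1}" for s
  proof (rule vector_diff_chain_within)
    show "((\<lambda>s. s * w) has_vector_derivative w) (at s within {0..1})"
      by (auto intro!: derivative_eq_intros)
    show "(H has_vector_derivative h (s * w)) (at (s * w) within (\<lambda>s. s * w) ` {0..1})"
      using H sub that by (blast intro: has_vector_derivative_within_subset)
  qed
  then have "((\<lambda>s. w *\<^sub>R h (s * w)) has_integral (H \<circ> (\<lambda>s. s * w)) 1 - (H \<circ> (\<lambda>s. s * w)) 0) {0..1}"
    by (intro fundamental_theorem_of_calculus vd) auto
  from integral_unique[OF this] have "integral {0..1} (\<lambda>s. w *\<^sub>R h (s * w)) = H w - H 0"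
    by simp
  then show ?thesis
    by (simp add: prim_def scaleR_conv_of_real)
qed

lemma prim_0 [simp]: "prim h 0 = 0"
  by (simp add: prim_def)

lemma prim_has_vector_derivative:
  assumes "continuous_on UNIV h"
  shows "(prim h has_vector_derivative h w) (at w)"
proof -
  define a b where "a = min w 0 - 1" and "b = max w 0 + 1"
  let ?H = "\<lambda>x. integral {a..x} h"
  have H: "(?H has_vector_derivative h x) (at x within {a..b})" if "x \<in> {a..b}" for x
    using that by (intro integral_has_vector_derivative continuous_on_subset[OF assms]) auto
  have "(?H has_vector_derivative h w) (at w within {a..b})"
    by (rule H) (auto simp: a_def b_def)
  moreover have "at w within {a..b} = at w"
    by (rule at_within_interior) (auto simp: a_def b_def)
  ultimately have "((\<lambda>x. ?H x - ?H 0) has_vector_derivative h w - 0) (at w)"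
    by (intro has_vector_derivative_diff has_vector_derivative_const) simp
  moreover have "open {a<..<b}" "w \<in> {a<..<b}"
    by (auto simp: a_def b_def)
  moreover have "?H x - ?H 0 = prim h x" if "x \<in> {a<..<b}" for x
    using that by (intro prim_FTC[OF _ _ _ H, symmetric]) (auto simp: a_def b_def)
  ultimately show ?thesis
    by (auto intro: has_vector_derivative_transform_within_open)
qed

lemma prim_eqI:
  assumes "\<And>x. (H has_vector_derivative h x) (at x)" "H 0 = 0"
  shows "prim h w = H w"
  using prim_FTC[of UNIV w H h] assms by simp

text \<open>
  The factor \<open>sgn(v - k)\<close> is the difference of the indicators of \<open>[-R, v]\<close> and \<open>[v, R]\<close>, even at \<open>k = v\<close>,
  where both are \<open>1\<close>.
\<close>

lemma set_integral_sgn_kernel: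
  assumes h: "continuous_on UNIV h" and v: "\<bar>v\<bar> \<le> R"
  shows "set_integrable lborel {-R..R} (\<lambda>k. of_real (sgn (v - k)) * h k)"
    and "(LINT k:{-R..R}|lborel. of_real (sgn (v - k)) * h k) = 2 * prim h v - prim h R - prim h (- R)"
proof -
  have eq: "indicator {-R..R} k *\<^sub>R (of_real (sgn (v - k)) * h k)
      = indicator {-R..v} k *\<^sub>R h k - indicator {v..R} k *\<^sub>R h k" for k
    using v by (auto simp: indicator_def sgn_if)
  have int: "integrable lborel (\<lambda>k. indicator {a..b} k *\<^sub>R h k)" for a b
    using borel_integrable_atLeastAtMost'[OF continuous_on_subset[OF h subset_UNIV]]
    by (simp add: set_integrable_def)
  have FTC: "integral\<^sup>L lborel (\<lambda>k. indicator {a..b} k *\<^sub>R h k) = prim h b - prim h a" if "a \<le> b" for a b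
    using that by (intro integral_FTC_atLeastAtMost)
      (auto intro: continuous_on_subset[OF h] has_vector_derivative_at_within prim_has_vector_derivative[OF h])
  show "set_integrable lborel {-R..R} (\<lambda>k. of_real (sgn (v - k)) * h k)"
    unfolding set_integrable_def eq by (intro Bochner_Integration.integrable_diff int)
  show "(LINT k:{-R..R}|lborel. of_real (sgn (v - k)) * h k) = 2 * prim h v - prim h R - prim h (- R)"
    unfolding set_lebesgue_integral_def eq
    using v by (simp add: Bochner_Integration.integral_diff[OF int int] FTC)
qed

text \<open>
  The factor of the Fourier transform; it is half the second derivative of \<open>\<E>\<^sub>\<xi>\<close>.
\<close>

definition wave :: "complex \<Rightarrow> real \<Rightarrow> complex" where
  "wave \<xi> k = exp (- \<i> * \<xi> * complex_of_real k)"

lemma continuous_on_wave [continuous_intros]: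
  "continuous_on S h \<Longrightarrow> continuous_on S (\<lambda>p. wave \<xi> (h p))"
  unfolding wave_def by (intro continuous_intros)

lemma has_vector_derivative_exp_of_real:
  "((\<lambda>k. exp (c * complex_of_real k)) has_vector_derivative c * exp (c * complex_of_real w)) (at w)"
proof -
  have "((\<lambda>z. exp (c * z)) has_field_derivative c * exp (c * of_real w)) (at (of_real w))"
    by (auto intro!: derivative_eq_intros)
  from has_vector_derivative_real_field[OF this]
  show ?thesis by (simp add: mult.commute)
qed

lemma exp_entropy_derivatives:
  defines "D \<equiv> \<lambda>\<xi> w. if \<xi> = 0 then 2 * complex_of_real w else 2 * \<i> * (exp (- \<i> * \<xi> * complex_of_real w) - 1) / \<xi>"
  shows "(exp_entropy \<xi> has_vector_derivative D \<xi> w) (at w)"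
    and "(D \<xi> has_vector_derivative 2 * wave \<xi> w) (at w)"
proof -
  note [derivative_intros] = has_vector_derivative_exp_of_real[of "- \<i> * \<xi>"]
  show "(exp_entropy \<xi> has_vector_derivative D \<xi> w) (at w)"
  proof (cases "\<xi> = 0")
    case True
    have "((\<lambda>k. complex_of_real k * complex_of_real k) has_vector_derivative
        complex_of_real w * complex_of_real 1 + complex_of_real 1 * complex_of_real w) (at w)"
      by (intro has_vector_derivative_mult has_vector_derivative_of_real DERIV_ident)
    moreover have "exp_entropy \<xi> = (\<lambda>k. complex_of_real k * complex_of_real k)"
      by (simp add: fun_eq_iff True exp_entropy_def power2_eq_square)
    ultimately show ?thesis
      by (simp add: D_def True)
  next
    case False
    have "((\<lambda>k. - 2 / \<xi>\<^sup>2 * (exp (- \<i> * \<xi> * complex_of_real k) - 1 + \<i> * \<xi> * complex_of_real k))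
        has_vector_derivative - 2 / \<xi>\<^sup>2 * (- \<i> * \<xi> * exp (- \<i> * \<xi> * complex_of_real w) - 0 + \<i> * \<xi> * complex_of_real 1)) (at w)"
      by (intro has_vector_derivative_mult_right has_vector_derivative_add has_vector_derivative_diff
          has_vector_derivative_const has_vector_derivative_exp_of_real has_vector_derivative_of_real DERIV_ident)
    moreover have "exp_entropy \<xi> = (\<lambda>k. - 2 / \<xi>\<^sup>2 * (exp (- \<i> * \<xi> * complex_of_real k) - 1 + \<i> * \<xi> * complex_of_real k))"
      by (intro ext) (simp only: exp_entropy_def False if_False times_divide_eq_left times_divide_eq_right)
    moreover have "- 2 / \<xi>\<^sup>2 * (- \<i> * \<xi> * exp (- \<i> * \<xi> * complex_of_real w) - 0 + \<i> * \<xi> * complex_of_real 1) = D \<xi> w"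
      using False by (simp add: D_def field_simps power2_eq_square)
    ultimately show ?thesis by simp
  qed
  show "(D \<xi> has_vector_derivative 2 * wave \<xi> w) (at w)"
  proof (cases "\<xi> = 0")
    case True
    have "((\<lambda>k. 2 * complex_of_real k) has_vector_derivative 2 * complex_of_real 1) (at w)"
      by (intro has_vector_derivative_mult_right has_vector_derivative_of_real DERIV_ident)
    then show ?thesis by (simp add: D_def True wave_def)
  next
    case False
    have "((\<lambda>k. 2 * \<i> / \<xi> * (exp (- \<i> * \<xi> * complex_of_real k) - 1))
        has_vector_derivative 2 * \<i> / \<xi> * (- \<i> * \<xi> * exp (- \<i> * \<xi> * complex_of_real w) - 0)) (at w)"
      by (intro has_vector_derivative_mult_right has_vector_derivative_diff
          has_vector_derivative_const has_vector_derivative_exp_of_real)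
    then show ?thesis using False by (simp add: D_def wave_def field_simps)
  qed
qed

lemma exp_entropy_0 [simp]: "exp_entropy \<xi> 0 = 0"
  by (simp add: exp_entropy_def)

lemma exp_entropy_has_vector_derivative:
  "(exp_entropy \<xi> has_vector_derivative 2 * prim (wave \<xi>) w) (at w)"
proof -
  let ?D = "\<lambda>w. if \<xi> = 0 then 2 * complex_of_real w else 2 * \<i> * (exp (- \<i> * \<xi> * complex_of_real w) - 1) / \<xi>"
  have "((\<lambda>w. 1/2 * ?D w) has_vector_derivative 1/2 * (2 * wave \<xi> w)) (at w)" for w
    by (intro has_vector_derivative_mult_right exp_entropy_derivatives(2))
  then have "prim (wave \<xi>) w = 1/2 * ?D w"
    by (intro prim_eqI) auto
  then have "2 * prim (wave \<xi>) w = ?D w"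
    by (simp only:) simp
  then show ?thesis
    by (simp only: exp_entropy_derivatives(1))
qed

text \<open>
  Taylor's formula \<open>\<E>\<^sub>\<xi>(w) = 2 \<integral>\<^bsub>[0,w]\<^esub> (w - k) e(k) dk\<close>, the form in which \<open>\<E>\<^sub>\<xi>\<close> arises from the integral of
  \<open>\<bar>w - k\<bar> e(k)\<close>.
\<close>

lemma exp_entropy_eq_prim:
  "exp_entropy \<xi> w = 2 * (of_real w * prim (wave \<xi>) w - prim (\<lambda>k. of_real k * wave \<xi> k) w)"
proof -
  have "((\<lambda>w. of_real w * prim (wave \<xi>) w - 1/2 * exp_entropy \<xi> w) has_vector_derivative
     (of_real w * wave \<xi> w + of_real 1 * prim (wave \<xi>) w) - 1/2 * (2 * prim (wave \<xi>) w)) (at w)" for w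
    by (intro has_vector_derivative_mult_right has_vector_derivative_diff has_vector_derivative_mult
        has_vector_derivative_of_real DERIV_ident exp_entropy_has_vector_derivative
        prim_has_vector_derivative continuous_intros)
  then have "prim (\<lambda>k. of_real k * wave \<xi> k) w = of_real w * prim (wave \<xi>) w - 1/2 * exp_entropy \<xi> w"
    by (intro prim_eqI) auto
  then show ?thesis by simp
qed

definition prim_u :: "(real \<times> 'a \<times> real \<Rightarrow> complex) \<Rightarrow> real \<times> 'a \<times> real \<Rightarrow> complex" where
  "prim_u \<Psi> = (\<lambda>(t, x, w). prim (\<lambda>k. \<Psi> (t, x, k)) w)"

lemma continuous_on_prim_u:
  fixes \<Psi> :: "real \<times> 'a::euclidean_space \<times> real \<Rightarrow> complex"
  assumes "continuous_on (J \<times> UNIV \<times> UNIV) \<Psi>"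
  shows "continuous_on (J \<times> UNIV \<times> UNIV) (prim_u \<Psi>)"
proof -
  have "continuous_on (J \<times> UNIV \<times> UNIV)
     (\<lambda>q. integral (cbox 0 1) (\<lambda>s. \<Psi> (fst q, fst (snd q), s * snd (snd q))))"
    unfolding case_prod_beta'
    by (intro integral_continuous_on_param)
      (auto simp: case_prod_beta' intro!: continuous_on_compose2[OF assms] continuous_intros)
  then have "continuous_on (J \<times> UNIV \<times> UNIV)
     (\<lambda>q. of_real (snd (snd q)) * integral {0..1} (\<lambda>s. \<Psi> (fst q, fst (snd q), s * snd (snd q))))"
    by (intro continuous_intros) (simp add: box_real)
  then show ?thesis
    by (simp add: prim_u_def prim_def case_prod_beta')
qed

text \<open>
  Directions without \<open>u\<close>-component commute with integration in \<open>u\<close>.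
\<close>

lemma has_pd_prim_u:
  fixes \<Psi> :: "real \<times> 'a::euclidean_space \<times> real \<Rightarrow> complex"
  assumes J: "convex J" and \<Psi>: "continuous_on (J \<times> UNIV \<times> UNIV) \<Psi>"
    and D: "continuous_on (J \<times> UNIV \<times> UNIV) D"
    and hd: "has_pd (J \<times> UNIV \<times> UNIV) (\<tau>, y, 0) \<Psi> D"
  shows "has_pd (J \<times> UNIV \<times> UNIV) (\<tau>, y, 0) (prim_u \<Psi>) (prim_u D)"
  unfolding has_pd_def
proof safe
  fix t :: real and x :: 'a and w :: real assume t: "t \<in> J"
  let ?U = "{s. t + s * \<tau> \<in> J}"
  let ?f = "\<lambda>\<Phi> s r. \<Phi> (t + s * \<tau>, x + s *\<^sub>R y, r * w)"
  have U: "convex ?U" using convex_line_section[OF J, of t \<tau>] by simp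
  have cont: "continuous_on (?U \<times> cbox 0 1) (\<lambda>(s, r). ?f \<Phi> s r)"
    if "continuous_on (J \<times> UNIV \<times> UNIV) \<Phi>" for \<Phi> :: "real \<times> 'a \<times> real \<Rightarrow> complex"
    unfolding case_prod_beta'
    by (intro continuous_on_compose2[OF that] continuous_intros) auto
  have "((\<lambda>s. integral (cbox 0 1) (?f \<Psi> s)) has_vector_derivative integral (cbox 0 1) (?f D 0))
      (at 0 within ?U)"
  proof (rule leibniz_rule_vector_derivative[OF _ _ cont[OF D] _ U])
    show "0 \<in> ?U" using t by simp
    fix s assume s: "s \<in> ?U"
    have "continuous_on (cbox 0 1) (?f \<Psi> s)"
      using s by (intro continuous_on_compose2[OF \<Psi>] continuous_intros) auto
    then show "?f \<Psi> s integrable_on cbox 0 1" by (rule integrable_continuous)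
    fix r :: real
    show "((\<lambda>s. ?f \<Psi> s r) has_vector_derivative ?f D s r) (at s within ?U)"
      using has_pd_at[OF hd, of "(t, x, r * w)" s] s by simp
  qed
  then have "((\<lambda>s. of_real w * integral (cbox 0 1) (?f \<Psi> s)) has_vector_derivative
       of_real w * integral (cbox 0 1) (?f D 0)) (at 0 within ?U)"
    by (rule has_vector_derivative_mult_right)
  then show "((\<lambda>s. prim_u \<Psi> ((t, x, w) + s *\<^sub>R (\<tau>, y, 0))) has_vector_derivative prim_u D (t, x, w))
          (at 0 within {s. (t, x, w) + s *\<^sub>R (\<tau>, y, 0) \<in> J \<times> UNIV \<times> UNIV})"
    by (simp add: prim_u_def prim_def box_real)
qed

lemma has_pd_prim_u_state:
  fixes \<Psi> :: "real \<times> 'a::euclidean_space \<times> real \<Rightarrow> complex"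
  assumes \<Psi>: "continuous_on (J \<times> UNIV \<times> UNIV) \<Psi>"
  shows "has_pd (J \<times> UNIV \<times> UNIV) (0, 0, 1) (prim_u \<Psi>) \<Psi>"
  unfolding has_pd_def
proof safe
  fix t :: real and x :: 'a and w :: real assume t: "t \<in> J"
  have "continuous_on UNIV (\<lambda>k. \<Psi> (t, x, k))"
    using t by (intro continuous_on_compose2[OF \<Psi>] continuous_intros) auto
  then have "(prim (\<lambda>k. \<Psi> (t, x, k)) has_vector_derivative 1 *\<^sub>R \<Psi> (t, x, w)) (at (w + 0))"
    using prim_has_vector_derivative[of "\<lambda>k. \<Psi> (t, x, k)" w] by simp
  then have "((prim (\<lambda>k. \<Psi> (t, x, k)) \<circ> (\<lambda>s. w + s)) has_vector_derivative 1 *\<^sub>R \<Psi> (t, x, w)) (at 0)"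
    by (intro vector_diff_chain_at) (auto intro!: derivative_eq_intros)
  then show "((\<lambda>s. prim_u \<Psi> ((t, x, w) + s *\<^sub>R (0, 0, 1))) has_vector_derivative \<Psi> (t, x, w))
          (at 0 within {s. (t, x, w) + s *\<^sub>R (0, 0, 1) \<in> J \<times> UNIV \<times> UNIV})"
    using t by (simp add: prim_u_def o_def)
qed

lemma prim_cmult: "prim (\<lambda>k. c * h k) w = c * prim h w"
  by (simp add: prim_def mult.left_commute)

lemma prim_integrable:
  fixes h :: "real \<Rightarrow> complex"
  assumes "continuous_on UNIV h"
  shows "(\<lambda>s. h (s * w)) integrable_on {0..1 :: real}"
  by (intro integrable_continuous_real continuous_on_compose2[OF assms] continuous_intros) auto

lemma prim_diff:
  assumes "continuous_on UNIV h" "continuous_on UNIV h'"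
  shows "prim (\<lambda>k. h k - h' k) w = prim h w - prim h' w"
  unfolding prim_def
  by (subst Henstock_Kurzweil_Integration.integral_diff[OF prim_integrable[OF assms(1)] prim_integrable[OF assms(2)]])
    (simp add: right_diff_distrib)

lemma prim_sum:
  assumes "finite A" "\<And>i. i \<in> A \<Longrightarrow> continuous_on UNIV (h i)"
  shows "prim (\<lambda>k. \<Sum>i\<in>A. h i k) w = (\<Sum>i\<in>A. prim (h i) w)"
  unfolding prim_def
  by (subst Henstock_Kurzweil_Integration.integral_sum[OF assms(1) prim_integrable[OF assms(2)]])
    (simp_all add: sum_distrib_left)

lemma has_pd_state_fun:
  "has_pd S (\<tau>, y, 0) (\<lambda>q. c (snd (snd q))) (\<lambda>_. 0)"
  by (simp add: has_pd_def)

lemma has_pd_state_deriv: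
  fixes E :: "real \<Rightarrow> complex" and J :: "real set"
  assumes "\<And>w. (E has_vector_derivative E' w) (at w)"
  shows "has_pd (J \<times> (UNIV :: 'a::real_normed_vector set) \<times> UNIV) (0, 0, 1)
     (\<lambda>q. E (snd (snd q))) (\<lambda>q. E' (snd (snd q)))"
  unfolding has_pd_def
proof safe
  fix t :: real and x :: 'a and w :: real assume t: "t \<in> J"
  have "((E \<circ> (\<lambda>s. w + s)) has_vector_derivative 1 *\<^sub>R E' (w + 0)) (at 0)"
    by (intro vector_diff_chain_at assms) (auto intro!: derivative_eq_intros)
  then show "((\<lambda>s. E (snd (snd ((t, x, w) + s *\<^sub>R (0, 0, 1))))) has_vector_derivative E' (snd (snd (t, x, w))))
     (at 0 within {s. (t, x, w) + s *\<^sub>R (0, 0, 1) \<in> J \<times> UNIV \<times> UNIV})"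
    using t by (simp add: o_def)
qed

lemma continuous_prim:
  assumes "continuous_on UNIV h"
  shows "continuous_on UNIV (prim h)"
  by (intro continuous_at_imp_continuous_on ballI
      has_vector_derivative_continuous[OF prim_has_vector_derivative[OF assms]])

lemma continuous_prim_wave: "continuous_on UNIV (prim (wave \<xi>))"
  by (intro continuous_prim continuous_on_wave continuous_on_id)

lemma continuous_exp_entropy: "continuous_on UNIV (exp_entropy \<xi>)"
  by (intro continuous_at_imp_continuous_on ballI has_vector_derivative_continuous[OF exp_entropy_has_vector_derivative])

lemma Ck_on_exp_entropy: "Ck_on 1 UNIV (exp_entropy \<xi>)"
proof -
  have t: "thick (UNIV :: real set) 1"
    by (simp add: thick_def)
  have h: "has_pd UNIV 1 (exp_entropy \<xi>) (\<lambda>w. 2 * prim (wave \<xi>) w)"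
    unfolding has_pd_def
  proof
    fix w :: real
    have "((exp_entropy \<xi> \<circ> (\<lambda>s. w + s)) has_vector_derivative 1 *\<^sub>R (2 * prim (wave \<xi>) (w + 0))) (at 0)"
      by (intro vector_diff_chain_at exp_entropy_has_vector_derivative) (auto intro!: derivative_eq_intros)
    then show "((\<lambda>s. exp_entropy \<xi> (w + s *\<^sub>R 1)) has_vector_derivative 2 * prim (wave \<xi>) w)
        (at 0 within {s. w + s *\<^sub>R 1 \<in> UNIV})"
      by (simp add: o_def)
  qed
  have "continuous_on UNIV (pd UNIV 1 (exp_entropy \<xi>))"
    using continuous_on_mult[OF continuous_on_const[of UNIV 2] continuous_prim_wave]
    by (simp add: has_pd_imp_pd_eq[OF h t] cong: continuous_on_cong)
  then show ?thesis
    using has_pd_imp_has_pd_on[OF h] continuous_exp_entropy by simp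
qed

section \<open>Distributions, Fourier-Laplace transforms and Borel representatives\<close>

text \<open>
  Seminorms of order one suffice for such a functional. The sum over lists of length at most one has
  nonnegative terms, so it dominates the supremum of \<open>\<phi>\<close> (empty list) and of each first derivative
  (singletons).
\<close>

lemma distribution_on_first_orderI:
  fixes S :: "'a::euclidean_space set"
  assumes S: "\<And>b. b \<in> Basis \<Longrightarrow> thick S b"
    and add: "\<And>\<phi> \<psi>. \<phi> \<in> Ckc 1 S \<Longrightarrow> \<psi> \<in> Ckc 1 S \<Longrightarrow> L (\<lambda>p. \<phi> p + \<psi> p) = L \<phi> + L \<psi>"
    and mult: "\<And>c \<phi>. \<phi> \<in> Ckc 1 S \<Longrightarrow> L (\<lambda>p. c * \<phi> p) = c * L \<phi>"
    and bound: "\<And>K. compact K \<Longrightarrow> K \<subseteq> S \<Longrightarrow> \<exists>C. \<forall>\<phi> M. \<phi> \<in> Ckc 1 S \<longrightarrow> (\<forall>p\<in>S - K. \<phi> p = 0) \<longrightarrow>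
        (\<forall>p\<in>S. norm (\<phi> p) \<le> M) \<longrightarrow> (\<forall>b\<in>Basis. \<forall>p\<in>S. norm (pd S b \<phi> p) \<le> M) \<longrightarrow> norm (L \<phi>) \<le> C * M"
  shows "distribution_on S L"
  unfolding distribution_on_def
proof (intro conjI ballI allI impI)
  fix K assume K: "compact K \<and> K \<subseteq> S"
  then obtain C where C: "\<And>\<phi> M. \<phi> \<in> Ckc 1 S \<Longrightarrow> (\<And>p. p \<in> S - K \<Longrightarrow> \<phi> p = 0) \<Longrightarrow>
        (\<And>p. p \<in> S \<Longrightarrow> norm (\<phi> p) \<le> M) \<Longrightarrow> (\<And>b p. b \<in> Basis \<Longrightarrow> p \<in> S \<Longrightarrow> norm (pd S b \<phi> p) \<le> M) \<Longrightarrow> norm (L \<phi>) \<le> C * M"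
    using bound[of K] by blast
  let ?V = "{vs :: 'a list. set vs \<subseteq> Basis \<and> length vs \<le> 1}"
  have fin: "finite ?V" by (rule finite_lists_length_le) simp
  show "\<exists>C N. \<forall>\<phi>\<in>test_functions S. support_on S \<phi> \<subseteq> K \<longrightarrow> cmod (L \<phi>) \<le>
      C * (\<Sum>vs | set vs \<subseteq> Basis \<and> length vs \<le> N. SUP p\<in>S. cmod (foldr (pd S) vs \<phi> p))"
  proof (intro exI[of _ C] exI[of _ 1] ballI impI)
    fix \<phi> assume \<phi>: "\<phi> \<in> test_functions S" and supp: "support_on S \<phi> \<subseteq> K"
    let ?N = "\<lambda>vs. SUP p\<in>S. cmod (foldr (pd S) vs \<phi> p)"
    have \<phi>1: "\<phi> \<in> Ckc 1 S" using \<phi> by (rule test_functions_imp_Ckc)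
    have off: "\<phi> p = 0" if "p \<in> S - K" for p using that supp by (auto simp: support_on_def)
    note cont = Ckc_1_continuous[OF \<phi>1] and pd = Ckc_1_has_pd[OF \<phi>1] Ckc_1_continuous_pd[OF \<phi>1]
    have sup: "bdd_above ((\<lambda>p. cmod (q p)) ` S)"
      if q: "continuous_on S q" "\<And>p. p \<in> S - K \<Longrightarrow> q p = 0" for q
    proof -
      have "bounded (q ` K)"
        using K q(1) by (intro compact_imp_bounded compact_continuous_image) (auto intro: continuous_on_subset)
      then obtain B where B: "\<And>p. p \<in> K \<Longrightarrow> cmod (q p) \<le> B" by (auto simp: bounded_iff)
      have "cmod (q p) \<le> max B 0" if "p \<in> S" for p
        using B[of p] q(2)[of p] that by (cases "p \<in> K") auto
      then show ?thesis by (rule bdd_aboveI2)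
    qed
    have bdd: "bdd_above ((\<lambda>p. cmod (foldr (pd S) vs \<phi> p)) ` S)" if "vs \<in> ?V" for vs
    proof (cases vs)
      case Nil
      then show ?thesis using sup[OF cont off] by simp
    next
      case (Cons b l)
      then have b: "b \<in> Basis" and l: "l = []" using that by auto
      have "pd S b \<phi> p = 0" if "p \<in> S - K" for p
        using K that off
        by (intro has_pd_eq_0_off[OF S[OF b] pd(1)[OF b], where K = K]) (auto intro: compact_imp_closed)
      from sup[OF pd(2)[OF b] this] show ?thesis by (simp add: Cons l)
    qed
    have le: "cmod (foldr (pd S) vs \<phi> p) \<le> (\<Sum>vs\<in>?V. ?N vs)" if "vs \<in> ?V" "p \<in> S" for vs p
    proof -
      have "0 \<le> ?N vs" if "vs \<in> ?V" for vs
        by (rule order_trans[OF norm_ge_zero cSUP_upper[OF \<open>p \<in> S\<close> bdd[OF that]]])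
      then have "?N vs \<le> (\<Sum>vs\<in>?V. ?N vs)"
        using that(1) fin by (intro member_le_sum) auto
      with cSUP_upper[OF that(2) bdd[OF that(1)]] show ?thesis by linarith
    qed
    have "cmod (L \<phi>) \<le> C * (\<Sum>vs\<in>?V. ?N vs)"
    proof (rule C[OF \<phi>1 off])
      show "cmod (\<phi> p) \<le> (\<Sum>vs\<in>?V. ?N vs)" if "p \<in> S" for p
        using le[of "[]" p] that by simp
      show "cmod (pd S b \<phi> p) \<le> (\<Sum>vs\<in>?V. ?N vs)" if "b \<in> Basis" "p \<in> S" for b p
        using le[of "[b]" p] that by simp
    qed
    then show "cmod (L \<phi>) \<le> C * (\<Sum>vs | set vs \<subseteq> Basis \<and> length vs \<le> 1. ?N vs)" .
  qed
qed (blast intro: add mult test_functions_imp_Ckc)+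

lemma distribution_on_cong:
  fixes S :: "'a::euclidean_space set"
  assumes S: "\<And>b. b \<in> Basis \<Longrightarrow> thick S b" and eq: "\<And>\<phi>. \<phi> \<in> Ckc 1 S \<Longrightarrow> L \<phi> = L' \<phi>"
    and L': "distribution_on S L'"
  shows "distribution_on S L"
proof -
  have t: "\<phi> \<in> Ckc 1 S" if "\<phi> \<in> test_functions S" for \<phi> :: "'a \<Rightarrow> complex"
    using that by (rule test_functions_imp_Ckc)
  have a: "L (\<lambda>p. \<phi> p + \<psi> p) = L' (\<lambda>p. \<phi> p + \<psi> p)"
    if "\<phi> \<in> test_functions S" "\<psi> \<in> test_functions S" for \<phi> \<psi>
    by (rule eq[OF Ckc_1_add[OF S t[OF that(1)] t[OF that(2)]]])
  have m: "L (\<lambda>p. c * \<phi> p) = L' (\<lambda>p. c * \<phi> p)" if "\<phi> \<in> test_functions S" for \<phi> c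
    by (rule eq[OF Ckc_1_bounded_linear[OF S bounded_linear_mult_right t[OF that]]])
  have e: "L \<phi> = L' \<phi>" if "\<phi> \<in> test_functions S" for \<phi>
    by (rule eq[OF t[OF that]])
  show ?thesis
    using L' unfolding distribution_on_def by (simp add: a m e cong: ball_cong)
qed

text \<open>
  Since \<open>m\<close> has bounded support, the exponential series may be integrated term by term; the result is a
  power series in \<open>\<xi>\<close> that converges everywhere.
\<close>

lemma holomorphic_Fourier_Laplace:
  assumes m: "integrable lborel m" and 0: "\<And>k. R < \<bar>k\<bar> \<Longrightarrow> m k = 0"
  shows "(\<lambda>\<xi>. \<integral>k. m k * exp (- \<i> * \<xi> * complex_of_real k) \<partial>lborel) holomorphic_on UNIV"
proof -
  let ?f = "\<lambda>\<xi> n k. m k * (- \<i> * \<xi> * complex_of_real k) ^ n /\<^sub>R fact n"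
  let ?a = "\<lambda>n. \<integral>k. m k * (- \<i> * complex_of_real k) ^ n /\<^sub>R fact n \<partial>lborel"
  let ?F = "\<lambda>\<xi>. \<integral>k. m k * exp (- \<i> * \<xi> * complex_of_real k) \<partial>lborel"
  have [measurable]: "m \<in> borel_measurable borel" using m by auto
  have bound: "norm (?f \<xi> n k) \<le> norm (m k) * ((norm \<xi> * \<bar>R\<bar>) ^ n /\<^sub>R fact n)" for \<xi> n k
  proof (cases "R < \<bar>k\<bar>")
    case False
    then have "(norm \<xi> * \<bar>k\<bar>) ^ n \<le> (norm \<xi> * \<bar>R\<bar>) ^ n"
      by (intro power_mono mult_left_mono) auto
    then show ?thesis
      by (simp add: norm_mult norm_power mult_left_mono divide_right_mono field_simps)
  qed (simp add: 0)
  have int: "integrable lborel (?f \<xi> n)" for \<xi> n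
  proof (rule Bochner_Integration.integrable_bound)
    show "integrable lborel (\<lambda>k. norm (m k) * ((norm \<xi> * \<bar>R\<bar>) ^ n /\<^sub>R fact n))"
      using m by (intro integrable_mult_left integrable_norm)
    show "AE k in lborel. norm (?f \<xi> n k) \<le> norm (norm (m k) * ((norm \<xi> * \<bar>R\<bar>) ^ n /\<^sub>R fact n))"
      by (intro AE_I2 order_trans[OF bound]) simp
  qed measurable
  have sums: "(\<lambda>n. ?a n * (\<xi> - 0) ^ n) sums ?F \<xi>" for \<xi>
  proof -
    have "(\<lambda>n. integral\<^sup>L lborel (?f \<xi> n)) sums (\<integral>k. (\<Sum>n. ?f \<xi> n k) \<partial>lborel)"
    proof (rule sums_integral[OF int])
      have "summable (\<lambda>n. norm (?f \<xi> n k))" for k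
      proof (rule summable_comparison_test'[where N = 0])
        show "summable (\<lambda>n. norm (m k) * ((norm \<xi> * \<bar>R\<bar>) ^ n /\<^sub>R fact n))"
          by (intro summable_mult summable_exp_generic)
        show "norm (norm (?f \<xi> n k)) \<le> norm (m k) * ((norm \<xi> * \<bar>R\<bar>) ^ n /\<^sub>R fact n)" for n
          by (simp only: real_norm_def abs_norm_cancel bound)
      qed
      then show "AE k in lborel. summable (\<lambda>n. norm (?f \<xi> n k))"
        by (rule AE_I2)
      have g: "summable (\<lambda>n. (\<integral>k. norm (m k) \<partial>lborel) * ((norm \<xi> * \<bar>R\<bar>) ^ n /\<^sub>R fact n))"
        by (intro summable_mult summable_exp_generic)
      have le: "(\<integral>k. norm (?f \<xi> n k) \<partial>lborel)
          \<le> (\<integral>k. norm (m k) \<partial>lborel) * ((norm \<xi> * \<bar>R\<bar>) ^ n /\<^sub>R fact n)" for n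
      proof -
        have "(\<integral>k. norm (?f \<xi> n k) \<partial>lborel) \<le> (\<integral>k. norm (m k) * ((norm \<xi> * \<bar>R\<bar>) ^ n /\<^sub>R fact n) \<partial>lborel)"
          by (rule integral_mono[OF integrable_norm[OF int] integrable_mult_left[OF integrable_norm[OF m]] bound])
        then show ?thesis by simp
      qed
      show "summable (\<lambda>n. \<integral>k. norm (?f \<xi> n k) \<partial>lborel)"
      proof (rule summable_comparison_test'[OF g, where N = 0])
        show "norm (\<integral>k. norm (?f \<xi> n k) \<partial>lborel)
          \<le> (\<integral>k. norm (m k) \<partial>lborel) * ((norm \<xi> * \<bar>R\<bar>) ^ n /\<^sub>R fact n)" for n
          using le[of n] by (simp only: real_norm_def abs_of_nonneg[OF Bochner_Integration.integral_nonneg[OF norm_ge_zero]])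
      qed
    qed
    moreover have "(\<Sum>n. ?f \<xi> n k) = m k * exp (- \<i> * \<xi> * complex_of_real k)" for k
    proof -
      have "(\<lambda>n. m k * ((- \<i> * \<xi> * complex_of_real k) ^ n /\<^sub>R fact n)) sums (m k * exp (- \<i> * \<xi> * complex_of_real k))"
        by (intro sums_mult exp_converges)
      then show ?thesis by (simp add: sums_iff)
    qed
    moreover have "integral\<^sup>L lborel (?f \<xi> n) = ?a n * (\<xi> - 0) ^ n" for n
    proof -
      have "?f \<xi> n = (\<lambda>k. m k * (- \<i> * complex_of_real k) ^ n /\<^sub>R fact n * \<xi> ^ n)"
        by (simp add: fun_eq_iff power_mult_distrib mult_ac power_minus')
      then show ?thesis by simp
    qed
    ultimately show ?thesis by simp
  qed
  have "?F field_differentiable at z" for z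
  proof -
    have "?F holomorphic_on ball 0 (norm z + 1)"
      by (rule power_series_holomorphic[OF sums])
    then show ?thesis
      by (rule holomorphic_on_imp_differentiable_at) auto
  qed
  then show ?thesis by (simp add: holomorphic_on_def)
qed

text \<open>
  In a complete space, measurability passes from a function to any other that agrees with it almost
  everywhere. If neither is measurable, both integrals are \<open>0\<close> by convention.
\<close>

lemma (in complete_measure) integral_cong_AE':
  fixes f g :: "'a \<Rightarrow> 'b::{banach, second_countable_topology}"
  assumes ae: "AE x in M. f x = g x"
  shows "integral\<^sup>L M f = integral\<^sup>L M g"
proof -
  have meas: "h' \<in> borel_measurable M" if "h \<in> borel_measurable M" "AE x in M. h x = h' x"
    for h h' :: "'a \<Rightarrow> 'b"
  proof (rule measurableI)
    fix A :: "'b set" assume A: "A \<in> sets borel"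
    show "h' -` A \<inter> space M \<in> sets M"
    proof (rule in_sets_AE)
      show "h -` A \<inter> space M \<in> sets M" using that(1) A by (rule measurable_sets)
      show "AE x in M. (x \<in> h -` A \<inter> space M) = (x \<in> h' -` A \<inter> space M)"
        using that(2) by eventually_elim auto
    qed simp
  qed simp
  have ae': "AE x in M. g x = f x" using ae by eventually_elim simp
  show ?thesis
  proof (cases "f \<in> borel_measurable M")
    case True
    then show ?thesis using meas[OF True ae] ae by (intro integral_cong_AE)
  next
    case False
    then have "g \<notin> borel_measurable M" using meas[OF _ ae'] by blast
    with False show ?thesis
      by (metis borel_measurable_integrable not_integrable_integral_eq)
  qed
qed

lemma set_integral_cong_AE_lebesgue:
  fixes f g :: "'a::euclidean_space \<Rightarrow> 'b::{banach, second_countable_topology}"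
  assumes "AE x in lebesgue. x \<in> S \<longrightarrow> f x = g x"
  shows "(LINT x:S|lebesgue. f x) = (LINT x:S|lebesgue. g x)"
  unfolding set_lebesgue_integral_def
proof (rule completion.integral_cong_AE')
  show "AE x in lebesgue. indicat_real S x *\<^sub>R f x = indicat_real S x *\<^sub>R g x"
    using assms by eventually_elim (auto simp: indicator_def)
qed

text \<open>
  Provides the representatives for which Fubini is available. Truncation at the essential bound
  makes the bound hold at every point.
\<close>

lemma ex_bounded_borel_AE_eq:
  fixes S :: "'a::euclidean_space set"
  assumes S: "S \<in> sets borel" and u: "Linfty (lebesgue_on S) u"
  shows "\<exists>v R. v \<in> borel_measurable borel \<and> (\<forall>p. \<bar>v p\<bar> \<le> R) \<and> (AE p in lebesgue. p \<in> S \<longrightarrow> u p = v p)"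
proof -
  obtain C where um: "u \<in> borel_measurable (lebesgue_on S)" and C: "AE p in lebesgue_on S. \<bar>u p\<bar> \<le> C"
    using u by (auto simp: Linfty_def)
  have Sl: "S \<inter> space lebesgue \<in> sets lebesgue" using S by auto
  have "(\<lambda>p. indicator S p *\<^sub>R u p) \<in> borel_measurable lebesgue"
    using um Sl by (simp add: borel_measurable_restrict_space_iff)
  from completion_ex_borel_measurable_real[OF this]
  obtain w where w: "w \<in> borel_measurable lborel" "AE p in lborel. indicator S p *\<^sub>R u p = w p" by blast
  define v where "v p = max (- \<bar>C\<bar>) (min \<bar>C\<bar> (w p))" for p
  have "AE p in lebesgue. indicator S p *\<^sub>R u p = w p" using w(2) by (rule AE_completion)
  moreover have "AE p in lebesgue. p \<in> S \<longrightarrow> \<bar>u p\<bar> \<le> C"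
    using C Sl by (simp add: AE_restrict_space_iff)
  ultimately have "AE p in lebesgue. p \<in> S \<longrightarrow> u p = v p"
    by eventually_elim (auto simp: v_def)
  moreover have "v \<in> borel_measurable borel" using w(1) unfolding v_def by simp
  moreover have "\<bar>v p\<bar> \<le> \<bar>C\<bar>" for p by (auto simp: v_def)
  ultimately show ?thesis by blast
qed

section \<open>First-order functionals of a test function\<close>

locale time_domain =
  fixes I :: "real set"
  assumes time_interval: "I = {0..} \<or> (\<exists>T>0. I = {0..<T})"
begin

lemma zero_in_I: "0 \<in> I"
  using time_interval by auto

lemma ex_pos_in_I: "\<exists>b\<in>I. 0 < b"
  using time_interval
proof (elim disjE exE conjE)
  assume "I = {0..}"
  then show ?thesis by (intro bexI[of _ 1]) auto
next
  fix T :: real assume "I = {0..<T}" "0 < T"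
  then show ?thesis by (intro bexI[of _ "T / 2"]) auto
qed

lemma convex_I: "convex I" and borel_I: "I \<in> sets borel"
  using time_interval by auto

lemma Om_borel: "(Om I :: 'n::finite point set) \<in> sets borel"
  using borel_I by (intro borel_Times) auto

lemma thick_Om: "thick (Om I :: 'n::finite point set) v"
proof -
  obtain b where "b \<in> I" "0 < b" using ex_pos_in_I by blast
  then show ?thesis using zero_in_I convex_I by (intro thick_strip[of I 0 b]) auto
qed

lemma thick_flux_dom: "thick (flux_dom I :: 'n::finite state set) v"
proof -
  obtain b where "b \<in> I" "0 < b" using ex_pos_in_I by blast
  then have "thick (closure I \<times> (UNIV :: ((real^'n) \<times> real) set)) v"
    using zero_in_I closure_subset[of I] convex_closure[OF convex_I]
    by (intro thick_strip[of "closure I" 0 b]) auto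
  then show ?thesis by simp
qed

lemma basis_point: "((1, 0) :: 'n::finite point) \<in> Basis" "((0, axis i 1) :: 'n::finite point) \<in> Basis"
  by (auto simp: Basis_prod_def Basis_vec_def)

lemma test_support:
  fixes \<phi> :: "'n::finite point \<Rightarrow> complex"
  assumes "\<phi> \<in> Ckc 1 (Om I)" "closed K" "\<forall>p\<in>Om I - K. \<phi> p = 0" "p \<in> Om I - K"
  shows "dt I \<phi> p = 0" "dx I i \<phi> p = 0"
proof -
  show "dt I \<phi> p = 0"
    by (rule has_pd_eq_0_off[OF thick_Om Ckc_1_has_pd[OF assms(1) basis_point(1)] assms(2) bspec[OF assms(3)] assms(4)])
  show "dx I i \<phi> p = 0"
    by (rule has_pd_eq_0_off[OF thick_Om Ckc_1_has_pd[OF assms(1) basis_point(2)] assms(2) bspec[OF assms(3)] assms(4)])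
qed

definition coeffs ::
  "('n::finite point \<Rightarrow> complex) \<Rightarrow> ('n \<Rightarrow> 'n point \<Rightarrow> complex) \<Rightarrow> ('n point \<Rightarrow> complex) \<Rightarrow>
   (real^'n \<Rightarrow> complex) \<Rightarrow> bool" where
  "coeffs c0 c1 c2 c3 \<longleftrightarrow> loc_bounded (Om I) c0 \<and> (\<forall>i. loc_bounded (Om I) (c1 i)) \<and>
     loc_bounded (Om I) c2 \<and> loc_bounded UNIV c3"

text \<open>
  The integrand over the space-time domain in \<open>first_order\<close>.
\<close>

definition symbol ::
  "('n::finite point \<Rightarrow> complex) \<Rightarrow> ('n \<Rightarrow> 'n point \<Rightarrow> complex) \<Rightarrow> ('n point \<Rightarrow> complex) \<Rightarrow>
   ('n point \<Rightarrow> complex) \<Rightarrow> 'n point \<Rightarrow> complex" where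
  "symbol c0 c1 c2 \<phi> p = c0 p * dt I \<phi> p + (\<Sum>i\<in>UNIV. c1 i p * dx I i \<phi> p) + c2 p * \<phi> p"

text \<open>
  The common form of the weak formulation, the entropy productions and the Kruzhkov productions. The
  integrals are taken for the Borel measure so that Fubini applies; \<open>first_order_lebesgue\<close> returns to
  the Lebesgue measure.
\<close>

definition first_order ::
  "('n::finite point \<Rightarrow> complex) \<Rightarrow> ('n \<Rightarrow> 'n point \<Rightarrow> complex) \<Rightarrow> ('n point \<Rightarrow> complex) \<Rightarrow>
   (real^'n \<Rightarrow> complex) \<Rightarrow> ('n point \<Rightarrow> complex) \<Rightarrow> complex" where
  "first_order c0 c1 c2 c3 \<phi> =
     (LINT p:Om I|lborel. symbol c0 c1 c2 \<phi> p) + (LINT x:UNIV|lborel. c3 x * \<phi> (0, x))"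

lemma symbol_0_off:
  assumes "\<phi> \<in> Ckc 1 (Om I)" "closed K" "\<forall>p\<in>Om I - K. \<phi> p = 0" "p \<in> Om I - K"
  shows "symbol c0 c1 c2 \<phi> p = 0"
  using test_support[OF assms] bspec[OF assms(3,4)] by (simp add: symbol_def)

lemma loc_bounded_test:
  fixes \<phi> :: "'n::finite point \<Rightarrow> complex"
  assumes "\<phi> \<in> Ckc 1 (Om I)"
  shows "loc_bounded (Om I) \<phi>" "loc_bounded (Om I) (dt I \<phi>)" "loc_bounded (Om I) (dx I i \<phi>)"
    "loc_bounded UNIV (\<lambda>x. \<phi> (0, x))"
proof -
  show "loc_bounded (Om I) \<phi>"
    by (rule loc_bounded_continuous[OF Om_borel Ckc_1_continuous[OF assms]])
  show "loc_bounded (Om I) (dt I \<phi>)"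
    by (rule loc_bounded_continuous[OF Om_borel Ckc_1_continuous_pd[OF assms basis_point(1)]])
  show "loc_bounded (Om I) (dx I i \<phi>)"
    by (rule loc_bounded_continuous[OF Om_borel Ckc_1_continuous_pd[OF assms basis_point(2)]])
  have "continuous_on UNIV (\<lambda>x. \<phi> (0, x))"
    using zero_in_I by (intro continuous_on_compose2[OF Ckc_1_continuous[OF assms]] continuous_intros) auto
  then show "loc_bounded UNIV (\<lambda>x. \<phi> (0, x))"
    by (intro loc_bounded_continuous) auto
qed

lemma loc_bounded_symbol:
  fixes \<phi> :: "'n::finite point \<Rightarrow> complex"
  assumes "coeffs c0 c1 c2 c3" "\<phi> \<in> Ckc 1 (Om I)"
  shows "loc_bounded (Om I) (symbol c0 c1 c2 \<phi>)"
  unfolding symbol_def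
  using assms(1) loc_bounded_test[OF assms(2)]
  by (intro loc_bounded_add loc_bounded_mult loc_bounded_sum Om_borel) (auto simp: coeffs_def)

lemma trace_support:
  fixes \<phi> :: "'n::finite point \<Rightarrow> complex"
  assumes "compact K" "\<forall>p\<in>Om I - K. \<phi> p = 0"
  shows "compact (snd ` K)" "\<And>x. x \<in> UNIV - snd ` K \<Longrightarrow> \<phi> (0, x) = 0"
proof -
  show "compact (snd ` K)"
    using assms(1) by (intro compact_continuous_image continuous_intros)
  show "\<phi> (0, x) = 0" if "x \<in> UNIV - snd ` K" for x
    using that zero_in_I by (intro bspec[OF assms(2)]) force
qed

lemma integrable_coeff:
  fixes \<phi> :: "'n::finite point \<Rightarrow> complex"
  assumes "loc_bounded (Om I) c" "\<phi> \<in> Ckc 1 (Om I)"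
  shows "set_integrable lborel (Om I) (\<lambda>p. c p * \<phi> p)"
proof -
  obtain K where "compact K \<and> K \<subseteq> Om I \<and> (\<forall>p\<in>Om I - K. \<phi> p = 0)"
    using Ckc_1_support[OF assms(2)] ..
  note K = this[THEN conjunct1] this[THEN conjunct2, THEN conjunct1]
    this[THEN conjunct2, THEN conjunct2]
  show ?thesis
    by (rule set_integrable_loc_bounded[OF loc_bounded_mult[OF assms(1) loc_bounded_test(1)[OF assms(2)]] K(1,2)])
      (simp only: bspec[OF K(3)] mult_zero_right)
qed

lemma integrable_symbol:
  fixes \<phi> :: "'n::finite point \<Rightarrow> complex"
  assumes c: "coeffs c0 c1 c2 c3" and \<phi>: "\<phi> \<in> Ckc 1 (Om I)"
  shows "set_integrable lborel (Om I) (symbol c0 c1 c2 \<phi>)"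
    and "set_integrable lborel UNIV (\<lambda>x. c3 x * \<phi> (0, x))"
proof -
  obtain K where "compact K \<and> K \<subseteq> Om I \<and> (\<forall>p\<in>Om I - K. \<phi> p = 0)"
    using Ckc_1_support[OF \<phi>] ..
  note K = this[THEN conjunct1] this[THEN conjunct2, THEN conjunct1]
    this[THEN conjunct2, THEN conjunct2]
  show "set_integrable lborel (Om I) (symbol c0 c1 c2 \<phi>)"
    by (rule set_integrable_loc_bounded[OF loc_bounded_symbol[OF c \<phi>] K(1,2)])
      (rule symbol_0_off[OF \<phi> compact_imp_closed[OF K(1)] K(3)])
  have "loc_bounded UNIV (\<lambda>x. c3 x * \<phi> (0, x))"
    using c by (intro loc_bounded_mult loc_bounded_test(4)[OF \<phi>]) (simp add: coeffs_def)
  then show "set_integrable lborel UNIV (\<lambda>x. c3 x * \<phi> (0, x))"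
    by (rule set_integrable_loc_bounded[OF _ trace_support(1)[OF K(1,3)] subset_UNIV])
      (use trace_support(2)[OF K(1,3)] in auto)
qed

lemma first_order_linear:
  fixes \<phi> :: "'n::finite point \<Rightarrow> complex"
  assumes c: "coeffs c0 c1 c2 c3" and d: "coeffs d0 d1 d2 d3" and \<phi>: "\<phi> \<in> Ckc 1 (Om I)"
  shows "first_order (\<lambda>p. c0 p + a * d0 p) (\<lambda>i p. c1 i p + a * d1 i p) (\<lambda>p. c2 p + a * d2 p)
      (\<lambda>x. c3 x + a * d3 x) \<phi> = first_order c0 c1 c2 c3 \<phi> + a * first_order d0 d1 d2 d3 \<phi>"
proof -
  have s: "symbol (\<lambda>p. c0 p + a * d0 p) (\<lambda>i p. c1 i p + a * d1 i p) (\<lambda>p. c2 p + a * d2 p) \<phi>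
     = (\<lambda>p. symbol c0 c1 c2 \<phi> p + a * symbol d0 d1 d2 \<phi> p)"
    by (simp add: fun_eq_iff symbol_def distrib_left distrib_right sum.distrib sum_distrib_left mult.assoc)
  have t: "(\<lambda>x. (c3 x + a * d3 x) * \<phi> (0, x)) = (\<lambda>x. c3 x * \<phi> (0, x) + a * (d3 x * \<phi> (0, x)))"
    by (simp add: fun_eq_iff algebra_simps)
  show ?thesis
    unfolding first_order_def s t
    using integrable_symbol[OF c \<phi>] integrable_symbol[OF d \<phi>]
    by (simp add: set_integral_add algebra_simps)
qed

lemma coeffs_linear:
  assumes "coeffs c0 c1 c2 c3" "coeffs d0 d1 d2 d3"
  shows "coeffs (\<lambda>p. c0 p + a * d0 p) (\<lambda>i p. c1 i p + a * d1 i p) (\<lambda>p. c2 p + a * d2 p) (\<lambda>x. c3 x + a * d3 x)"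
  using assms loc_bounded_const[OF Om_borel, of a] loc_bounded_const[of UNIV a] unfolding coeffs_def
  by (intro conjI allI loc_bounded_add loc_bounded_mult; simp)

lemma first_order_cong:
  assumes "\<And>p. p \<in> Om I \<Longrightarrow> c0 p = d0 p" "\<And>i p. p \<in> Om I \<Longrightarrow> c1 i p = d1 i p"
    "\<And>p. p \<in> Om I \<Longrightarrow> c2 p = d2 p" "\<And>x. c3 x = d3 x"
  shows "first_order c0 c1 c2 c3 \<phi> = first_order d0 d1 d2 d3 \<phi>"
proof -
  have "(LINT p:Om I|lborel. symbol c0 c1 c2 \<phi> p) = (LINT p:Om I|lborel. symbol d0 d1 d2 \<phi> p)"
    using Om_borel by (intro set_lebesgue_integral_cong) (auto simp: symbol_def assms(1,2,3))
  then show ?thesis by (simp add: first_order_def assms(4))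
qed

lemma pd_test_add:
  fixes \<phi> \<psi> :: "'n::finite point \<Rightarrow> complex"
  assumes "\<phi> \<in> Ckc 1 (Om I)" "\<psi> \<in> Ckc 1 (Om I)" "b \<in> Basis" "p \<in> Om I"
  shows "pd (Om I) b (\<lambda>p. \<phi> p + \<psi> p) p = pd (Om I) b \<phi> p + pd (Om I) b \<psi> p"
  by (rule has_pd_imp_pd_eq[OF has_pd_add[OF Ckc_1_has_pd[OF assms(1,3)] Ckc_1_has_pd[OF assms(2,3)]]
        thick_Om assms(4)])

lemma pd_test_bounded_linear:
  fixes \<phi> :: "'n::finite point \<Rightarrow> complex"
  assumes "\<phi> \<in> Ckc 1 (Om I)" "bounded_linear L" "b \<in> Basis" "p \<in> Om I"
  shows "pd (Om I) b (\<lambda>p. L (\<phi> p)) p = L (pd (Om I) b \<phi> p)"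
  by (rule has_pd_imp_pd_eq[OF has_pd_bounded_linear[OF assms(2) Ckc_1_has_pd[OF assms(1,3)]]
        thick_Om assms(4)])

text \<open>
  On a compact \<open>K\<close> the coefficients are bounded, so a test function supported in \<open>K\<close> is estimated by
  its \<open>C\<^sup>1\<close> norm times the measure of \<open>K\<close> and of its spatial projection.
\<close>

lemma distribution_on_first_order:
  fixes c1 :: "'n::finite \<Rightarrow> 'n point \<Rightarrow> complex"
  assumes c: "coeffs c0 c1 c2 c3"
  shows "distribution_on (Om I) (first_order c0 c1 c2 c3)"
proof (rule distribution_on_first_orderI)
  fix \<phi> \<psi> :: "'n point \<Rightarrow> complex" and a
  assume \<phi>: "\<phi> \<in> Ckc 1 (Om I)"
  {
    assume \<psi>: "\<psi> \<in> Ckc 1 (Om I)"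
    have "(LINT p:Om I|lborel. symbol c0 c1 c2 (\<lambda>p. \<phi> p + \<psi> p) p)
        = (LINT p:Om I|lborel. symbol c0 c1 c2 \<phi> p + symbol c0 c1 c2 \<psi> p)"
    proof (rule set_lebesgue_integral_cong)
      show "\<forall>p. p \<in> Om I \<longrightarrow> symbol c0 c1 c2 (\<lambda>p. \<phi> p + \<psi> p) p = symbol c0 c1 c2 \<phi> p + symbol c0 c1 c2 \<psi> p"
        by (simp add: symbol_def pd_test_add[OF \<phi> \<psi>] basis_point distrib_left sum.distrib)
    qed (use Om_borel in simp)
    moreover have "(\<lambda>x. c3 x * (\<phi> (0, x) + \<psi> (0, x))) = (\<lambda>x. c3 x * \<phi> (0, x) + c3 x * \<psi> (0, x))"
      by (simp add: fun_eq_iff algebra_simps)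
    ultimately show "first_order c0 c1 c2 c3 (\<lambda>p. \<phi> p + \<psi> p) = first_order c0 c1 c2 c3 \<phi> + first_order c0 c1 c2 c3 \<psi>"
      using integrable_symbol[OF c \<phi>] integrable_symbol[OF c \<psi>]
      by (simp add: first_order_def set_integral_add)
  }
  have "(LINT p:Om I|lborel. symbol c0 c1 c2 (\<lambda>p. a * \<phi> p) p)
      = (LINT p:Om I|lborel. a * symbol c0 c1 c2 \<phi> p)"
  proof (rule set_lebesgue_integral_cong)
    show "\<forall>p. p \<in> Om I \<longrightarrow> symbol c0 c1 c2 (\<lambda>p. a * \<phi> p) p = a * symbol c0 c1 c2 \<phi> p"
      by (simp add: symbol_def pd_test_bounded_linear[OF \<phi> bounded_linear_mult_right[of a]] basis_point
          distrib_left sum_distrib_left mult.left_commute)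
  qed (use Om_borel in simp)
  moreover have "(\<lambda>x. c3 x * (a * \<phi> (0, x))) = (\<lambda>x. a * (c3 x * \<phi> (0, x)))"
    by (simp add: fun_eq_iff algebra_simps)
  ultimately show "first_order c0 c1 c2 c3 (\<lambda>p. a * \<phi> p) = a * first_order c0 c1 c2 c3 \<phi>"
    by (simp add: first_order_def algebra_simps)
next
  fix K :: "'n point set" assume K: "compact K" "K \<subseteq> Om I"
  have "bounded (q ` K)" if "loc_bounded (Om I) q" for q
    using K that by (auto simp: loc_bounded_def)
  then have ex: "\<exists>B. \<forall>p\<in>K. norm (q p) \<le> B" if "loc_bounded (Om I) q" for q
    using that by (auto simp: bounded_iff)
  obtain B0 where B0: "\<And>p. p \<in> K \<Longrightarrow> norm (c0 p) \<le> B0" using ex[of c0] c by (auto simp: coeffs_def)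
  have "\<forall>i. \<exists>B. \<forall>p\<in>K. norm (c1 i p) \<le> B" using ex c by (auto simp: coeffs_def)
  then obtain B1 where B1: "\<And>i p. p \<in> K \<Longrightarrow> norm (c1 i p) \<le> B1 i" by metis
  obtain B2 where B2: "\<And>p. p \<in> K \<Longrightarrow> norm (c2 p) \<le> B2" using ex[of c2] c by (auto simp: coeffs_def)
  have "bounded (c3 ` snd ` K)"
    using c compact_continuous_image[OF continuous_on_snd[OF continuous_on_id] K(1)]
    by (simp add: coeffs_def loc_bounded_def)
  then obtain B3 where B3: "\<And>x. x \<in> snd ` K \<Longrightarrow> norm (c3 x) \<le> B3" by (auto simp: bounded_iff)
  let ?B = "B0 + (\<Sum>i\<in>UNIV. B1 i) + B2"
  show "\<exists>C. \<forall>\<phi> M. \<phi> \<in> Ckc 1 (Om I) \<longrightarrow> (\<forall>p\<in>Om I - K. \<phi> p = 0) \<longrightarrow> (\<forall>p\<in>Om I. norm (\<phi> p) \<le> M) \<longrightarrow>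
      (\<forall>b\<in>Basis. \<forall>p\<in>Om I. norm (pd (Om I) b \<phi> p) \<le> M) \<longrightarrow> norm (first_order c0 c1 c2 c3 \<phi>) \<le> C * M"
  proof (intro exI[of _ "?B * measure lborel K + B3 * measure lborel (snd ` K)"] allI impI)
    fix \<phi> :: "'n point \<Rightarrow> complex" and M :: real
    assume \<phi>: "\<phi> \<in> Ckc 1 (Om I)" and 0: "\<forall>p\<in>Om I - K. \<phi> p = 0" and M: "\<forall>p\<in>Om I. norm (\<phi> p) \<le> M"
      "\<forall>b\<in>Basis. \<forall>p\<in>Om I. norm (pd (Om I) b \<phi> p) \<le> M"
    have "norm (LINT p:Om I|lborel. symbol c0 c1 c2 \<phi> p) \<le> (?B * M) * measure lborel K"
    proof (rule norm_set_integral_le[OF integrable_symbol(1)[OF c \<phi>] K])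
      show "symbol c0 c1 c2 \<phi> p = 0" if "p \<in> Om I - K" for p
        using symbol_0_off[OF \<phi> compact_imp_closed[OF K(1)] 0 that] .
      fix p assume p: "p \<in> K"
      then have pO: "p \<in> Om I" using K(2) by blast
      have le: "norm (x * y) \<le> B * M" if "norm x \<le> B" "norm y \<le> M" for x y :: complex and B
        unfolding norm_mult using that by (intro mult_mono order_trans[OF norm_ge_zero that(1)]) auto
      have "norm (symbol c0 c1 c2 \<phi> p) \<le> norm (c0 p * dt I \<phi> p)
          + (\<Sum>i\<in>UNIV. norm (c1 i p * dx I i \<phi> p)) + norm (c2 p * \<phi> p)"
        unfolding symbol_def
        by (intro order_trans[OF norm_triangle_ineq] add_mono order_refl norm_sum)
      also have "\<dots> \<le> B0 * M + (\<Sum>i\<in>UNIV. B1 i * M) + B2 * M"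
        by (intro add_mono sum_mono le B0[OF p] B1[OF p] B2[OF p] M(1)[rule_format, OF pO]
            M(2)[rule_format, OF basis_point(1) pO] M(2)[rule_format, OF basis_point(2) pO])
      finally show "norm (symbol c0 c1 c2 \<phi> p) \<le> ?B * M"
        by (simp add: algebra_simps sum_distrib_left)
    qed
    moreover have "norm (LINT x:UNIV|lborel. c3 x * \<phi> (0, x)) \<le> (B3 * M) * measure lborel (snd ` K)"
    proof (rule norm_set_integral_le[OF integrable_symbol(2)[OF c \<phi>]])
      show "compact (snd ` K)" using K(1) by (intro compact_continuous_image continuous_intros)
      show "c3 x * \<phi> (0, x) = 0" if "x \<in> UNIV - snd ` K" for x
      proof -
        have "(0, x) \<in> Om I - K" using that zero_in_I by force
        then show ?thesis using 0 by simp
      qed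
      fix x assume x: "x \<in> snd ` K"
      show "norm (c3 x * \<phi> (0, x)) \<le> B3 * M"
        unfolding norm_mult
        using B3[OF x] M(1) zero_in_I by (intro mult_mono order_trans[OF norm_ge_zero B3[OF x]]) auto
    qed simp
    ultimately show "norm (first_order c0 c1 c2 c3 \<phi>) \<le> (?B * measure lborel K + B3 * measure lborel (snd ` K)) * M"
      unfolding first_order_def
      by (intro order_trans[OF norm_triangle_ineq]) (simp add: algebra_simps)
  qed
qed (rule thick_Om)

text \<open>
  Integration in a parameter of the functional is integration of its coefficients.
\<close>

lemma first_order_Fubini:
  fixes c1 :: "'k::euclidean_space \<Rightarrow> 'n::finite \<Rightarrow> 'n point \<Rightarrow> complex"
  assumes c0: "loc_bounded (J \<times> Om I) (\<lambda>(k, p). c0 k p)"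
    and c1: "\<And>i. loc_bounded (J \<times> Om I) (\<lambda>(k, p). c1 k i p)"
    and c2: "loc_bounded (J \<times> Om I) (\<lambda>(k, p). c2 k p)"
    and c3: "loc_bounded (J \<times> UNIV) (\<lambda>(k, x). c3 k x)"
    and J: "compact J" and \<phi>: "\<phi> \<in> Ckc 1 (Om I)"
  shows "set_integrable lborel J (\<lambda>k. first_order (c0 k) (c1 k) (c2 k) (c3 k) \<phi>)"
    and "(LINT k:J|lborel. first_order (c0 k) (c1 k) (c2 k) (c3 k) \<phi>)
       = first_order (\<lambda>p. LINT k:J|lborel. c0 k p) (\<lambda>i p. LINT k:J|lborel. c1 k i p)
           (\<lambda>p. LINT k:J|lborel. c2 k p) (\<lambda>x. LINT k:J|lborel. c3 k x) \<phi>"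
proof -
  have Jb: "J \<in> sets borel" using J by (simp add: compact_imp_closed borel_closed)
  obtain K where "compact K \<and> K \<subseteq> Om I \<and> (\<forall>p\<in>Om I - K. \<phi> p = 0)"
    using Ckc_1_support[OF \<phi>] ..
  note K = this[THEN conjunct1] this[THEN conjunct2, THEN conjunct1]
    this[THEN conjunct2, THEN conjunct2]
  note lt = loc_bounded_test[OF \<phi>]
  have JO: "J \<times> Om I \<in> sets borel" using Jb Om_borel by (rule borel_Times)
  have "loc_bounded (J \<times> Om I) (\<lambda>z. (case z of (k, p) \<Rightarrow> c0 k p) * (case z of (k, p) \<Rightarrow> dt I \<phi> p)
      + (\<Sum>i\<in>UNIV. (case z of (k, p) \<Rightarrow> c1 k i p) * (case z of (k, p) \<Rightarrow> dx I i \<phi> p))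
      + (case z of (k, p) \<Rightarrow> c2 k p) * (case z of (k, p) \<Rightarrow> \<phi> p))"
    by (intro loc_bounded_add loc_bounded_mult loc_bounded_sum c0 c1 c2 JO loc_bounded_snd[OF Jb] lt)
  then have A: "loc_bounded (J \<times> Om I) (\<lambda>(k, p). symbol (c0 k) (c1 k) (c2 k) \<phi> p)"
    by (simp add: symbol_def case_prod_beta')
  have "loc_bounded (J \<times> UNIV) (\<lambda>z. (case z of (k, x) \<Rightarrow> c3 k x) * (case z of (k, x) \<Rightarrow> \<phi> (0, x)))"
    by (intro loc_bounded_mult c3 loc_bounded_snd[OF Jb] lt)
  then have B: "loc_bounded (J \<times> UNIV) (\<lambda>(k, x). c3 k x * \<phi> (0, x))"
    by (simp add: case_prod_beta')
  have A0: "symbol (c0 k) (c1 k) (c2 k) \<phi> p = 0" if "p \<in> Om I - K" for k p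
    using symbol_0_off[OF \<phi> compact_imp_closed[OF K(1)] K(3) that] .
  have B0: "c3 k x * \<phi> (0, x) = 0" if "x \<in> UNIV - snd ` K" for k x
    using trace_support(2)[OF K(1,3) that] by simp
  note FA = set_integral_Fubini[OF A J K(1,2) A0]
  note FB = set_integral_Fubini[OF B J trace_support(1)[OF K(1,3)] subset_UNIV B0]
  show "set_integrable lborel J (\<lambda>k. first_order (c0 k) (c1 k) (c2 k) (c3 k) \<phi>)"
    unfolding first_order_def by (intro set_integral_add FA(1) FB(1))
  have sec: "set_integrable lborel J (\<lambda>k. q k p)" if "loc_bounded (J \<times> S) (\<lambda>(k, p). q k p)" "p \<in> S"
    for q :: "'k \<Rightarrow> 'a::euclidean_space \<Rightarrow> complex" and S p
    using loc_bounded_sections(2)[OF that] J by (intro set_integrable_loc_bounded[of _ _ J]) auto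
  have "(LINT p:Om I|lborel. LINT k:J|lborel. symbol (c0 k) (c1 k) (c2 k) \<phi> p)
     = (LINT p:Om I|lborel. symbol (\<lambda>p. LINT k:J|lborel. c0 k p) (\<lambda>i p. LINT k:J|lborel. c1 k i p)
           (\<lambda>p. LINT k:J|lborel. c2 k p) \<phi> p)"
  proof (rule set_lebesgue_integral_cong)
    show "\<forall>p. p \<in> Om I \<longrightarrow> (LINT k:J|lborel. symbol (c0 k) (c1 k) (c2 k) \<phi> p)
       = symbol (\<lambda>p. LINT k:J|lborel. c0 k p) (\<lambda>i p. LINT k:J|lborel. c1 k i p) (\<lambda>p. LINT k:J|lborel. c2 k p) \<phi> p"
    proof (intro allI impI)
      fix p :: "'n point" assume p: "p \<in> Om I"
      note i = sec[OF c0 p] sec[OF c1 p] sec[OF c2 p]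
      have "set_integrable lborel J (\<lambda>k. c0 k p * dt I \<phi> p)"
        "\<And>j. set_integrable lborel J (\<lambda>k. c1 k j p * dx I j \<phi> p)"
        "set_integrable lborel J (\<lambda>k. c2 k p * \<phi> p)"
        using i by auto
      then show "(LINT k:J|lborel. symbol (c0 k) (c1 k) (c2 k) \<phi> p)
         = symbol (\<lambda>p. LINT k:J|lborel. c0 k p) (\<lambda>i p. LINT k:J|lborel. c1 k i p) (\<lambda>p. LINT k:J|lborel. c2 k p) \<phi> p"
        unfolding symbol_def by (simp add: set_integral_add set_integral_sum)
    qed
  qed (use Om_borel in simp)
  moreover have "(LINT x:UNIV|lborel. LINT k:J|lborel. c3 k x * \<phi> (0, x))
      = (LINT x:UNIV|lborel. (LINT k:J|lborel. c3 k x) * \<phi> (0, x))"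
    by simp
  ultimately show "(LINT k:J|lborel. first_order (c0 k) (c1 k) (c2 k) (c3 k) \<phi>)
       = first_order (\<lambda>p. LINT k:J|lborel. c0 k p) (\<lambda>i p. LINT k:J|lborel. c1 k i p)
           (\<lambda>p. LINT k:J|lborel. c2 k p) (\<lambda>x. LINT k:J|lborel. c3 k x) \<phi>"
    unfolding first_order_def using set_integral_add(2)[OF FA(1) FB(1)] FA(2) FB(2) by simp
qed

lemma first_order_lebesgue:
  fixes \<phi> :: "'n::finite point \<Rightarrow> complex"
  assumes c: "coeffs c0 c1 c2 c3" and \<phi>: "\<phi> \<in> Ckc 1 (Om I)"
  shows "first_order c0 c1 c2 c3 \<phi> =
      (LINT p:Om I|lebesgue. c0 p * dt I \<phi> p + (\<Sum>i\<in>UNIV. c1 i p * dx I i \<phi> p))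
      + (LINT p:Om I|lebesgue. c2 p * \<phi> p) + (LINT x|lebesgue. c3 x * \<phi> (0, x))"
proof -
  have c': "coeffs c0 c1 (\<lambda>_. 0) c3" "loc_bounded (Om I) c2" "loc_bounded UNIV c3"
    using c loc_bounded_const[OF Om_borel] by (auto simp: coeffs_def)
  have eq: "symbol c0 c1 (\<lambda>_. 0) \<phi> = (\<lambda>p. c0 p * dt I \<phi> p + (\<Sum>i\<in>UNIV. c1 i p * dx I i \<phi> p))"
    by (simp add: symbol_def fun_eq_iff)
  have lb: "loc_bounded (Om I) (\<lambda>p. c2 p * \<phi> p)" "loc_bounded UNIV (\<lambda>x. c3 x * \<phi> (0, x))"
    by (intro loc_bounded_mult c' loc_bounded_test[OF \<phi>])+
  have "(LINT p:Om I|lborel. symbol c0 c1 c2 \<phi> p)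
      = (LINT p:Om I|lborel. symbol c0 c1 (\<lambda>_. 0) \<phi> p) + (LINT p:Om I|lborel. c2 p * \<phi> p)"
    using set_integral_add(2)[OF integrable_symbol(1)[OF c'(1) \<phi>] integrable_coeff[OF c'(2) \<phi>]]
    by (simp add: symbol_def)
  then show ?thesis
    using set_integral_lebesgue_eq_lborel[OF loc_bounded_symbol[OF c'(1) \<phi>]]
      set_integral_lebesgue_eq_lborel[OF lb(1)] set_integral_lebesgue_eq_lborel[OF lb(2)]
    unfolding first_order_def eq by (simp add: set_lebesgue_integral_def)
qed

lemma set_integral_lebesgue_coeff:
  fixes \<phi> :: "'n::finite point \<Rightarrow> complex"
  assumes "loc_bounded (Om I) A" "loc_bounded (Om I) B" and \<phi>: "\<phi> \<in> Ckc 1 (Om I)"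
  shows "(LINT p:Om I|lebesgue. (A p + B p) * \<phi> p)
       = (LINT p:Om I|lebesgue. A p * \<phi> p) + (LINT p:Om I|lebesgue. B p * \<phi> p)"
    and "(LINT p:Om I|lebesgue. (A p - B p) * \<phi> p)
       = (LINT p:Om I|lebesgue. A p * \<phi> p) - (LINT p:Om I|lebesgue. B p * \<phi> p)"
proof -
  have i: "set_integrable lborel (Om I) (\<lambda>p. A p * \<phi> p)" "set_integrable lborel (Om I) (\<lambda>p. B p * \<phi> p)"
    by (rule integrable_coeff[OF assms(1) \<phi>], rule integrable_coeff[OF assms(2) \<phi>])
  have e: "(LINT p:Om I|lebesgue. C p * \<phi> p) = (LINT p:Om I|lborel. C p * \<phi> p)" if "loc_bounded (Om I) C" for C
    using that by (intro set_integral_lebesgue_eq_lborel loc_bounded_mult loc_bounded_test[OF \<phi>])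
  show "(LINT p:Om I|lebesgue. (A p + B p) * \<phi> p)
       = (LINT p:Om I|lebesgue. A p * \<phi> p) + (LINT p:Om I|lebesgue. B p * \<phi> p)"
    unfolding e[OF loc_bounded_add[OF assms(1,2)]] e[OF assms(1)] e[OF assms(2)]
    unfolding distrib_right by (rule set_integral_add(2)[OF i])
  show "(LINT p:Om I|lebesgue. (A p - B p) * \<phi> p)
       = (LINT p:Om I|lebesgue. A p * \<phi> p) - (LINT p:Om I|lebesgue. B p * \<phi> p)"
    unfolding e[OF loc_bounded_diff[OF Om_borel assms(1,2)]] e[OF assms(1)] e[OF assms(2)]
    unfolding left_diff_distrib by (rule set_integral_diff(2)[OF i])
qed

end

lemma (in time_domain) first_order_times_const:
  "first_order (\<lambda>p. c0 p * a) (\<lambda>i p. c1 i p * a) (\<lambda>p. c2 p * a) (\<lambda>x. c3 x * a) \<phi>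
     = first_order c0 c1 c2 c3 \<phi> * a"
proof -
  have s: "symbol (\<lambda>p. c0 p * a) (\<lambda>i p. c1 i p * a) (\<lambda>p. c2 p * a) \<phi> = (\<lambda>p. symbol c0 c1 c2 \<phi> p * a)"
    by (simp add: fun_eq_iff symbol_def distrib_right sum_distrib_right mult.assoc mult.commute[of a])
  have t: "(\<lambda>x. c3 x * a * \<phi> (0, x)) = (\<lambda>x. c3 x * \<phi> (0, x) * a)"
    by (simp add: fun_eq_iff mult_ac)
  show ?thesis
    unfolding first_order_def s t by (simp add: distrib_right)
qed

context time_domain
begin

lemma state_basis:
  "((1, 0, 0) :: 'n::finite state) \<in> Basis" "((0, axis i 1, 0) :: 'n::finite state) \<in> Basis"
  "((0, 0, 1) :: 'n::finite state) \<in> Basis"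
  by (auto simp: Basis_prod_def Basis_vec_def zero_prod_def)

lemma state_basis_cases:
  assumes "(b :: 'n::finite state) \<in> Basis"
  shows "b = (1, 0, 0) \<or> (\<exists>i. b = (0, axis i 1, 0)) \<or> b = (0, 0, 1)"
  using assms by (auto simp: Basis_prod_def Basis_vec_def zero_prod_def)

lemma mem_flux_dom: "p \<in> Om I \<Longrightarrow> (fst p, snd p, w) \<in> flux_dom I"
  using closure_subset[of I] by auto

lemma continuous_on_freeze:
  fixes \<Phi> :: "'n::finite state \<Rightarrow> complex"
  assumes "continuous_on (flux_dom I) \<Phi>"
  shows "continuous_on (Om I \<times> UNIV) (\<lambda>(p, w). \<Phi> (fst p, snd p, w))"
  unfolding case_prod_beta'
proof (rule continuous_on_compose2[OF assms])
  show "continuous_on (Om I \<times> UNIV) (\<lambda>z :: 'n point \<times> real. (fst (fst z), snd (fst z), snd z))"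
    by (intro continuous_intros)
  show "(\<lambda>z :: 'n point \<times> real. (fst (fst z), snd (fst z), snd z)) ` (Om I \<times> UNIV) \<subseteq> flux_dom I"
    using closure_subset[of I] by auto
qed

lemma loc_bounded_state:
  fixes \<Phi> :: "'n::finite state \<Rightarrow> complex"
  assumes "continuous_on (flux_dom I) \<Phi>" "v \<in> borel_measurable borel" "\<And>p. \<bar>v p\<bar> \<le> R"
  shows "loc_bounded (Om I) (\<lambda>p. \<Phi> (fst p, snd p, v p))"
  by (rule loc_bounded_subst[OF Om_borel continuous_on_freeze[OF assms(1)] assms(2,3)])

text \<open>
  Components of a flux with their own \<open>x\<^sub>i\<close>-derivatives, whose sum is the divergence. Keeping the components
  as scalar functions treats real and complex fluxes alike.
\<close>

definition regular_flux ::
  "('n::finite \<Rightarrow> 'n state \<Rightarrow> complex) \<Rightarrow> ('n \<Rightarrow> 'n state \<Rightarrow> complex) \<Rightarrow> bool" where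
  "regular_flux G dG \<longleftrightarrow> (\<forall>i. continuous_on (flux_dom I) (G i) \<and>
     has_pd (flux_dom I) (0, axis i 1, 0) (G i) (dG i) \<and> continuous_on (flux_dom I) (dG i))"

lemma coeffs_const:
  "coeffs (\<lambda>_. a) (\<lambda>_ _. b) (\<lambda>_. c) (\<lambda>_. d)"
  by (simp add: coeffs_def loc_bounded_const[OF Om_borel] loc_bounded_const)

lemma coeffs_regular_flux:
  assumes "regular_flux G dG"
  shows "coeffs (\<lambda>_. 0) (\<lambda>i p. G i (fst p, snd p, w)) (\<lambda>p. \<Sum>i\<in>UNIV. dG i (fst p, snd p, w)) (\<lambda>_. 0)"
  using assms unfolding coeffs_def regular_flux_def
  by (intro conjI allI loc_bounded_sum loc_bounded_const Om_borel
      loc_bounded_state[where v = "\<lambda>_. w" and R = "\<bar>w\<bar>"]) auto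

lemma has_pd_freeze:
  fixes G :: "'n::finite state \<Rightarrow> complex"
  assumes "has_pd (flux_dom I) (0, y, 0) G dG"
  shows "has_pd (Om I) (0, y) (\<lambda>p. G (fst p, snd p, w)) (\<lambda>p. dG (fst p, snd p, w))"
  unfolding has_pd_def
proof
  fix p :: "'n point" assume p: "p \<in> Om I"
  have "((\<lambda>s. G ((fst p, snd p, w) + s *\<^sub>R (0, y, 0))) has_vector_derivative dG (fst p, snd p, w))
      (at 0 within {s. (fst p, snd p, w) + s *\<^sub>R (0, y, 0) \<in> flux_dom I})"
    using assms mem_flux_dom[OF p] unfolding has_pd_def by blast
  moreover have "{s. (fst p, snd p, w) + s *\<^sub>R (0, y, 0) \<in> flux_dom I} = UNIV"
    using mem_flux_dom[OF p] by auto
  moreover have "{s. p + s *\<^sub>R (0, y) \<in> Om I} = UNIV"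
    using p by (auto simp: mem_Times_iff)
  ultimately show "((\<lambda>s. G (fst (p + s *\<^sub>R (0, y)), snd (p + s *\<^sub>R (0, y)), w))
      has_vector_derivative dG (fst p, snd p, w)) (at 0 within {s. p + s *\<^sub>R (0, y) \<in> Om I})"
    by simp
qed

text \<open>
  With the state frozen at a constant \<open>w\<close>, the flux is a field on space-time, and the
  identity is the divergence theorem in \<open>x\<close>.
\<close>

lemma first_order_divergence:
  fixes \<phi> :: "'n::finite point \<Rightarrow> complex"
  assumes G: "regular_flux G dG" and \<phi>: "\<phi> \<in> Ckc 1 (Om I)"
  shows "first_order (\<lambda>_. 0) (\<lambda>i p. G i (fst p, snd p, w)) (\<lambda>p. \<Sum>i\<in>UNIV. dG i (fst p, snd p, w)) (\<lambda>_. 0) \<phi> = 0"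
proof -
  obtain K where "compact K \<and> K \<subseteq> Om I \<and> (\<forall>p\<in>Om I - K. \<phi> p = 0)"
    using Ckc_1_support[OF \<phi>] ..
  note K = this[THEN conjunct1] this[THEN conjunct2, THEN conjunct1]
    this[THEN conjunct2, THEN conjunct2]
  let ?X = "\<lambda>i p. G i (fst p, snd p, w) * dx I i \<phi> p + dG i (fst p, snd p, w) * \<phi> p"
  have lb: "loc_bounded (Om I) (\<lambda>p. G i (fst p, snd p, w))" "loc_bounded (Om I) (\<lambda>p. dG i (fst p, snd p, w))" for i
    using G unfolding regular_flux_def
    by (auto intro!: loc_bounded_state[where v = "\<lambda>_. w" and R = "\<bar>w\<bar>"])
  have int: "set_integrable lborel (Om I) (?X i)" for i
  proof (rule set_integrable_loc_bounded[OF _ K(1,2)])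
    show "loc_bounded (Om I) (?X i)"
      by (intro loc_bounded_add loc_bounded_mult lb loc_bounded_test(1,3)[OF \<phi>])
    show "?X i p = 0" if "p \<in> Om I - K" for p
      using test_support(2)[OF \<phi> compact_imp_closed[OF K(1)] K(3) that] bspec[OF K(3) that] by simp
  qed
  have zero: "(LINT p:Om I|lborel. ?X i p) = 0" for i
  proof (rule integral_by_parts_translation_invariant[where v = "(0, axis i 1)" and K = K])
    have c: "continuous_on (Om I) (\<lambda>p. \<Phi> (fst p, snd p, w))" if "continuous_on (flux_dom I) \<Phi>"
      for \<Phi> :: "'n state \<Rightarrow> complex"
      using mem_flux_dom by (intro continuous_on_compose2[OF that] continuous_intros) blast
    show "continuous_on (Om I) (\<lambda>p. G i (fst p, snd p, w))" "continuous_on (Om I) (\<lambda>p. dG i (fst p, snd p, w))"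
      using G by (auto simp: regular_flux_def intro!: c)
    show "has_pd (Om I) (0, axis i 1) (\<lambda>p. G i (fst p, snd p, w)) (\<lambda>p. dG i (fst p, snd p, w))"
      using G by (auto simp: regular_flux_def intro!: has_pd_freeze)
    show "\<phi> p = 0" if "p \<in> Om I - K" for p by (rule bspec[OF K(3) that])
    show "p + s *\<^sub>R (0, axis i 1) \<in> Om I" if "p \<in> Om I" for p s
      using that by (auto simp: mem_Times_iff)
  qed (rule Om_borel Ckc_1_continuous[OF \<phi>] Ckc_1_has_pd[OF \<phi> basis_point(2)]
      Ckc_1_continuous_pd[OF \<phi> basis_point(2)] K(1) K(2))+
  have "symbol (\<lambda>_. 0) (\<lambda>i p. G i (fst p, snd p, w)) (\<lambda>p. \<Sum>i\<in>UNIV. dG i (fst p, snd p, w)) \<phi>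
     = (\<lambda>p. \<Sum>i\<in>UNIV. ?X i p)"
    by (simp add: fun_eq_iff symbol_def sum.distrib sum_distrib_right)
  then show ?thesis
    unfolding first_order_def using set_integral_sum(2)[OF int] zero by simp
qed

text \<open>
  The entropy \<open>1\<close> has no production.
\<close>

lemma first_order_time:
  fixes \<phi> :: "'n::finite point \<Rightarrow> complex"
  assumes \<phi>: "\<phi> \<in> Ckc 1 (Om I)"
  shows "first_order (\<lambda>_. 1) (\<lambda>_ _. 0) (\<lambda>_. 0) (\<lambda>_. 1) \<phi> = 0"
proof -
  obtain K where "compact K \<and> K \<subseteq> Om I \<and> (\<forall>p\<in>Om I - K. \<phi> p = 0)"
    using Ckc_1_support[OF \<phi>] ..
  note K = this[THEN conjunct1] this[THEN conjunct2, THEN conjunct1]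
    this[THEN conjunct2, THEN conjunct2]
  have "(LINT p:Om I|lborel. dt I \<phi> p) + (LINT x|lborel. \<phi> (0, x)) = 0"
    by (rule integral_pd_time[OF time_interval Ckc_1_has_pd[OF \<phi> basis_point(1)] Ckc_1_continuous[OF \<phi>]
          Ckc_1_continuous_pd[OF \<phi> basis_point(1)] K(1,2) bspec[OF K(3)]
          test_support(1)[OF \<phi> compact_imp_closed[OF K(1)] K(3)]])
  then show ?thesis
    by (simp add: first_order_def symbol_def set_lebesgue_integral_def)
qed

lemma flux_classD:
  fixes F :: "'n::finite state \<Rightarrow> 'b::real_normed_vector"
  assumes "flux_class I F"
  shows "continuous_on (flux_dom I) F"
    and "b \<in> Basis \<Longrightarrow> has_pd (flux_dom I) b F (pd (flux_dom I) b F)"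
    and "b \<in> Basis \<Longrightarrow> continuous_on (flux_dom I) (pd (flux_dom I) b F)"
  using assms unfolding flux_class_def One_nat_def Ck_on_Suc_0_iff by (blast intro: has_pd_pd)+

lemma regular_flux_flux_class:
  fixes F :: "'n::finite state \<Rightarrow> 'b::real_normed_vector"
  assumes F: "flux_class I F" and L: "\<And>i. bounded_linear (L i)"
  shows "regular_flux (\<lambda>i q. L i (F q)) (\<lambda>i q. L i (pd (flux_dom I) (0, axis i 1, 0) F q))"
  unfolding regular_flux_def
  by (intro allI conjI bounded_linear.continuous_on[OF L] has_pd_bounded_linear[OF L]
      flux_classD[OF F] state_basis(2))

lemma div_x_eq:
  fixes F :: "'n::finite state \<Rightarrow> ('b::real_normed_vector)^'n"
  assumes F: "flux_class I F" and q: "q \<in> flux_dom I"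
  shows "div_x I F q = (\<Sum>i\<in>UNIV. pd (flux_dom I) (0, axis i 1, 0) F q $ i)"
  unfolding div_x_def
  by (intro sum.cong refl has_pd_imp_pd_eq[OF has_pd_bounded_linear[OF bounded_linear_vec_nth
          flux_classD(2)[OF F state_basis(2)]] thick_flux_dom q])

end

section \<open>Entropy and Kruzhkov productions as first-order functionals\<close>

text \<open>
  The setting of the statement for Borel representatives of \<open>u\<close> and \<open>u\<^sub>o\<close>, with one bound \<open>R\<close> for both.
\<close>

locale balance_law = time_domain I for I :: "real set" +
  fixes f :: "'n::finite state \<Rightarrow> real^'n" and g :: "'n state \<Rightarrow> real"
    and uo :: "real^'n \<Rightarrow> real" and u :: "'n point \<Rightarrow> real" and R :: real
  assumes flux: "flux_class I f" and source: "continuous_on (flux_dom I) g"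
    and uo_borel: "uo \<in> borel_measurable borel" and uo_le: "\<And>x. \<bar>uo x\<bar> \<le> R"
    and u_borel: "u \<in> borel_measurable borel" and u_le: "\<And>p. \<bar>u p\<bar> \<le> R"
    and solution: "distributional_solution I f g uo u"
begin

definition fc :: "'n \<Rightarrow> 'n state \<Rightarrow> complex" where
  "fc i q = complex_of_real (f q $ i)"

definition dfc :: "'n \<Rightarrow> 'n state \<Rightarrow> complex" where
  "dfc i q = complex_of_real (pd (flux_dom I) (0, axis i 1, 0) f q $ i)"

definition gc :: "'n state \<Rightarrow> complex" where
  "gc q = complex_of_real (g q)"

abbreviation vu :: "'n point \<Rightarrow> 'n state" where
  "vu p \<equiv> (fst p, snd p, u p)"

lemma Om_lebesgue: "(Om I :: 'n point set) \<in> sets lebesgue"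
  using Om_borel by auto

lemma vu_mem: "p \<in> Om I \<Longrightarrow> vu p \<in> flux_dom I"
  by (rule mem_flux_dom)

lemma bounded_linear_component: "bounded_linear (\<lambda>z :: real^'n. complex_of_real (z $ i))"
  by (rule bounded_linear_compose[OF bounded_linear_of_real bounded_linear_vec_nth])

lemma regular_fc: "regular_flux fc dfc"
  using regular_flux_flux_class[OF flux bounded_linear_component]
  by (simp add: fc_def[abs_def] dfc_def[abs_def])

lemma continuous_gc: "continuous_on (flux_dom I) gc"
  unfolding gc_def by (intro continuous_intros source)

lemma continuous_fc: "continuous_on (flux_dom I) (fc i)" "continuous_on (flux_dom I) (dfc i)"
  using regular_fc by (auto simp: regular_flux_def)

lemma div_x_f: "q \<in> flux_dom I \<Longrightarrow> complex_of_real (div_x I f q) = (\<Sum>i\<in>UNIV. dfc i q)"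
  by (simp add: div_x_eq[OF flux] dfc_def)

lemma loc_bounded_vu: "continuous_on (flux_dom I) \<Phi> \<Longrightarrow> loc_bounded (Om I) (\<lambda>p. \<Phi> (vu p))"
  by (rule loc_bounded_state[OF _ u_borel u_le])

lemma loc_bounded_u: "continuous_on UNIV E \<Longrightarrow> loc_bounded (Om I) (\<lambda>p. E (u p))"
  using loc_bounded_vu[of "\<lambda>q. E (snd (snd q))"]
  by (simp add: continuous_on_compose2[of UNIV E] continuous_intros)

lemma loc_bounded_uo:
  assumes E: "continuous_on UNIV E"
  shows "loc_bounded UNIV (\<lambda>x. E (uo x))"
  by (rule loc_bounded_subst[OF _ _ uo_borel uo_le])
    (auto simp: case_prod_beta' intro!: continuous_on_compose2[OF E] continuous_intros)

lemma coeffs_solution: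
  "coeffs (\<lambda>p. of_real (u p)) (\<lambda>i p. fc i (vu p)) (\<lambda>p. gc (vu p)) (\<lambda>x. of_real (uo x))"
proof -
  have of_real: "continuous_on UNIV complex_of_real" by (intro continuous_intros)
  show ?thesis
    unfolding coeffs_def
    by (intro conjI allI loc_bounded_vu[OF continuous_fc(1)] loc_bounded_vu[OF continuous_gc]
        loc_bounded_u[OF of_real] loc_bounded_uo[OF of_real])
qed

text \<open>
  The equation is assumed for real test functions. It is applied to the real and the imaginary part
  of \<open>\<phi>\<close>, treated together as real-linear maps that commute with real factors.
\<close>

lemma first_order_solution:
  assumes \<phi>: "\<phi> \<in> Ckc 1 (Om I)"
  shows "first_order (\<lambda>p. of_real (u p)) (\<lambda>i p. fc i (vu p)) (\<lambda>p. gc (vu p)) (\<lambda>x. of_real (uo x)) \<phi> = 0"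
    (is "?S = 0")
proof -
  have L: "L ?S = 0" if L: "bounded_linear L" and mult: "\<And>a z. L (complex_of_real a * z) = a * L z"
    for L :: "complex \<Rightarrow> real"
  proof -
    have add: "L (x + y) = L x + L y" for x y
      by (rule linear_add[OF bounded_linear.linear[OF L]])
    have sum: "L (sum X A) = (\<Sum>i\<in>A. L (X i))" for X :: "'n \<Rightarrow> complex" and A
      by (rule linear_sum[OF bounded_linear.linear[OF L]])
    let ?\<chi> = "\<lambda>p. L (\<phi> p)"
    have \<chi>: "?\<chi> \<in> Ckc 1 (Om I)"
      by (rule Ckc_1_bounded_linear[OF thick_Om L \<phi>])
    have c0: "coeffs (\<lambda>p. of_real (u p)) (\<lambda>i p. fc i (vu p)) (\<lambda>_. 0) (\<lambda>x. of_real (uo x))"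
      using coeffs_solution loc_bounded_const[OF Om_borel] by (auto simp: coeffs_def)
    let ?X = "\<lambda>p. of_real (u p) * dt I \<phi> p + (\<Sum>i\<in>UNIV. fc i (vu p) * dx I i \<phi> p)"
    have X: "set_integrable lborel (Om I) ?X"
      using integrable_symbol(1)[OF c0 \<phi>] by (simp add: symbol_def[abs_def])
    have "(LINT (t, x):Om I|lebesgue. u (t, x) * dt I ?\<chi> (t, x)
            + (\<Sum>i\<in>UNIV. f (t, x, u (t, x)) $ i * dx I i ?\<chi> (t, x)))
       = (LINT p:Om I|lebesgue. L (?X p))"
    proof (rule set_lebesgue_integral_cong)
      show "\<forall>p. p \<in> Om I \<longrightarrow> (case p of (t, x) \<Rightarrow> u (t, x) * dt I ?\<chi> (t, x)
            + (\<Sum>i\<in>UNIV. f (t, x, u (t, x)) $ i * dx I i ?\<chi> (t, x))) = L (?X p)"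
      proof (intro allI impI)
        fix p :: "'n point" assume p: "p \<in> Om I"
        have "dt I ?\<chi> p = L (dt I \<phi> p)" "\<And>i. dx I i ?\<chi> p = L (dx I i \<phi> p)"
          using pd_test_bounded_linear[OF \<phi> L _ p] basis_point by auto
        then show "(case p of (t, x) \<Rightarrow> u (t, x) * dt I ?\<chi> (t, x)
            + (\<Sum>i\<in>UNIV. f (t, x, u (t, x)) $ i * dx I i ?\<chi> (t, x))) = L (?X p)"
          by (simp add: case_prod_beta' add sum mult fc_def)
      qed
    qed (rule Om_lebesgue)
    also have "\<dots> = L (LINT p:Om I|lebesgue. ?X p)"
      by (rule set_integral_lebesgue_bounded_linear[OF L X])
    finally have 1: "(LINT (t, x):Om I|lebesgue. u (t, x) * dt I ?\<chi> (t, x)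
            + (\<Sum>i\<in>UNIV. f (t, x, u (t, x)) $ i * dx I i ?\<chi> (t, x))) = L (LINT p:Om I|lebesgue. ?X p)" .
    have Y: "set_integrable lborel (Om I) (\<lambda>p. gc (vu p) * \<phi> p)"
      by (rule integrable_coeff[OF loc_bounded_vu[OF continuous_gc] \<phi>])
    have 2: "(LINT (t, x):Om I|lebesgue. g (t, x, u (t, x)) * ?\<chi> (t, x))
        = L (LINT p:Om I|lebesgue. gc (vu p) * \<phi> p)"
      using set_integral_lebesgue_bounded_linear[OF L Y] by (simp add: case_prod_beta' mult gc_def)
    have 3: "(LINT x|lebesgue. uo x * ?\<chi> (0, x)) = L (LINT x|lebesgue. of_real (uo x) * \<phi> (0, x))"
      using set_integral_lebesgue_bounded_linear[OF L integrable_symbol(2)[OF coeffs_solution \<phi>]]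
      by (simp add: mult set_lebesgue_integral_def)
    show ?thesis
      using solution[unfolded distributional_solution_def, rule_format, OF \<chi>]
      unfolding first_order_lebesgue[OF coeffs_solution \<phi>] 1 2 3 by (simp add: add)
  qed
  have "Re ?S = 0" "Im ?S = 0"
    by (intro L bounded_linear_Re bounded_linear_Im; simp)+
  then show ?thesis by (simp add: complex_eq_iff)
qed

lemma loc_bounded_dfc: "loc_bounded (Om I) (\<lambda>p. \<Sum>i\<in>UNIV. dfc i (vu p))"
  by (intro loc_bounded_sum[OF Om_borel] loc_bounded_vu continuous_fc)

lemma coeffs_entropy:
  assumes E: "continuous_on UNIV E" and E': "continuous_on UNIV E'" and G: "regular_flux G dG"
  shows "coeffs (\<lambda>p. E (u p)) (\<lambda>i p. G i (vu p))
      (\<lambda>p. (\<Sum>i\<in>UNIV. dG i (vu p)) - E' (u p) * (\<Sum>i\<in>UNIV. dfc i (vu p)) + E' (u p) * gc (vu p))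
      (\<lambda>x. E (uo x))"
proof -
  have dG: "loc_bounded (Om I) (\<lambda>p. \<Sum>i\<in>UNIV. dG i (vu p))"
    by (intro loc_bounded_sum[OF Om_borel] loc_bounded_vu) (use G in \<open>simp add: regular_flux_def\<close>)
  have G': "loc_bounded (Om I) (\<lambda>p. G i (vu p))" for i
    by (intro loc_bounded_vu) (use G in \<open>simp add: regular_flux_def\<close>)
  show ?thesis
    unfolding coeffs_def
    by (intro conjI allI G' loc_bounded_u[OF E] loc_bounded_uo[OF E]
        loc_bounded_add[OF loc_bounded_diff[OF Om_borel dG loc_bounded_mult[OF loc_bounded_u[OF E'] loc_bounded_dfc]]
          loc_bounded_mult[OF loc_bounded_u[OF E'] loc_bounded_vu[OF continuous_gc]]])
qed

lemma entropy_production_eq_first_order: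
  assumes E: "continuous_on UNIV E" and E': "continuous_on UNIV E'"
    and EE': "\<And>w. (E has_vector_derivative E' w) (at w)"
    and F: "flux_class I F" and \<phi>: "\<phi> \<in> Ckc 1 (Om I)"
  defines "dF \<equiv> \<lambda>i q. pd (flux_dom I) (0, axis i 1, 0) F q $ i"
  shows "entropy_production I f g uo u E F \<phi> =
    first_order (\<lambda>p. E (u p)) (\<lambda>i p. F (vu p) $ i)
      (\<lambda>p. (\<Sum>i\<in>UNIV. dF i (vu p)) - E' (u p) * (\<Sum>i\<in>UNIV. dfc i (vu p)) + E' (u p) * gc (vu p))
      (\<lambda>x. E (uo x)) \<phi>"
proof -
  have G: "regular_flux (\<lambda>i q. F q $ i) dF"
    unfolding dF_def using regular_flux_flux_class[OF F bounded_linear_vec_nth] by simp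
  have vd: "vector_derivative E (at w) = E' w" for w
    using EE' by (rule vector_derivative_at)
  have lb: "loc_bounded (Om I) (\<lambda>p. \<Sum>i\<in>UNIV. dF i (vu p))"
    "loc_bounded (Om I) (\<lambda>p. E' (u p) * (\<Sum>i\<in>UNIV. dfc i (vu p)))"
    "loc_bounded (Om I) (\<lambda>p. E' (u p) * gc (vu p))"
  proof -
    show "loc_bounded (Om I) (\<lambda>p. \<Sum>i\<in>UNIV. dF i (vu p))"
      by (intro loc_bounded_sum[OF Om_borel] loc_bounded_vu) (use G in \<open>simp add: regular_flux_def\<close>)
  qed (rule loc_bounded_mult[OF loc_bounded_u[OF E'] loc_bounded_dfc]
      loc_bounded_mult[OF loc_bounded_u[OF E'] loc_bounded_vu[OF continuous_gc]])+
  have 1: "(LINT (t, x):Om I|lebesgue. vector_derivative E (at (u (t, x)))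
         * complex_of_real (div_x I f (t, x, u (t, x))) * \<phi> (t, x))
      = (LINT p:Om I|lebesgue. E' (u p) * (\<Sum>i\<in>UNIV. dfc i (vu p)) * \<phi> p)"
  proof (rule set_lebesgue_integral_cong)
    show "\<forall>p. p \<in> Om I \<longrightarrow> (case p of (t, x) \<Rightarrow> vector_derivative E (at (u (t, x)))
         * complex_of_real (div_x I f (t, x, u (t, x))) * \<phi> (t, x))
       = E' (u p) * (\<Sum>i\<in>UNIV. dfc i (vu p)) * \<phi> p"
      using div_x_f[OF vu_mem] by (simp add: case_prod_beta' vd del: split_paired_All)
  qed (rule Om_lebesgue)
  have 2: "(LINT (t, x):Om I|lebesgue. div_x I F (t, x, u (t, x)) * \<phi> (t, x))
      = (LINT p:Om I|lebesgue. (\<Sum>i\<in>UNIV. dF i (vu p)) * \<phi> p)"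
  proof (rule set_lebesgue_integral_cong)
    show "\<forall>p. p \<in> Om I \<longrightarrow> (case p of (t, x) \<Rightarrow> div_x I F (t, x, u (t, x)) * \<phi> (t, x))
       = (\<Sum>i\<in>UNIV. dF i (vu p)) * \<phi> p"
      using div_x_eq[OF F vu_mem] by (simp add: case_prod_beta' dF_def del: split_paired_All)
  qed (rule Om_lebesgue)
  show ?thesis
    unfolding entropy_production_def 1 2 first_order_lebesgue[OF coeffs_entropy[OF E E' G] \<phi>]
      set_integral_lebesgue_coeff(1)[OF loc_bounded_diff[OF Om_borel lb(1,2)] lb(3) \<phi>]
      set_integral_lebesgue_coeff(2)[OF lb(1,2) \<phi>]
    by (simp add: case_prod_beta' vd gc_def)
qed

text \<open>
  The coefficients of the Kruzhkov production, each written as \<open>sgn(u - k)\<close> times a function continuous in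
  \<open>(k, t, x, u)\<close>; in particular \<open>\<bar>u - k\<bar> = sgn(u - k) (u - k)\<close>.
\<close>

definition kr0 :: "real \<Rightarrow> 'n point \<Rightarrow> complex" where
  "kr0 k p = of_real (sgn (u p - k)) * (of_real (u p) - of_real k)"

definition kr1 :: "real \<Rightarrow> 'n \<Rightarrow> 'n point \<Rightarrow> complex" where
  "kr1 k i p = of_real (sgn (u p - k)) * (fc i (vu p) - fc i (fst p, snd p, k))"

definition kr2 :: "real \<Rightarrow> 'n point \<Rightarrow> complex" where
  "kr2 k p = of_real (sgn (u p - k)) * (gc (vu p) - (\<Sum>i\<in>UNIV. dfc i (fst p, snd p, k)))"

definition kr3 :: "real \<Rightarrow> real^'n \<Rightarrow> complex" where
  "kr3 k x = of_real (sgn (uo x - k)) * (of_real (uo x) - of_real k)"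

lemma continuous_on_state_k:
  fixes \<Phi> :: "'n state \<Rightarrow> complex"
  assumes "continuous_on (flux_dom I) \<Phi>"
  shows "continuous_on (UNIV \<times> Om I \<times> UNIV)
      (\<lambda>z :: real \<times> 'n point \<times> real. \<Phi> (fst (fst (snd z)), snd (fst (snd z)), snd (snd z)))"
    and "continuous_on (UNIV \<times> Om I \<times> UNIV)
      (\<lambda>z :: real \<times> 'n point \<times> real. \<Phi> (fst (fst (snd z)), snd (fst (snd z)), fst z))"
proof -
  have *: "continuous_on (UNIV \<times> Om I \<times> UNIV)
      (\<lambda>z :: real \<times> 'n point \<times> real. \<Phi> (fst (fst (snd z)), snd (fst (snd z)), w z))"
    if w: "continuous_on (UNIV \<times> Om I \<times> UNIV) w" for w
  proof (rule continuous_on_compose2[OF assms])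
    show "continuous_on (UNIV \<times> Om I \<times> UNIV)
       (\<lambda>z :: real \<times> 'n point \<times> real. (fst (fst (snd z)), snd (fst (snd z)), w z))"
      by (intro continuous_intros w)
    show "(\<lambda>z. (fst (fst (snd z)), snd (fst (snd z)), w z)) ` (UNIV \<times> Om I \<times> UNIV) \<subseteq> flux_dom I"
    proof (rule image_subsetI)
      fix z :: "real \<times> 'n point \<times> real" assume "z \<in> UNIV \<times> Om I \<times> UNIV"
      then have "fst (snd z) \<in> Om I" by (auto simp: mem_Times_iff)
      then show "(fst (fst (snd z)), snd (fst (snd z)), w z) \<in> flux_dom I"
        by (rule mem_flux_dom)
    qed
  qed
  show "continuous_on (UNIV \<times> Om I \<times> UNIV)
      (\<lambda>z :: real \<times> 'n point \<times> real. \<Phi> (fst (fst (snd z)), snd (fst (snd z)), snd (snd z)))"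
    by (intro * continuous_intros)
  show "continuous_on (UNIV \<times> Om I \<times> UNIV)
      (\<lambda>z :: real \<times> 'n point \<times> real. \<Phi> (fst (fst (snd z)), snd (fst (snd z)), fst z))"
    by (intro * continuous_intros)
qed

lemma loc_bounded_kr:
  assumes h: "continuous_on UNIV h"
  shows "loc_bounded (UNIV \<times> Om I) (\<lambda>(k, p). kr0 k p * h k)"
    and "loc_bounded (UNIV \<times> Om I) (\<lambda>(k, p). kr1 k i p * h k)"
    and "loc_bounded (UNIV \<times> Om I) (\<lambda>(k, p). kr2 k p * h k)"
    and "loc_bounded (UNIV \<times> UNIV) (\<lambda>(k, x). kr3 k x * h k)"
proof -
  have hc: "continuous_on A (\<lambda>z. h (fst z))" for A :: "(real \<times> 'a::topological_space) set"
    by (intro continuous_on_compose2[OF h] continuous_intros) auto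
  show "loc_bounded (UNIV \<times> Om I) (\<lambda>(k, p). kr0 k p * h k)"
    using loc_bounded_sgn_kernel[OF Om_borel _ u_borel u_le,
        of "\<lambda>k p w. (of_real w - of_real k) * h k"]
    by (simp add: kr0_def mult.assoc case_prod_beta' hc continuous_intros)
  show "loc_bounded (UNIV \<times> Om I) (\<lambda>(k, p). kr1 k i p * h k)"
    using loc_bounded_sgn_kernel[OF Om_borel _ u_borel u_le,
        of "\<lambda>k p w. (fc i (fst p, snd p, w) - fc i (fst p, snd p, k)) * h k"]
    by (simp add: kr1_def mult.assoc case_prod_beta' continuous_on_mult continuous_on_diff hc
        continuous_on_state_k[OF continuous_fc(1)])
  show "loc_bounded (UNIV \<times> Om I) (\<lambda>(k, p). kr2 k p * h k)"
    using loc_bounded_sgn_kernel[OF Om_borel _ u_borel u_le,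
        of "\<lambda>k p w. (gc (fst p, snd p, w) - (\<Sum>i\<in>UNIV. dfc i (fst p, snd p, k))) * h k"]
    by (simp add: kr2_def mult.assoc case_prod_beta' continuous_on_mult continuous_on_diff continuous_on_sum hc
        continuous_on_state_k[OF continuous_fc(2)] continuous_on_state_k[OF continuous_gc])
  show "loc_bounded (UNIV \<times> UNIV) (\<lambda>(k, x). kr3 k x * h k)"
    using loc_bounded_sgn_kernel[OF _ _ uo_borel uo_le,
        of UNIV "\<lambda>k p w. (of_real w - of_real k) * h k"]
    by (simp add: kr3_def mult.assoc case_prod_beta' hc continuous_intros)
qed

lemma coeffs_kr: "coeffs (kr0 k) (kr1 k) (kr2 k) (kr3 k)"
  using loc_bounded_sections(1)[OF loc_bounded_kr(1)[of "\<lambda>_. 1"], of k]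
    loc_bounded_sections(1)[OF loc_bounded_kr(2)[of "\<lambda>_. 1"], of k]
    loc_bounded_sections(1)[OF loc_bounded_kr(3)[of "\<lambda>_. 1"], of k]
    loc_bounded_sections(1)[OF loc_bounded_kr(4)[of "\<lambda>_. 1"], of k]
  by (simp add: coeffs_def)

lemma Kruzhkov_production_eq_first_order:
  assumes \<phi>: "\<phi> \<in> Ckc 1 (Om I)"
  shows "Kruzhkov_production I f g uo u k \<phi> = first_order (kr0 k) (kr1 k) (kr2 k) (kr3 k) \<phi>"
proof -
  have abs: "complex_of_real \<bar>a - k\<bar> = of_real (sgn (a - k)) * (of_real a - of_real k)" for a
  proof -
    have "\<bar>a - k\<bar> = sgn (a - k) * (a - k)" by (simp add: sgn_if abs_if)
    then show ?thesis by (simp only: of_real_mult of_real_diff)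
  qed
  let ?A = "\<lambda>p. of_real (sgn (u p - k)) * (\<Sum>i\<in>UNIV. dfc i (fst p, snd p, k))"
  let ?B = "\<lambda>p. of_real (sgn (u p - k)) * gc (vu p)"
  have A: "loc_bounded (Om I) ?A" "loc_bounded (Om I) ?B"
  proof -
    have sgn: "loc_bounded (Om I) (\<lambda>p. complex_of_real (sgn (u p - k)))"
    proof (rule loc_bounded_bounded[OF Om_borel])
      show "(\<lambda>p. complex_of_real (sgn (u p - k))) \<in> borel_measurable borel"
        using u_borel unfolding sgn_real_def by measurable
      show "norm (complex_of_real (sgn (u p - k))) \<le> 1" for p
        by (simp add: sgn_real_def)
    qed
    have "loc_bounded (Om I) (\<lambda>p. \<Sum>i\<in>UNIV. dfc i (fst p, snd p, k))"
      by (intro loc_bounded_sum[OF Om_borel] loc_bounded_state[where v = "\<lambda>_. k" and R = "\<bar>k\<bar>"] continuous_fc) auto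
    with sgn show "loc_bounded (Om I) ?A" by (rule loc_bounded_mult)
    show "loc_bounded (Om I) ?B"
      by (rule loc_bounded_mult[OF sgn loc_bounded_vu[OF continuous_gc]])
  qed
  have 1: "(LINT (t, x):Om I|lebesgue. complex_of_real (sgn (u (t, x) - k) * div_x I f (t, x, k)) * \<phi> (t, x))
      = (LINT p:Om I|lebesgue. ?A p * \<phi> p)"
  proof (rule set_lebesgue_integral_cong)
    show "\<forall>p. p \<in> Om I \<longrightarrow> (case p of (t, x) \<Rightarrow>
        complex_of_real (sgn (u (t, x) - k) * div_x I f (t, x, k)) * \<phi> (t, x)) = ?A p * \<phi> p"
      using div_x_f[OF mem_flux_dom] by (simp add: case_prod_beta' del: split_paired_All)
  qed (rule Om_lebesgue)
  have 2: "kr2 k = (\<lambda>p. ?B p - ?A p)"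
    by (simp add: fun_eq_iff kr2_def right_diff_distrib)
  show ?thesis
    unfolding Kruzhkov_production_def 1 first_order_lebesgue[OF coeffs_kr \<phi>]
    unfolding 2 set_integral_lebesgue_coeff(2)[OF A(2,1) \<phi>]
    by (simp add: case_prod_beta' abs kr0_def kr1_def kr3_def Kruzhkov_flux_def fc_def gc_def)
qed

end

section \<open>The standard entropy flux\<close>

context balance_law
begin

text \<open>
  With \<open>\<E>\<^sub>\<xi>' = 2 \<integral>\<^bsub>[0,w]\<^esub> e\<close> this is \<open>\<E>\<^sub>\<xi>' \<Phi> - \<integral>\<^bsub>[0,w]\<^esub> \<E>\<^sub>\<xi>'' \<Phi>\<close>, hence by parts the integral of
  \<open>\<E>\<^sub>\<xi>' \<partial>\<^sub>u\<Phi>\<close>. For \<open>\<Phi> = f\<^sub>i\<close> it is a component of an entropy flux, in a form that can be differentiated in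
  \<open>(t, x)\<close> whenever \<open>\<Phi>\<close> can.
\<close>

definition tilt :: "complex \<Rightarrow> ('n state \<Rightarrow> complex) \<Rightarrow> 'n state \<Rightarrow> complex" where
  "tilt \<xi> \<Phi> q = 2 * (prim (wave \<xi>) (snd (snd q)) * \<Phi> q)
     - 2 * prim_u (\<lambda>q. \<Phi> q * wave \<xi> (snd (snd q))) q"

lemma continuous_on_snd_snd:
  fixes c :: "real \<Rightarrow> complex"
  assumes "continuous_on UNIV c"
  shows "continuous_on A (\<lambda>q :: 'n state. c (snd (snd q)))"
  by (intro continuous_on_compose2[OF assms] continuous_intros) auto

lemma continuous_on_times_wave:
  "continuous_on (flux_dom I) \<Phi> \<Longrightarrow> continuous_on (flux_dom I) (\<lambda>q :: 'n state. \<Phi> q * wave \<xi> (snd (snd q)))"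
  by (intro continuous_on_mult continuous_on_wave continuous_intros)

lemma continuous_on_tilt:
  assumes "continuous_on (flux_dom I) \<Phi>"
  shows "continuous_on (flux_dom I) (tilt \<xi> \<Phi>)"
  unfolding tilt_def
  by (intro continuous_on_diff continuous_on_mult continuous_on_const assms
      continuous_on_snd_snd continuous_prim_wave continuous_on_prim_u continuous_on_times_wave)

lemma has_pd_times_wave:
  assumes "has_pd (flux_dom I) (\<tau>, y, 0) \<Phi> D"
  shows "has_pd (flux_dom I) (\<tau>, y, 0) (\<lambda>q :: 'n state. \<Phi> q * wave \<xi> (snd (snd q))) (\<lambda>q. D q * wave \<xi> (snd (snd q)))"
  using has_pd_mult[OF assms has_pd_state_fun[where c = "wave \<xi>"]] by simp

lemma has_pd_tilt:
  assumes "continuous_on (flux_dom I) \<Phi>" "continuous_on (flux_dom I) D"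
    and hd: "has_pd (flux_dom I) (\<tau>, y, 0) \<Phi> D"
  shows "has_pd (flux_dom I) (\<tau>, y, 0) (tilt \<xi> \<Phi>) (tilt \<xi> D)"
proof -
  have "has_pd (flux_dom I) (\<tau>, y, 0) (\<lambda>q :: 'n state. prim (wave \<xi>) (snd (snd q)) * \<Phi> q)
     (\<lambda>q. prim (wave \<xi>) (snd (snd q)) * D q)"
    using has_pd_mult[OF has_pd_state_fun[where c = "prim (wave \<xi>)"] hd] by simp
  moreover have "has_pd (flux_dom I) (\<tau>, y, 0) (prim_u (\<lambda>q. \<Phi> q * wave \<xi> (snd (snd q))))
     (prim_u (\<lambda>q. D q * wave \<xi> (snd (snd q))))"
    by (intro has_pd_prim_u convex_closure convex_I continuous_on_times_wave has_pd_times_wave assms)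
  ultimately show ?thesis
    unfolding tilt_def[abs_def]
    by (intro has_pd_diff has_pd_bounded_linear[OF bounded_linear_mult_right])
qed

text \<open>
  The terms containing \<open>e(w)\<close> cancel and leave \<open>\<E>\<^sub>\<xi>' \<partial>\<^sub>u\<Phi>\<close>.
\<close>

lemma has_pd_tilt_state:
  assumes c: "continuous_on (flux_dom I) \<Phi>" and hd: "has_pd (flux_dom I) (0, 0, 1) \<Phi> D"
  shows "has_pd (flux_dom I) (0, 0, 1) (tilt \<xi> \<Phi>) (\<lambda>q :: 'n state. 2 * prim (wave \<xi>) (snd (snd q)) * D q)"
proof -
  have k: "has_pd (flux_dom I) (0, 0, 1) (\<lambda>q :: 'n state. prim (wave \<xi>) (snd (snd q))) (\<lambda>q. wave \<xi> (snd (snd q)))"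
    by (intro has_pd_state_deriv prim_has_vector_derivative continuous_on_wave continuous_on_id)
  have "has_pd (flux_dom I) (0, 0, 1) (tilt \<xi> \<Phi>)
     (\<lambda>q :: 'n state. 2 * (prim (wave \<xi>) (snd (snd q)) * D q + wave \<xi> (snd (snd q)) * \<Phi> q)
       - 2 * (\<Phi> q * wave \<xi> (snd (snd q))))"
    unfolding tilt_def[abs_def]
    by (intro has_pd_diff has_pd_bounded_linear[OF bounded_linear_mult_right] has_pd_mult[OF k hd]
        has_pd_prim_u_state continuous_on_times_wave c)
  then show ?thesis
    by (rule has_pd_cong) (simp_all add: algebra_simps)
qed

lemma regular_tilt: "regular_flux (\<lambda>i. tilt \<xi> (fc i)) (\<lambda>i. tilt \<xi> (dfc i))"
  using regular_fc unfolding regular_flux_def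
  by (intro allI conjI continuous_on_tilt has_pd_tilt; blast)

definition std_flux :: "complex \<Rightarrow> 'n state \<Rightarrow> complex^'n" where
  "std_flux \<xi> q = (\<chi> i. tilt \<xi> (fc i) q)"

lemma has_pd_component:
  assumes "has_pd S b h d"
  shows "has_pd S b (\<lambda>q. complex_of_real (h q $ (i :: 'n))) (\<lambda>q. complex_of_real (d q $ i))"
  by (rule has_pd_bounded_linear[OF bounded_linear_component assms])

lemma continuous_component:
  assumes "continuous_on S h"
  shows "continuous_on S (\<lambda>q. complex_of_real (h q $ (i :: 'n)))"
  by (rule bounded_linear.continuous_on[OF bounded_linear_component assms])

lemma entropy_pair_std_flux: "entropy_pair I f (exp_entropy \<xi>) (std_flux \<xi>)"
proof -
  let ?c = "\<lambda>i h q. complex_of_real (h q $ (i :: 'n)) :: complex"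
  let ?H = "\<lambda>q. \<chi> i. 2 * prim (wave \<xi>) (snd (snd q)) * ?c i (du I f) q"
  have fcc: "fc i = ?c i f" for i by (simp add: fc_def fun_eq_iff)
  have K: "continuous_on A (\<lambda>q :: 'n state. 2 * prim (wave \<xi>) (snd (snd q)))" for A
    by (intro continuous_on_mult continuous_on_const continuous_on_snd_snd continuous_prim_wave)
  have du: "has_pd (flux_dom I) (0, 0, 1) (std_flux \<xi>) ?H"
  proof (rule has_pd_vec)
    fix i
    show "has_pd (flux_dom I) (0, 0, 1) (\<lambda>q. std_flux \<xi> q $ i) (\<lambda>q. ?H q $ i)"
      using has_pd_tilt_state[OF continuous_component[OF flux_classD(1)[OF flux], of i]
          has_pd_component[OF flux_classD(2)[OF flux state_basis(3)], of i]]
      by (simp add: std_flux_def fcc)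
  qed
  have cH: "continuous_on (flux_dom I) ?H"
    by (intro continuous_on_vec_lambda continuous_on_mult[OF K] continuous_component flux_classD(3)[OF flux state_basis(3)])
  have dq: "has_pd (flux_dom I) (\<tau>, y, 0) (std_flux \<xi>) (\<lambda>q. \<chi> i. tilt \<xi> (?c i (pd (flux_dom I) (\<tau>, y, 0) f)) q)"
    "continuous_on (flux_dom I) (\<lambda>q. \<chi> i. tilt \<xi> (?c i (pd (flux_dom I) (\<tau>, y, 0) f)) q)"
    if b: "((\<tau>, y, 0) :: 'n state) \<in> Basis" for \<tau> y
  proof -
    have 1: "has_pd (flux_dom I) (\<tau>, y, 0) (tilt \<xi> (?c i f)) (tilt \<xi> (?c i (pd (flux_dom I) (\<tau>, y, 0) f)))" for i
      by (intro has_pd_tilt continuous_component has_pd_component flux_classD[OF flux] b)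
    show "has_pd (flux_dom I) (\<tau>, y, 0) (std_flux \<xi>) (\<lambda>q. \<chi> i. tilt \<xi> (?c i (pd (flux_dom I) (\<tau>, y, 0) f)) q)"
      by (rule has_pd_vec) (use 1 in \<open>simp add: std_flux_def fcc\<close>)
    show "continuous_on (flux_dom I) (\<lambda>q. \<chi> i. tilt \<xi> (?c i (pd (flux_dom I) (\<tau>, y, 0) f)) q)"
      by (intro continuous_on_vec_lambda continuous_on_tilt continuous_component flux_classD[OF flux] b)
  qed
  have cF: "continuous_on (flux_dom I) (std_flux \<xi>)"
    unfolding std_flux_def[abs_def]
    by (intro continuous_on_vec_lambda continuous_on_tilt continuous_fc)
  have pdI: "has_pd_on (flux_dom I) b h \<and> continuous_on (flux_dom I) (pd (flux_dom I) b h)"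
    if "has_pd (flux_dom I) b h d" "continuous_on (flux_dom I) d" for b and h d :: "'n state \<Rightarrow> complex^'n"
    using that has_pd_imp_has_pd_on[OF that(1)] has_pd_imp_pd_eq[OF that(1) thick_flux_dom]
    by (simp cong: continuous_on_cong del: split_paired_All)
  have C1: "Ck_on 1 (flux_dom I) (std_flux \<xi>)"
    unfolding One_nat_def Ck_on_Suc_0_iff
  proof (intro conjI[OF cF] ballI)
    fix b :: "'n state" assume b: "b \<in> Basis"
    from state_basis_cases[OF b]
    show "has_pd_on (flux_dom I) b (std_flux \<xi>) \<and> continuous_on (flux_dom I) (pd (flux_dom I) b (std_flux \<xi>))"
    proof (elim disjE exE)
      assume "b = (1, 0, 0)"
      then show ?thesis using pdI[OF dq[OF state_basis(1)]] by simp
    next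
      fix i assume "b = (0, axis i 1, 0)"
      then show ?thesis using pdI[OF dq[OF state_basis(2)]] by simp
    next
      assume "b = (0, 0, 1)"
      then show ?thesis using pdI[OF du cH] by simp
    qed
  qed
  have du_eq: "du I (std_flux \<xi>) q = ?H q" if "q \<in> flux_dom I" for q
    by (rule has_pd_imp_pd_eq[OF du thick_flux_dom that])
  have dd: "has_pd_on (flux_dom I) (\<tau>, y, 0) (du I (std_flux \<xi>))
      \<and> continuous_on (flux_dom I) (pd (flux_dom I) (\<tau>, y, 0) (du I (std_flux \<xi>)))"
    if f: "has_pd_on (flux_dom I) (\<tau>, y, 0) (du I f)"
      "continuous_on (flux_dom I) (pd (flux_dom I) (\<tau>, y, 0) (du I f))" for \<tau> y
  proof (rule pdI)
    let ?D = "\<lambda>q. \<chi> i. 2 * prim (wave \<xi>) (snd (snd q)) * ?c i (pd (flux_dom I) (\<tau>, y, 0) (du I f)) q"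
    have "has_pd (flux_dom I) (\<tau>, y, 0) ?H ?D"
    proof (rule has_pd_vec)
      fix i
      show "has_pd (flux_dom I) (\<tau>, y, 0) (\<lambda>q. ?H q $ i) (\<lambda>q. ?D q $ i)"
        using has_pd_mult[OF has_pd_state_fun[where c = "\<lambda>w. 2 * prim (wave \<xi>) w"]
            has_pd_component[OF has_pd_pd[OF f(1)], of i]] by simp
    qed
    then show "has_pd (flux_dom I) (\<tau>, y, 0) (du I (std_flux \<xi>)) ?D"
      by (rule has_pd_cong[OF _ du_eq refl])
    show "continuous_on (flux_dom I) ?D"
      by (intro continuous_on_vec_lambda continuous_on_mult[OF K] continuous_component f(2))
  qed
  have "flux_class I (std_flux \<xi>)"
    using C1 dd flux unfolding flux_class_def by simp
  moreover have "du I (std_flux \<xi>) (t, x, w) $ i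
        = vector_derivative (exp_entropy \<xi>) (at w) * complex_of_real (du I f (t, x, w) $ i)"
    if "t \<in> closure I" for t x w i
    using du_eq[of "(t, x, w)"] that
    by (simp add: vector_derivative_at[OF exp_entropy_has_vector_derivative])
  ultimately show ?thesis
    using Ck_on_exp_entropy by (simp add: entropy_pair_def)
qed

text \<open>
  As functions of \<open>w\<close> both sides have the derivative \<open>\<E>\<^sub>\<xi>'(w) \<partial>\<^sub>u f\<^sub>i\<close>, and they agree at \<open>w = 0\<close>, where the
  standard flux vanishes.
\<close>

lemma entropy_flux_decomposition:
  assumes F: "entropy_pair I f (exp_entropy \<xi>) F" and t: "t \<in> closure I"
  shows "F (t, x, w) $ i = tilt \<xi> (fc i) (t, x, w) + F (t, x, 0) $ i"
proof -
  have fF: "flux_class I F" using F by (simp add: entropy_pair_def)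
  have tilt0: "tilt \<xi> (fc i) (t, x, 0) = 0"
    by (simp add: tilt_def prim_u_def)
  let ?d = "\<lambda>r. F (t, x, r) $ i - tilt \<xi> (fc i) (t, x, r) - F (t, x, 0) $ i"
  have "(?d has_vector_derivative 0) (at r)" for r
  proof -
    have hF: "has_pd (flux_dom I) (0, 0, 1) (\<lambda>q. F q $ i) (\<lambda>q. du I F q $ i)"
      by (rule has_pd_bounded_linear[OF bounded_linear_vec_nth flux_classD(2)[OF fF state_basis(3)]])
    have hG: "has_pd (flux_dom I) (0, 0, 1) (tilt \<xi> (fc i))
        (\<lambda>q. 2 * prim (wave \<xi>) (snd (snd q)) * complex_of_real (du I f q $ i))"
      using has_pd_tilt_state[OF continuous_fc(1) has_pd_component[OF flux_classD(2)[OF flux state_basis(3)], of i, folded fc_def]] .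
    have m: "(t, x, 0) + r *\<^sub>R (0, 0, 1) \<in> flux_dom I" using t by simp
    have U: "{r. (t, x, 0) + r *\<^sub>R (0, 0, 1) \<in> flux_dom I} = (UNIV :: real set)" using t by simp
    have "((\<lambda>r. F (t, x, r) $ i) has_vector_derivative du I F (t, x, r) $ i) (at r)"
      using has_pd_at[OF hF m] unfolding U by simp
    moreover have "((\<lambda>r. tilt \<xi> (fc i) (t, x, r)) has_vector_derivative
        2 * prim (wave \<xi>) r * complex_of_real (du I f (t, x, r) $ i)) (at r)"
      using has_pd_at[OF hG m] unfolding U by simp
    moreover have "du I F (t, x, r) $ i = 2 * prim (wave \<xi>) r * complex_of_real (du I f (t, x, r) $ i)"
      using F t by (simp add: entropy_pair_def vector_derivative_at[OF exp_entropy_has_vector_derivative])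
    ultimately have "(?d has_vector_derivative
        2 * prim (wave \<xi>) r * complex_of_real (du I f (t, x, r) $ i)
        - 2 * prim (wave \<xi>) r * complex_of_real (du I f (t, x, r) $ i) - 0) (at r)"
      by (intro has_vector_derivative_diff has_vector_derivative_const) simp_all
    then show ?thesis by simp
  qed
  then have "prim (\<lambda>_. 0) w = ?d w"
    by (rule prim_eqI) (simp add: tilt0)
  then show ?thesis by (simp add: prim_def algebra_simps)
qed

lemma entropy_flux_decomposition_pd:
  assumes F: "entropy_pair I f (exp_entropy \<xi>) F" and p: "p \<in> Om I"
  defines "dF \<equiv> \<lambda>i q. pd (flux_dom I) (0, axis i 1, 0) F q $ i"
  shows "dF i (fst p, snd p, w) = tilt \<xi> (dfc i) (fst p, snd p, w) + dF i (fst p, snd p, 0)"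
proof -
  have fF: "flux_class I F" using F by (simp add: entropy_pair_def)
  let ?e = "(0, axis i 1) :: 'n point"
  have hF: "has_pd (flux_dom I) (0, axis i 1, 0) (\<lambda>q. F q $ i) (dF i)"
    unfolding dF_def
    by (rule has_pd_bounded_linear[OF bounded_linear_vec_nth flux_classD(2)[OF fF state_basis(2)]])
  have hG: "has_pd (flux_dom I) (0, axis i 1, 0) (tilt \<xi> (fc i)) (tilt \<xi> (dfc i))"
    using regular_tilt by (simp add: regular_flux_def)
  have "has_pd (Om I) ?e (\<lambda>p. F (fst p, snd p, w) $ i)
     (\<lambda>p. tilt \<xi> (dfc i) (fst p, snd p, w) + dF i (fst p, snd p, 0))"
  proof (rule has_pd_cong[OF has_pd_add[OF has_pd_freeze[OF hG, of w] has_pd_freeze[OF hF, of 0]] _ refl])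
    fix p :: "'n point" assume "p \<in> Om I"
    then have "fst p \<in> closure I" using closure_subset[of I] by (auto simp: mem_Times_iff)
    then show "F (fst p, snd p, w) $ i = tilt \<xi> (fc i) (fst p, snd p, w) + F (fst p, snd p, 0) $ i"
      by (rule entropy_flux_decomposition[OF F])
  qed
  from has_pd_imp_pd_eq[OF this thick_Om p] has_pd_imp_pd_eq[OF has_pd_freeze[OF hF, of w] thick_Om p]
  show ?thesis by simp
qed

end

section \<open>The Fourier transform of the Kruzhkov productions\<close>

context balance_law
begin

abbreviation entropy_functional ::
  "complex \<Rightarrow> ('n \<Rightarrow> 'n state \<Rightarrow> complex) \<Rightarrow> ('n \<Rightarrow> 'n state \<Rightarrow> complex) \<Rightarrow> ('n point \<Rightarrow> complex) \<Rightarrow> complex"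
where
  "entropy_functional \<xi> G dG \<equiv> first_order (\<lambda>p. exp_entropy \<xi> (u p)) (\<lambda>i p. G i (vu p))
     (\<lambda>p. (\<Sum>i\<in>UNIV. dG i (vu p)) - 2 * prim (wave \<xi>) (u p) * (\<Sum>i\<in>UNIV. dfc i (vu p))
        + 2 * prim (wave \<xi>) (u p) * gc (vu p))
     (\<lambda>x. exp_entropy \<xi> (uo x))"

lemma continuous_2_prim_wave: "continuous_on UNIV (\<lambda>w. 2 * prim (wave \<xi>) w)"
  by (intro continuous_on_mult continuous_on_const continuous_prim_wave)

lemmas coeffs_std =
  coeffs_entropy[OF continuous_exp_entropy continuous_2_prim_wave regular_tilt]

text \<open>
  The entropy production does not depend on the flux: two fluxes differ by a field that does not
  depend on \<open>u\<close>, and its contribution is a divergence.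
\<close>

lemma entropy_production_eq_std:
  assumes F: "entropy_pair I f (exp_entropy \<xi>) F" and \<phi>: "\<phi> \<in> Ckc 1 (Om I)"
  shows "entropy_production I f g uo u (exp_entropy \<xi>) F \<phi>
     = entropy_functional \<xi> (\<lambda>i. tilt \<xi> (fc i)) (\<lambda>i. tilt \<xi> (dfc i)) \<phi>"
proof -
  have fF: "flux_class I F" using F by (simp add: entropy_pair_def)
  define dF where "dF i q = pd (flux_dom I) (0, axis i 1, 0) F q $ i" for i q
  have reg: "regular_flux (\<lambda>i q. F q $ i) dF"
    unfolding dF_def[abs_def] using regular_flux_flux_class[OF fF bounded_linear_vec_nth] by simp
  have "entropy_production I f g uo u (exp_entropy \<xi>) F \<phi>
     = entropy_functional \<xi> (\<lambda>i q. F q $ i) dF \<phi>"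
    using entropy_production_eq_first_order[OF continuous_exp_entropy continuous_2_prim_wave
        exp_entropy_has_vector_derivative fF \<phi>, folded dF_def[abs_def]]
    by (simp add: dF_def)
  also have "\<dots> = first_order (\<lambda>p. exp_entropy \<xi> (u p) + 1 * 0)
     (\<lambda>i p. tilt \<xi> (fc i) (vu p) + 1 * F (fst p, snd p, 0) $ i)
     (\<lambda>p. ((\<Sum>i\<in>UNIV. tilt \<xi> (dfc i) (vu p)) - 2 * prim (wave \<xi>) (u p) * (\<Sum>i\<in>UNIV. dfc i (vu p))
        + 2 * prim (wave \<xi>) (u p) * gc (vu p)) + 1 * (\<Sum>i\<in>UNIV. dF i (fst p, snd p, 0)))
     (\<lambda>x. exp_entropy \<xi> (uo x) + 1 * 0) \<phi>"
  proof (rule first_order_cong)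
    fix p :: "'n point" assume p: "p \<in> Om I"
    then have "fst p \<in> closure I" using closure_subset[of I] by (auto simp: mem_Times_iff)
    then show "F (vu p) $ i = tilt \<xi> (fc i) (vu p) + 1 * F (fst p, snd p, 0) $ i" for i
      unfolding mult_1 by (rule entropy_flux_decomposition[OF F])
    have "dF i (vu p) = tilt \<xi> (dfc i) (vu p) + dF i (fst p, snd p, 0)" for i
      unfolding dF_def by (rule entropy_flux_decomposition_pd[OF F p])
    then have "(\<Sum>i\<in>UNIV. dF i (vu p)) = (\<Sum>i\<in>UNIV. tilt \<xi> (dfc i) (vu p)) + (\<Sum>i\<in>UNIV. dF i (fst p, snd p, 0))"
      by (simp only: sum.distrib)
    then show "(\<Sum>i\<in>UNIV. dF i (vu p)) - 2 * prim (wave \<xi>) (u p) * (\<Sum>i\<in>UNIV. dfc i (vu p))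
        + 2 * prim (wave \<xi>) (u p) * gc (vu p)
      = ((\<Sum>i\<in>UNIV. tilt \<xi> (dfc i) (vu p)) - 2 * prim (wave \<xi>) (u p) * (\<Sum>i\<in>UNIV. dfc i (vu p))
        + 2 * prim (wave \<xi>) (u p) * gc (vu p)) + 1 * (\<Sum>i\<in>UNIV. dF i (fst p, snd p, 0))"
      by (simp only: mult_1) (simp only: algebra_simps)
  qed simp_all
  also have "\<dots> = entropy_functional \<xi> (\<lambda>i. tilt \<xi> (fc i)) (\<lambda>i. tilt \<xi> (dfc i)) \<phi>
      + 1 * first_order (\<lambda>_. 0) (\<lambda>i p. F (fst p, snd p, 0) $ i) (\<lambda>p. \<Sum>i\<in>UNIV. dF i (fst p, snd p, 0)) (\<lambda>_. 0) \<phi>"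
    by (rule first_order_linear[OF coeffs_std coeffs_regular_flux[OF reg, of 0] \<phi>])
  also have "first_order (\<lambda>_. 0) (\<lambda>i p. F (fst p, snd p, 0) $ i) (\<lambda>p. \<Sum>i\<in>UNIV. dF i (fst p, snd p, 0)) (\<lambda>_. 0) \<phi> = 0"
    by (rule first_order_divergence[OF reg \<phi>])
  finally show ?thesis by simp
qed

text \<open>
  Beyond the bound \<open>R\<close> the sign is a constant \<open>s\<close>, so the production is \<open>s\<close> times the weak form of the
  equation, corrected by terms for the constant state \<open>k\<close>; each of these vanishes.
\<close>

lemma Kruzhkov_production_eq_0:
  assumes \<phi>: "\<phi> \<in> Ckc 1 (Om I)" and k: "R < \<bar>k\<bar>"
  shows "Kruzhkov_production I f g uo u k \<phi> = 0"
proof -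
  define s where "s = complex_of_real (- sgn k)"
  have sgn: "complex_of_real (sgn (w - k)) = s" if "\<bar>w\<bar> \<le> R" for w
    using that k unfolding s_def by (auto simp: sgn_if)
  note zero = coeffs_const[of 0 0 0 0]
  note A = coeffs_linear[OF zero coeffs_solution, of s]
  note B = coeffs_linear[OF A coeffs_const[of 1 0 0 1], of "- s * of_real k"]
  \<comment> \<open>Zero coefficients, then \<open>s\<close> times the equation, \<open>- s k\<close> times the entropy \<open>1\<close>, and \<open>- s\<close> times the
    divergence of \<open>f(\<cdot>, k)\<close>; the nesting is the one produced by \<open>first_order_linear\<close>.\<close>
  have "first_order (kr0 k) (kr1 k) (kr2 k) (kr3 k) \<phi> = first_order
     (\<lambda>p. ((0 + s * of_real (u p)) + (- s * of_real k) * 1) + (- s) * 0)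
     (\<lambda>i p. ((0 + s * fc i (vu p)) + (- s * of_real k) * 0) + (- s) * fc i (fst p, snd p, k))
     (\<lambda>p. ((0 + s * gc (vu p)) + (- s * of_real k) * 0) + (- s) * (\<Sum>i\<in>UNIV. dfc i (fst p, snd p, k)))
     (\<lambda>x. ((0 + s * of_real (uo x)) + (- s * of_real k) * 1) + (- s) * 0) \<phi>"
    by (rule first_order_cong)
      (simp_all add: kr0_def kr1_def kr2_def kr3_def sgn[OF u_le] sgn[OF uo_le] algebra_simps)
  also have "\<dots> = ((first_order (\<lambda>_. 0) (\<lambda>_ _. 0) (\<lambda>_. 0) (\<lambda>_. 0) \<phi> + s * 0) + (- s * of_real k) * 0) + (- s) * 0"
    unfolding first_order_linear[OF B coeffs_regular_flux[OF regular_fc, of k] \<phi>]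
      first_order_linear[OF A coeffs_const \<phi>] first_order_linear[OF zero coeffs_solution \<phi>]
      first_order_solution[OF \<phi>] first_order_time[OF \<phi>] first_order_divergence[OF regular_fc \<phi>] ..
  also have "\<dots> = 0" by (simp add: first_order_def symbol_def)
  finally show ?thesis by (simp only: Kruzhkov_production_eq_first_order[OF \<phi>])
qed

text \<open>
  The common computation behind all coefficients of the transform: \<open>c\<close> is the value of \<open>h\<close> at the state \<open>w\<close>
  (or of the source term), and the right-hand side separates what depends on \<open>w\<close> through \<open>\<E>\<^sub>\<xi>'\<close> and
  a primitive from a multiple of \<open>c\<close> and a term independent of \<open>w\<close>.
\<close>

lemma kr_kernel_integral:
  fixes h :: "real \<Rightarrow> complex"
  assumes h: "continuous_on UNIV h" and w: "\<bar>w\<bar> \<le> R"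
  shows "(LINT k:{-R..R}|lborel. of_real (sgn (w - k)) * ((c - h k) * wave \<xi> k))
     = 2 * (prim (wave \<xi>) w * c) - 2 * prim (\<lambda>k. h k * wave \<xi> k) w
       + (- prim (wave \<xi>) R - prim (wave \<xi>) (- R)) * c
       + prim (\<lambda>k. h k * wave \<xi> k) R + prim (\<lambda>k. h k * wave \<xi> k) (- R)"
proof -
  have k: "continuous_on UNIV (wave \<xi>)" by (intro continuous_on_wave continuous_on_id)
  have eq: "prim (\<lambda>k. (c - h k) * wave \<xi> k) v = c * prim (wave \<xi>) v - prim (\<lambda>k. h k * wave \<xi> k) v" for v
    unfolding left_diff_distrib
    using prim_diff[of "\<lambda>k. c * wave \<xi> k" "\<lambda>k. h k * wave \<xi> k" v] h k
    by (simp add: prim_cmult continuous_on_mult)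
  have "continuous_on UNIV (\<lambda>k. (c - h k) * wave \<xi> k)"
    by (intro continuous_on_mult continuous_on_diff continuous_on_const h k)
  from set_integral_sgn_kernel(2)[OF this w] show ?thesis
    unfolding eq by (simp add: algebra_simps)
qed

text \<open>
  The coefficients are integrated in \<open>k\<close> one by one. Compared with those of the entropy production,
  they contain in addition \<open>A\<close> times the entropy \<open>1\<close>, \<open>B\<close> times the equation, and the divergences of the two
  fields \<open>P(\<cdot>, R)\<close> and \<open>P(\<cdot>, -R)\<close>, all of which pair to zero with \<open>\<phi>\<close>.
\<close>

lemma Fourier_Kruzhkov:
  assumes \<phi>: "\<phi> \<in> Ckc 1 (Om I)"
  shows "set_integrable lborel {-R..R} (\<lambda>k. Kruzhkov_production I f g uo u k \<phi> * wave \<xi> k)"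
    and "(LINT k:{-R..R}|lborel. Kruzhkov_production I f g uo u k \<phi> * wave \<xi> k)
       = entropy_functional \<xi> (\<lambda>i. tilt \<xi> (fc i)) (\<lambda>i. tilt \<xi> (dfc i)) \<phi>"
proof -
  have k: "continuous_on UNIV (wave \<xi>)" by (intro continuous_on_wave continuous_on_id)
  have J: "({-R..R} \<times> S) \<subseteq> UNIV \<times> S" for S :: "'a set" by auto
  have Jb: "{-R..R} \<times> Om I \<in> sets borel" "{-R..R} \<times> (UNIV :: (real^'n) set) \<in> sets borel"
    using Om_borel by (auto intro: borel_Times)
  note lb = loc_bounded_subset[OF loc_bounded_kr(1)[OF k] J Jb(1)]
    loc_bounded_subset[OF loc_bounded_kr(2)[OF k] J Jb(1)]
    loc_bounded_subset[OF loc_bounded_kr(3)[OF k] J Jb(1)]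
    loc_bounded_subset[OF loc_bounded_kr(4)[OF k] J Jb(2)]
  note Fub = first_order_Fubini[where ?c1.0 = "\<lambda>k i p. kr1 k i p * wave \<xi> k",
      OF lb(1) lb(2) lb(3) lb(4) compact_Icc \<phi>,
      unfolded first_order_times_const, folded Kruzhkov_production_eq_first_order[OF \<phi>]]
  show "set_integrable lborel {-R..R} (\<lambda>k. Kruzhkov_production I f g uo u k \<phi> * wave \<xi> k)"
    by (rule Fub(1))
  define P where "P i = prim_u (\<lambda>q. fc i q * wave \<xi> (snd (snd q)))" for i
  define D where "D i = prim_u (\<lambda>q. dfc i q * wave \<xi> (snd (snd q)))" for i
  have reg: "regular_flux P D"
    unfolding regular_flux_def P_def D_def
    by (intro allI conjI continuous_on_prim_u has_pd_prim_u convex_closure convex_I continuous_on_times_wave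
        has_pd_times_wave continuous_fc) (use regular_fc in \<open>simp add: regular_flux_def\<close>)
  \<comment> \<open>The affine part \<open>A + B w\<close> by which the integral of \<open>\<bar>w - k\<bar> e(k)\<close> exceeds \<open>\<E>\<^sub>\<xi>(w)\<close>.\<close>
  define A where "A = prim (\<lambda>k. of_real k * wave \<xi> k) R + prim (\<lambda>k. of_real k * wave \<xi> k) (- R)"
  define B where "B = - prim (wave \<xi>) R - prim (wave \<xi>) (- R)"
  have I0: "(LINT k:{-R..R}|lborel. of_real (sgn (w - k)) * (of_real w - of_real k) * wave \<xi> k)
      = exp_entropy \<xi> w + A + B * of_real w" if w: "\<bar>w\<bar> \<le> R" for w
    using kr_kernel_integral[OF continuous_on_of_real[OF continuous_on_id] w, of "of_real w" \<xi>]
    unfolding exp_entropy_eq_prim A_def B_def by (simp add: mult.assoc algebra_simps)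
  have cont: "continuous_on UNIV (\<lambda>k. \<Phi> (fst p, snd p, k))"
    if "p \<in> Om I" "continuous_on (flux_dom I) \<Phi>" for p and \<Phi> :: "'n state \<Rightarrow> complex"
    using mem_flux_dom[OF that(1)]
    by (intro continuous_on_compose2[OF that(2)] continuous_intros) blast
  have I1: "(LINT k:{-R..R}|lborel. kr1 k i p * wave \<xi> k)
      = tilt \<xi> (fc i) (vu p) + B * fc i (vu p) + P i (fst p, snd p, R) + P i (fst p, snd p, - R)"
    if p: "p \<in> Om I" for i p
    using kr_kernel_integral[OF cont[OF p continuous_fc(1)[of i]] u_le[of p], of "fc i (vu p)" \<xi>]
    unfolding kr1_def tilt_def B_def P_def prim_u_def by (simp add: mult.assoc)
  have I2: "(LINT k:{-R..R}|lborel. kr2 k p * wave \<xi> k)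
      = ((\<Sum>i\<in>UNIV. tilt \<xi> (dfc i) (vu p)) - 2 * prim (wave \<xi>) (u p) * (\<Sum>i\<in>UNIV. dfc i (vu p))
        + 2 * prim (wave \<xi>) (u p) * gc (vu p)) + B * gc (vu p)
        + (\<Sum>i\<in>UNIV. D i (fst p, snd p, R)) + (\<Sum>i\<in>UNIV. D i (fst p, snd p, - R))"
    if p: "p \<in> Om I" for p
  proof -
    have c: "continuous_on UNIV (\<lambda>k. dfc i (fst p, snd p, k) * wave \<xi> k)" for i
      by (intro continuous_on_mult cont[OF p continuous_fc(2)] k)
    have D: "prim (\<lambda>k. (\<Sum>i\<in>UNIV. dfc i (fst p, snd p, k)) * wave \<xi> k) w = (\<Sum>i\<in>UNIV. D i (fst p, snd p, w))" for w
      unfolding sum_distrib_right D_def prim_u_def using c by (simp add: prim_sum)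
    have T: "(\<Sum>i\<in>UNIV. tilt \<xi> (dfc i) (vu p))
        = 2 * prim (wave \<xi>) (u p) * (\<Sum>i\<in>UNIV. dfc i (vu p)) - 2 * (\<Sum>i\<in>UNIV. D i (vu p))"
      by (simp add: tilt_def D_def sum_subtractf sum_distrib_left mult.assoc)
    have "continuous_on UNIV (\<lambda>k. \<Sum>i\<in>UNIV. dfc i (fst p, snd p, k))"
      by (intro continuous_on_sum cont[OF p continuous_fc(2)])
    from kr_kernel_integral[OF this u_le[of p], of "gc (vu p)" \<xi>]
    show ?thesis
      unfolding T kr2_def D B_def by (simp add: mult.assoc)
  qed
  note C0 = coeffs_std[of \<xi>]
  note C1 = coeffs_linear[OF C0 coeffs_const[of 1 0 0 1], of A]
  note C2 = coeffs_linear[OF C1 coeffs_solution, of B]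
  note C3 = coeffs_linear[OF C2 coeffs_regular_flux[OF reg, of R], of 1]
  let ?M = "entropy_functional \<xi> (\<lambda>i. tilt \<xi> (fc i)) (\<lambda>i. tilt \<xi> (dfc i)) \<phi>"
  have "(LINT k:{-R..R}|lborel. Kruzhkov_production I f g uo u k \<phi> * wave \<xi> k)
     = first_order (\<lambda>p. LINT k:{-R..R}|lborel. kr0 k p * wave \<xi> k)
         (\<lambda>i p. LINT k:{-R..R}|lborel. kr1 k i p * wave \<xi> k)
         (\<lambda>p. LINT k:{-R..R}|lborel. kr2 k p * wave \<xi> k)
         (\<lambda>x. LINT k:{-R..R}|lborel. kr3 k x * wave \<xi> k) \<phi>"
    by (rule Fub(2))
  also have "\<dots> = first_order
     (\<lambda>p. (((exp_entropy \<xi> (u p) + A * 1) + B * of_real (u p)) + 1 * 0) + 1 * 0)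
     (\<lambda>i p. (((tilt \<xi> (fc i) (vu p) + A * 0) + B * fc i (vu p)) + 1 * P i (fst p, snd p, R)) + 1 * P i (fst p, snd p, - R))
     (\<lambda>p. (((((\<Sum>i\<in>UNIV. tilt \<xi> (dfc i) (vu p)) - 2 * prim (wave \<xi>) (u p) * (\<Sum>i\<in>UNIV. dfc i (vu p))
        + 2 * prim (wave \<xi>) (u p) * gc (vu p)) + A * 0) + B * gc (vu p))
        + 1 * (\<Sum>i\<in>UNIV. D i (fst p, snd p, R))) + 1 * (\<Sum>i\<in>UNIV. D i (fst p, snd p, - R)))
     (\<lambda>x. (((exp_entropy \<xi> (uo x) + A * 1) + B * of_real (uo x)) + 1 * 0) + 1 * 0) \<phi>"
    unfolding mult_1 mult_1_right mult_zero_right add_0_right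
    by (rule first_order_cong) (simp_all only: I1 I2 kr0_def kr3_def I0[OF u_le] I0[OF uo_le])
  also have "\<dots> = (((?M + A * 0) + B * 0) + 1 * 0) + 1 * 0"
    unfolding first_order_linear[OF C3 coeffs_regular_flux[OF reg, of "- R"] \<phi>]
      first_order_linear[OF C2 coeffs_regular_flux[OF reg] \<phi>]
      first_order_linear[OF C1 coeffs_solution \<phi>] first_order_linear[OF C0 coeffs_const \<phi>]
      first_order_solution[OF \<phi>] first_order_time[OF \<phi>] first_order_divergence[OF reg \<phi>] ..
  finally show "(LINT k:{-R..R}|lborel. Kruzhkov_production I f g uo u k \<phi> * wave \<xi> k) = ?M"
    by simp
qed

text \<open>
  The production vanishes for \<open>\<bar>k\<bar> > R\<close>, so the integral over \<open>[-R, R]\<close> is the full one.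
\<close>

lemma integrable_Kruzhkov:
  assumes \<phi>: "\<phi> \<in> Ckc 1 (Om I)"
  shows "integrable lborel (\<lambda>k. Kruzhkov_production I f g uo u k \<phi> * wave \<xi> k)"
    and "(\<integral>k. Kruzhkov_production I f g uo u k \<phi> * wave \<xi> k \<partial>lborel)
       = entropy_functional \<xi> (\<lambda>i. tilt \<xi> (fc i)) (\<lambda>i. tilt \<xi> (dfc i)) \<phi>"
proof -
  have eq: "indicator {-R..R} k *\<^sub>R (Kruzhkov_production I f g uo u k \<phi> * wave \<xi> k)
      = Kruzhkov_production I f g uo u k \<phi> * wave \<xi> k" for k
    using Kruzhkov_production_eq_0[OF \<phi>, of k] by (auto simp: indicator_def)
  show "integrable lborel (\<lambda>k. Kruzhkov_production I f g uo u k \<phi> * wave \<xi> k)"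
    using Fourier_Kruzhkov(1)[OF \<phi>, of \<xi>] unfolding set_integrable_def eq .
  show "(\<integral>k. Kruzhkov_production I f g uo u k \<phi> * wave \<xi> k \<partial>lborel)
       = entropy_functional \<xi> (\<lambda>i. tilt \<xi> (fc i)) (\<lambda>i. tilt \<xi> (dfc i)) \<phi>"
    using Fourier_Kruzhkov(2)[OF \<phi>, of \<xi>] unfolding set_lebesgue_integral_def eq .
qed

lemma mu_hat_eq:
  assumes \<phi>: "\<phi> \<in> Ckc 1 (Om I)"
  shows "integrable lebesgue
      (\<lambda>k. Kruzhkov_production I f g uo u k \<phi> * exp (- \<i> * \<xi> * complex_of_real k))"
    and "mu_hat I f g uo u \<xi> \<phi>
      = (\<integral>k. Kruzhkov_production I f g uo u k \<phi> * exp (- \<i> * \<xi> * complex_of_real k) \<partial>lborel)"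
    and "mu_hat I f g uo u \<xi> \<phi> = entropy_functional \<xi> (\<lambda>i. tilt \<xi> (fc i)) (\<lambda>i. tilt \<xi> (dfc i)) \<phi>"
proof -
  note i = integrable_Kruzhkov(1)[OF \<phi>, of \<xi>, unfolded wave_def]
  show "integrable lebesgue
      (\<lambda>k. Kruzhkov_production I f g uo u k \<phi> * exp (- \<i> * \<xi> * complex_of_real k))"
    using i by (subst integrable_completion[OF borel_measurable_integrable[OF i]])
  show eq: "mu_hat I f g uo u \<xi> \<phi>
      = (\<integral>k. Kruzhkov_production I f g uo u k \<phi> * exp (- \<i> * \<xi> * complex_of_real k) \<partial>lborel)"
    unfolding mu_hat_def by (rule integral_completion[OF borel_measurable_integrable[OF i]])
  show "mu_hat I f g uo u \<xi> \<phi> = entropy_functional \<xi> (\<lambda>i. tilt \<xi> (fc i)) (\<lambda>i. tilt \<xi> (dfc i)) \<phi>"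
    unfolding eq using integrable_Kruzhkov(2)[OF \<phi>, of \<xi>] by (simp only: wave_def)
qed

lemma mu_hat_distribution: "distribution_on (Om I) (mu_hat I f g uo u \<xi>)"
  by (rule distribution_on_cong[OF thick_Om mu_hat_eq(3) distribution_on_first_order[OF coeffs_std]])

lemma mu_hat_holomorphic:
  assumes \<phi>: "\<phi> \<in> Ckc 1 (Om I)"
  shows "(\<lambda>\<xi>. mu_hat I f g uo u \<xi> \<phi>) holomorphic_on UNIV"
proof -
  have "integrable lborel (\<lambda>k. Kruzhkov_production I f g uo u k \<phi>)"
    using integrable_Kruzhkov(1)[OF \<phi>, of 0] by (simp add: wave_def)
  from holomorphic_Fourier_Laplace[OF this Kruzhkov_production_eq_0[OF \<phi>]]
  show ?thesis unfolding mu_hat_eq(2)[OF \<phi>] .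
qed

end

theorem proposition2p26:
  fixes I :: "real set"
    and f :: "real \<times> (real^'n) \<times> real \<Rightarrow> real^'n"
    and g :: "real \<times> (real^'n) \<times> real \<Rightarrow> real"
    and uo :: "real^'n \<Rightarrow> real"
    and u :: "real \<times> (real^'n) \<Rightarrow> real"
  assumes "I = {0..} \<or> (\<exists>T>0. I = {0..<T})"
    and "flux_class I f"
    and "continuous_on (closure I \<times> UNIV \<times> UNIV) g"
    and "Linfty lebesgue uo"
    and "Linfty (lebesgue_on (I \<times> UNIV)) u"
    and "distributional_solution I f g uo u"
  shows
    "((\<forall>\<xi>. \<forall>\<phi>\<in>test_functions (I \<times> UNIV).
         integrable lebesgue
           (\<lambda>k. Kruzhkov_production I f g uo u k \<phi> * exp (- \<i> * \<xi> * complex_of_real k)))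
      \<and> (\<forall>\<xi>. distribution_on (I \<times> UNIV) (mu_hat I f g uo u \<xi>))
      \<and> (\<forall>\<phi>\<in>test_functions (I \<times> UNIV). (\<lambda>\<xi>. mu_hat I f g uo u \<xi> \<phi>) holomorphic_on UNIV))
     \<and>
     (\<forall>\<xi>. (\<exists>F. entropy_pair I f (exp_entropy \<xi>) F)
        \<and> (\<forall>F. entropy_pair I f (exp_entropy \<xi>) F \<longrightarrow>
             (\<forall>\<phi>\<in>test_functions (I \<times> UNIV).
                mu_hat I f g uo u \<xi> \<phi>
                = entropy_production I f g uo u (exp_entropy \<xi>) F \<phi>)))"
proof -
  interpret time_domain I using assms(1) by unfold_locales
  obtain v R1 where "v \<in> borel_measurable borel \<and> (\<forall>p. \<bar>v p\<bar> \<le> R1)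
      \<and> (AE p in lebesgue. p \<in> Om I \<longrightarrow> u p = v p)"
    using ex_bounded_borel_AE_eq[OF Om_borel assms(5)] by (elim exE) (rule that)
  then have v: "v \<in> borel_measurable borel" "\<And>p. \<bar>v p\<bar> \<le> R1"
    and ae: "AE p in lebesgue. p \<in> Om I \<longrightarrow> u p = v p"
    by (simp_all del: split_paired_All)
  have "Linfty (lebesgue_on UNIV) uo"
    using assms(4) by (simp add: lebesgue_on_UNIV_eq)
  from ex_bounded_borel_AE_eq[OF _ this]
  obtain v0 R0 where "v0 \<in> borel_measurable borel \<and> (\<forall>x. \<bar>v0 x\<bar> \<le> R0)
      \<and> (AE x in lebesgue. x \<in> UNIV \<longrightarrow> uo x = v0 x)"
    by auto
  then have v0: "v0 \<in> borel_measurable borel" "\<And>x. \<bar>v0 x\<bar> \<le> R0"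
    and ae0: "AE x in lebesgue. uo x = v0 x" by simp_all
  \<comment> \<open>Every integral in the statement is unchanged when \<open>u\<close> and \<open>u\<^sub>o\<close> are replaced by \<open>v\<close> and \<open>v\<^sub>0\<close>.\<close>
  have bulk: "(LINT p:Om I|lebesgue. X p) = (LINT p:Om I|lebesgue. Y p)"
    if "\<And>p. u p = v p \<Longrightarrow> X p = Y p" for X Y :: "real \<times> (real^'n) \<Rightarrow> 'c::{banach, second_countable_topology}"
  proof (rule set_integral_cong_AE_lebesgue)
    show "AE p in lebesgue. p \<in> Om I \<longrightarrow> X p = Y p"
      using ae by eventually_elim (intro impI that, erule mp)
  qed
  have trace: "(LINT x|lebesgue. X x) = (LINT x|lebesgue. Y x)"
    if "\<And>x. uo x = v0 x \<Longrightarrow> X x = Y x" for X Y :: "real^'n \<Rightarrow> 'c::{banach, second_countable_topology}"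
  proof (rule completion.integral_cong_AE')
    show "AE x in lebesgue. X x = Y x"
      using ae0 by eventually_elim (rule that)
  qed
  have Kr: "Kruzhkov_production I f g uo u = Kruzhkov_production I f g v0 v"
    unfolding Kruzhkov_production_def fun_eq_iff
    by (intro allI arg_cong2[where f = "(+)"] arg_cong2[where f = "(-)"] bulk trace) (auto simp: case_prod_beta')
  have mu: "mu_hat I f g uo u = mu_hat I f g v0 v"
    by (simp add: mu_hat_def Kr fun_eq_iff)
  have en: "entropy_production I f g uo u = entropy_production I f g v0 v"
    unfolding entropy_production_def fun_eq_iff
    by (intro allI arg_cong2[where f = "(+)"] arg_cong2[where f = "(-)"] bulk trace) (auto simp: case_prod_beta')
  have sol: "distributional_solution I f g v0 v"
    unfolding distributional_solution_def
  proof (intro allI impI)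
    fix \<phi> :: "real \<times> (real^'n) \<Rightarrow> real" assume \<phi>: "\<phi> \<in> Ckc 1 (Om I)"
    have "(LINT (t, x):Om I|lebesgue. v (t, x) * dt I \<phi> (t, x)
            + (\<Sum>i\<in>UNIV. f (t, x, v (t, x)) $ i * dx I i \<phi> (t, x)))
        + (LINT (t, x):Om I|lebesgue. g (t, x, v (t, x)) * \<phi> (t, x))
        + (LINT x|lebesgue. v0 x * \<phi> (0, x))
      = (LINT (t, x):Om I|lebesgue. u (t, x) * dt I \<phi> (t, x)
            + (\<Sum>i\<in>UNIV. f (t, x, u (t, x)) $ i * dx I i \<phi> (t, x)))
        + (LINT (t, x):Om I|lebesgue. g (t, x, u (t, x)) * \<phi> (t, x))
        + (LINT x|lebesgue. uo x * \<phi> (0, x))"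
      by (intro arg_cong2[where f = "(+)"] bulk[symmetric] trace[symmetric]) (auto simp: case_prod_beta')
    also have "\<dots> = 0"
      using assms(6) \<phi> unfolding distributional_solution_def by blast
    finally show "(LINT (t, x):Om I|lebesgue. v (t, x) * dt I \<phi> (t, x)
            + (\<Sum>i\<in>UNIV. f (t, x, v (t, x)) $ i * dx I i \<phi> (t, x)))
        + (LINT (t, x):Om I|lebesgue. g (t, x, v (t, x)) * \<phi> (t, x))
        + (LINT x|lebesgue. v0 x * \<phi> (0, x)) = 0" .
  qed
  interpret balance_law I f g v0 v "max R0 R1"
    by unfold_locales (use assms(2,3) v v0 sol in \<open>auto simp: le_max_iff_disj\<close>)
  have t: "\<phi> \<in> Ckc 1 (Om I)" if "\<phi> \<in> test_functions (Om I)" for \<phi> :: "real \<times> (real^'n) \<Rightarrow> complex"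
    using that by (rule test_functions_imp_Ckc)
  show ?thesis
    unfolding Kr mu en
  proof (intro conjI allI ballI impI)
    fix \<xi> show "\<exists>F. entropy_pair I f (exp_entropy \<xi>) F"
      using entropy_pair_std_flux by blast
  next
    fix \<xi> F and \<phi> :: "real \<times> (real^'n) \<Rightarrow> complex"
    assume F: "entropy_pair I f (exp_entropy \<xi>) F" and \<phi>: "\<phi> \<in> test_functions (Om I)"
    show "mu_hat I f g v0 v \<xi> \<phi> = entropy_production I f g v0 v (exp_entropy \<xi>) F \<phi>"
      unfolding mu_hat_eq(3)[OF t[OF \<phi>]] entropy_production_eq_std[OF F t[OF \<phi>]] ..
  qed (assumption | rule mu_hat_eq(1) mu_hat_distribution mu_hat_holomorphic t)+
qed

end
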